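(* When all the nodes have unit weight ($w_i=1$ for all $i$), the tree partition problem (defined in the context) can be solved in $O(w_0n^2)$ time, where $n$ is the number of nodes.
   Context: Tree partition problem (optimization form): given a tree with nodes $1,\ldots,n$, where node $i$ has a weight $w_i\ge0$ and a parameter $s_i\ge0$, and a threshold $w_0$, partition the node set into connected components such that each component has total weight at most $w_0$, minimizing the sum over components of the largest $s_i$ in the component. *)

theory Defs
  imports Complex_Main "HOL-Library.Disjoint_Sets"
begin

section \<open>Tree partition\<close>

text \<open>A graph on a vertex set \<open>V\<close> is given by its set \<open>E\<close> of undirected edges, each a two-element
  subset of \<open>V\<close>.\<close>

definition connected_in :: "nat set set \<Rightarrow> nat set \<Rightarrow> bool" where
  "connected_in E X \<longleftrightarrow>
     X \<noteq> {} \<and> (\<forall>x\<in>X. \<forall>y\<in>X. (x, y) \<in> {(a, b). a \<in> X \<and> b \<in> X \<and> {a, b} \<in> E}\<^sup>*)"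

definition is_cycle :: "nat set set \<Rightarrow> nat list \<Rightarrow> bool" where
  "is_cycle E xs \<longleftrightarrow>
     length xs \<ge> 3 \<and> distinct xs \<and> successively (\<lambda>a b. {a, b} \<in> E) xs \<and> {last xs, hd xs} \<in> E"

definition is_tree :: "nat set \<Rightarrow> nat set set \<Rightarrow> bool" where
  "is_tree V E \<longleftrightarrow>
     finite V \<and> (\<forall>e\<in>E. e \<subseteq> V \<and> card e = 2) \<and> connected_in E V \<and> (\<nexists>xs. is_cycle E xs)"

definition instance_ok :: "nat \<Rightarrow> nat set set \<Rightarrow> (nat \<Rightarrow> real) \<Rightarrow> (nat \<Rightarrow> real) \<Rightarrow> bool" where
  "instance_ok n E w s \<longleftrightarrow> is_tree {1..n} E \<and> (\<forall>i\<in>{1..n}. w i \<ge> 0 \<and> s i \<ge> 0)"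

definition feasible ::
  "nat \<Rightarrow> nat set set \<Rightarrow> (nat \<Rightarrow> real) \<Rightarrow> real \<Rightarrow> nat set set \<Rightarrow> bool" where
  "feasible n E w w0 P \<longleftrightarrow>
     partition_on {1..n} P \<and> (\<forall>K\<in>P. connected_in E K \<and> (\<Sum>i\<in>K. w i) \<le> w0)"

definition partition_cost :: "(nat \<Rightarrow> real) \<Rightarrow> nat set set \<Rightarrow> real" where
  "partition_cost s P = (\<Sum>K\<in>P. Max (s ` K))"

definition optimal_partition ::
  "nat \<Rightarrow> nat set set \<Rightarrow> (nat \<Rightarrow> real) \<Rightarrow> (nat \<Rightarrow> real) \<Rightarrow> real \<Rightarrow> nat set set \<Rightarrow> bool" where
  "optimal_partition n E w s w0 P \<longleftrightarrow> is_arg_min (partition_cost s) (feasible n E w w0) P"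


section \<open>Machine model\<close>

text \<open>
  A unit-cost RAM, written as structured programs. The memory consists of named arrays of unbounded
  length, some holding natural numbers and some holding real numbers; a program mentions only
  finitely many of them, and a scalar variable is an array of which only cell 0 is used.
  Natural numbers can be added, subtracted (truncating at 0), compared, and used as
  addresses; real numbers can only be added, compared, and copied. There is neither
  multiplication nor rounding of reals. Hence a step lengthens the numbers stored by a constant number
  of bits at most, and unit cost is a realistic measure.

  Each assignment and each evaluation of a guard is one step. The expressions in a program are
  part of that program, so charging for every operator and memory access inside an
  expression would change the running time of a program by a constant factor only.
\<close>

type_synonym aname = string

record memory =
  nmem :: "aname \<Rightarrow> nat \<Rightarrow> nat"
  rmem :: "aname \<Rightarrow> nat \<Rightarrow> real"

datatype nexp =
    NConst nat
  | NCell aname nexp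
  | NAdd nexp nexp
  | NSub nexp nexp

datatype rexp =
    RConst nat
  | RCell aname nexp
  | RAdd rexp rexp

datatype bexp =
    NLess nexp nexp
  | NEq nexp nexp
  | RLess rexp rexp
  | Not bexp
  | And bexp bexp

datatype com =
    Skip
  | NAssign aname nexp nexp
  | RAssign aname nexp rexp
  | Seq com com
  | If bexp com com
  | While bexp com

fun nval :: "nexp \<Rightarrow> memory \<Rightarrow> nat" where
  "nval (NConst k) \<sigma> = k"
| "nval (NCell a i) \<sigma> = nmem \<sigma> a (nval i \<sigma>)"
| "nval (NAdd x y) \<sigma> = nval x \<sigma> + nval y \<sigma>"
| "nval (NSub x y) \<sigma> = nval x \<sigma> - nval y \<sigma>"

fun rval :: "rexp \<Rightarrow> memory \<Rightarrow> real" where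
  "rval (RConst k) \<sigma> = real k"
| "rval (RCell a i) \<sigma> = rmem \<sigma> a (nval i \<sigma>)"
| "rval (RAdd x y) \<sigma> = rval x \<sigma> + rval y \<sigma>"

fun bval :: "bexp \<Rightarrow> memory \<Rightarrow> bool" where
  "bval (NLess x y) \<sigma> \<longleftrightarrow> nval x \<sigma> < nval y \<sigma>"
| "bval (NEq x y) \<sigma> \<longleftrightarrow> nval x \<sigma> = nval y \<sigma>"
| "bval (RLess x y) \<sigma> \<longleftrightarrow> rval x \<sigma> < rval y \<sigma>"
| "bval (Not b) \<sigma> \<longleftrightarrow> \<not> bval b \<sigma>"
| "bval (And b c) \<sigma> \<longleftrightarrow> bval b \<sigma> \<and> bval c \<sigma>"

definition nwrite :: "aname \<Rightarrow> nat \<Rightarrow> nat \<Rightarrow> memory \<Rightarrow> memory" where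
  "nwrite a i x \<sigma> = \<sigma>\<lparr>nmem := (nmem \<sigma>)(a := (nmem \<sigma> a)(i := x))\<rparr>"

definition rwrite :: "aname \<Rightarrow> nat \<Rightarrow> real \<Rightarrow> memory \<Rightarrow> memory" where
  "rwrite a i x \<sigma> = \<sigma>\<lparr>rmem := (rmem \<sigma>)(a := (rmem \<sigma> a)(i := x))\<rparr>"

text \<open>\<open>runs c \<sigma> t \<tau>\<close>: started in memory \<open>\<sigma>\<close>, the program \<open>c\<close> halts after \<open>t\<close> steps in memory \<open>\<tau>\<close>.\<close>

inductive runs :: "com \<Rightarrow> memory \<Rightarrow> nat \<Rightarrow> memory \<Rightarrow> bool" where
  Skip: "runs Skip \<sigma> 0 \<sigma>"
| NAssign: "runs (NAssign a i x) \<sigma> 1 (nwrite a (nval i \<sigma>) (nval x \<sigma>) \<sigma>)"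
| RAssign: "runs (RAssign a i x) \<sigma> 1 (rwrite a (nval i \<sigma>) (rval x \<sigma>) \<sigma>)"
| Seq: "runs c \<sigma> t \<sigma>' \<Longrightarrow> runs d \<sigma>' u \<sigma>'' \<Longrightarrow> runs (Seq c d) \<sigma> (t + u) \<sigma>''"
| IfTrue: "bval b \<sigma> \<Longrightarrow> runs c \<sigma> t \<sigma>' \<Longrightarrow> runs (If b c d) \<sigma> (t + 1) \<sigma>'"
| IfFalse: "\<not> bval b \<sigma> \<Longrightarrow> runs d \<sigma> t \<sigma>' \<Longrightarrow> runs (If b c d) \<sigma> (t + 1) \<sigma>'"
| WhileFalse: "\<not> bval b \<sigma> \<Longrightarrow> runs (While b c) \<sigma> 1 \<sigma>"
| WhileTrue: "bval b \<sigma> \<Longrightarrow> runs c \<sigma> t \<sigma>' \<Longrightarrow> runs (While b c) \<sigma>' u \<sigma>'' \<Longrightarrow>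
    runs (While b c) \<sigma> (t + u + 1) \<sigma>''"

inductive_cases SkipE: "runs Skip \<sigma> t \<tau>"
inductive_cases NAssignE: "runs (NAssign a i x) \<sigma> t \<tau>"
inductive_cases RAssignE: "runs (RAssign a i x) \<sigma> t \<tau>"
inductive_cases SeqE: "runs (Seq c d) \<sigma> t \<tau>"
inductive_cases IfE: "runs (If b c d) \<sigma> t \<tau>"
inductive_cases WhileE: "runs (While b c) \<sigma> t \<tau>"

lemma runs_deterministic:
  "runs c \<sigma> t \<tau> \<Longrightarrow> runs c \<sigma> t' \<tau>' \<Longrightarrow> t' = t \<and> \<tau>' = \<tau>"
proof (induction arbitrary: t' \<tau>' rule: runs.induct)
  case (WhileTrue b \<sigma> c t \<sigma>' u \<sigma>'')
  from WhileTrue.prems WhileTrue.hyps(1) obtain t1 \<rho> u1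
    where "t' = t1 + u1 + 1" "runs c \<sigma> t1 \<rho>" "runs (While b c) \<rho> u1 \<tau>'"
    by (auto elim: WhileE)
  with WhileTrue.IH show ?case by blast
next
  case (Seq c \<sigma> t \<sigma>' d u \<sigma>'')
  from Seq.prems obtain t1 \<rho> u1
    where "t' = t1 + u1" "runs c \<sigma> t1 \<rho>" "runs d \<rho> u1 \<tau>'"
    by (auto elim: SeqE)
  with Seq.IH show ?case by blast
next
  case (IfTrue b \<sigma> c t \<sigma>' d)
  from IfTrue.prems IfTrue.hyps(1) obtain t1 where "t' = t1 + 1" "runs c \<sigma> t1 \<tau>'"
    by (auto elim: IfE)
  with IfTrue.IH show ?case by blast
next
  case (IfFalse b \<sigma> d t \<sigma>' c)
  from IfFalse.prems IfFalse.hyps(1) obtain t1 where "t' = t1 + 1" "runs d \<sigma> t1 \<tau>'"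
    by (auto elim: IfE)
  with IfFalse.IH show ?case by blast
qed (auto elim: SkipE NAssignE RAssignE WhileE)


section \<open>Solving tree partition on the machine\<close>

text \<open>The edges of the tree are presented as a list, in an arbitrary order and with
  arbitrarily ordered end points.\<close>

definition lists_edges :: "(nat \<times> nat) list \<Rightarrow> nat set set \<Rightarrow> bool" where
  "lists_edges es E \<longleftrightarrow>
     distinct (map (\<lambda>(u, v). {u, v}) es) \<and> set (map (\<lambda>(u, v). {u, v}) es) = E"

text \<open>Edge number \<open>k\<close>, counted from 0, has its end points in \<open>u[k]\<close> and \<open>v[k]\<close>. All cells that
  do not carry input are 0.\<close>

definition input_memory ::
  "nat \<Rightarrow> (nat \<times> nat) list \<Rightarrow> (nat \<Rightarrow> real) \<Rightarrow> (nat \<Rightarrow> real) \<Rightarrow> real \<Rightarrow> memory" where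
  "input_memory n es w s w0 =
     \<lparr>nmem = (\<lambda>_ _. 0)
        (''n'' := (\<lambda>_. 0)(0 := n),
         ''u'' := (\<lambda>k. if k < length es then fst (es ! k) else 0),
         ''v'' := (\<lambda>k. if k < length es then snd (es ! k) else 0)),
      rmem = (\<lambda>_ _. 0)
        (''w0'' := (\<lambda>_. 0)(0 := w0),
         ''w'' := (\<lambda>i. if i \<in> {1..n} then w i else 0),
         ''s'' := (\<lambda>i. if i \<in> {1..n} then s i else 0))\<rparr>"

text \<open>A partition is output as an array \<open>comp\<close> of labels: two nodes belong to the same component iff
  they carry the same label. The flag \<open>feasible\<close> tells whether there is a feasible partition.\<close>

definition output_partition :: "nat \<Rightarrow> memory \<Rightarrow> nat set set" where
  "output_partition n \<tau> =
     (\<lambda>i. {j \<in> {1..n}. nmem \<tau> ''comp'' j = nmem \<tau> ''comp'' i}) ` {1..n}"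

definition correct_output ::
  "nat \<Rightarrow> nat set set \<Rightarrow> (nat \<Rightarrow> real) \<Rightarrow> (nat \<Rightarrow> real) \<Rightarrow> real \<Rightarrow> memory \<Rightarrow> bool" where
  "correct_output n E w s w0 \<tau> \<longleftrightarrow>
     (if \<exists>P. feasible n E w w0 P
      then nmem \<tau> ''feasible'' 0 = 1 \<and> optimal_partition n E w s w0 (output_partition n \<tau>)
      else nmem \<tau> ''feasible'' 0 = 0)"

definition solves_within ::
  "com \<Rightarrow> real \<Rightarrow> nat \<Rightarrow> nat set set \<Rightarrow> (nat \<times> nat) list \<Rightarrow> (nat \<Rightarrow> real) \<Rightarrow> (nat \<Rightarrow> real) \<Rightarrow> real \<Rightarrow> bool"
where
  "solves_within prog T n E es w s w0 \<longleftrightarrow>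
     (\<exists>t \<tau>. runs prog (input_memory n es w s w0) t \<tau> \<and> real t \<le> T \<and> correct_output n E w s w0 \<tau>)"

end

theory Submission
  imports Defs
begin

text \<open>
  Number the nodes \<open>0, \<dots>, n - 1\<close> so that the parent of \<open>i > 0\<close> has a smaller number than \<open>i\<close>, and let
  \<open>W = min n \<lfloor>w0\<rfloor>\<close>. For a guessed threshold \<open>S m\<close>, the open component containing \<open>v\<close> is charged
  the penalty \<open>S u\<close> for each of its nodes \<open>u\<close> with \<open>S u > S m\<close>. Then \<open>S m\<close> plus the penalties is
  an upper bound for the maximum of \<open>S\<close> on the component, and equals it for the best \<open>m\<close>, so no infinite
  values are needed. Let \<open>V v m k\<close> be the least cost of partitioning what has been merged into \<open>v\<close> so far,
  where the component of \<open>v\<close> has exactly \<open>k\<close> nodes and is charged only its penalties for \<open>m\<close>.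
  The nodes \<open>n - 1, \<dots>, 1\<close> are merged into their parents in this order: either the edge is cut and
  \<open>G i = Min {S m + V i m k}\<close> is paid, or the sizes of the two components add up.

  Merging \<open>i\<close> into \<open>p\<close> costs \<open>O(n \<cdot> min W a \<cdot> min W b)\<close> steps, where \<open>a\<close> and \<open>b\<close> are the
  numbers of nodes merged into \<open>p\<close> and \<open>i\<close>. A potential \<open>pot a\<close> which is \<open>a\<^sup>2\<close> up to \<open>W\<close> and continues
  linearly with slope \<open>2 W\<close> absorbs the product, whence \<open>O(W n\<^sup>2)\<close> steps in total.
\<close>

section \<open>Weakest preconditions with running times\<close>

text \<open>The maximum over a component is not additive under merging, hence the guess of a
  threshold. Forbidding nodes above the guess would need infinite entries, which the machine lacks;
  penalties keep every entry finite, at the price that a wrong guess may overestimate the cost. This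
  is harmless because the table is never compared with a recursively defined optimum. It is
  specified by inequalities, which make \<open>G 0\<close> a lower bound for the cost of every
  feasible partition, and by an attaining choice for each entry, which yields a partition costing at
  most \<open>G 0\<close>. Connectedness is made local by the rooted order: a component is connected
  iff each of its nodes, except the one with the smallest number, lies in the same component as its
  parent.\<close>

definition wp :: "com \<Rightarrow> memory \<Rightarrow> (nat \<Rightarrow> memory \<Rightarrow> bool) \<Rightarrow> bool" where
  "wp c \<sigma> Q \<longleftrightarrow> (\<exists>t \<tau>. runs c \<sigma> t \<tau> \<and> Q t \<tau>)"

lemma wp_Skip [simp]: "wp Skip \<sigma> Q \<longleftrightarrow> Q 0 \<sigma>"
  by (auto simp: wp_def elim: SkipE intro: runs.Skip)

lemma wp_NAssign [simp]:
  "wp (NAssign a i x) \<sigma> Q \<longleftrightarrow> Q 1 (nwrite a (nval i \<sigma>) (nval x \<sigma>) \<sigma>)"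
  unfolding wp_def by (metis NAssignE runs.NAssign)

lemma wp_RAssign [simp]:
  "wp (RAssign a i x) \<sigma> Q \<longleftrightarrow> Q 1 (rwrite a (nval i \<sigma>) (rval x \<sigma>) \<sigma>)"
  unfolding wp_def by (metis RAssignE runs.RAssign)

lemma wp_Seq [simp]: "wp (Seq c d) \<sigma> Q \<longleftrightarrow> wp c \<sigma> (\<lambda>t \<tau>. wp d \<tau> (\<lambda>u. Q (t + u)))"
  unfolding wp_def by (blast elim: SeqE intro: runs.Seq)

lemma wp_If [simp]:
  "wp (If b c d) \<sigma> Q \<longleftrightarrow> (if bval b \<sigma> then wp c \<sigma> (\<lambda>t. Q (t + 1)) else wp d \<sigma> (\<lambda>t. Q (t + 1)))"
  unfolding wp_def by (cases "bval b \<sigma>") (auto elim!: IfE; metis Suc_eq_plus1 runs.IfTrue runs.IfFalse)+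

lemma wp_mono: "wp c \<sigma> P \<Longrightarrow> (\<And>t \<tau>. P t \<tau> \<Longrightarrow> Q t \<tau>) \<Longrightarrow> wp c \<sigma> Q"
  unfolding wp_def by blast

lemma nmem_nwrite [simp]: "nmem (nwrite a i x \<sigma>) = (nmem \<sigma>)(a := (nmem \<sigma> a)(i := x))"
  and rmem_nwrite [simp]: "rmem (nwrite a i x \<sigma>) = rmem \<sigma>"
  and nmem_rwrite [simp]: "nmem (rwrite a i y \<sigma>) = nmem \<sigma>"
  and rmem_rwrite [simp]: "rmem (rwrite a i y \<sigma>) = (rmem \<sigma>)(a := (rmem \<sigma> a)(i := y))"
  by (simp_all add: nwrite_def rwrite_def)

fun nmods :: "com \<Rightarrow> aname set" where
  "nmods (NAssign a _ _) = {a}"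
| "nmods (Seq c d) = nmods c \<union> nmods d"
| "nmods (If _ c d) = nmods c \<union> nmods d"
| "nmods (While _ c) = nmods c"
| "nmods _ = {}"

fun rmods :: "com \<Rightarrow> aname set" where
  "rmods (RAssign a _ _) = {a}"
| "rmods (Seq c d) = rmods c \<union> rmods d"
| "rmods (If _ c d) = rmods c \<union> rmods d"
| "rmods (While _ c) = rmods c"
| "rmods _ = {}"

definition frame :: "com \<Rightarrow> memory \<Rightarrow> memory \<Rightarrow> bool" where
  "frame c \<sigma> \<tau> \<longleftrightarrow> (\<forall>a. a \<notin> nmods c \<longrightarrow> nmem \<tau> a = nmem \<sigma> a) \<and>
     (\<forall>a. a \<notin> rmods c \<longrightarrow> rmem \<tau> a = rmem \<sigma> a)"

lemma frame_nmem: "frame c \<sigma> \<tau> \<Longrightarrow> a \<notin> nmods c \<Longrightarrow> nmem \<tau> a = nmem \<sigma> a"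
  and frame_rmem: "frame c \<sigma> \<tau> \<Longrightarrow> a \<notin> rmods c \<Longrightarrow> rmem \<tau> a = rmem \<sigma> a"
  by (auto simp: frame_def)

lemma runs_frame: "runs c \<sigma> t \<tau> \<Longrightarrow> frame c \<sigma> \<tau>"
  by (induction rule: runs.induct) (auto simp: frame_def)

lemma wp_frame: "wp c \<sigma> P \<Longrightarrow> (\<And>t \<tau>. P t \<tau> \<Longrightarrow> frame c \<sigma> \<tau> \<Longrightarrow> Q t \<tau>) \<Longrightarrow> wp c \<sigma> Q"
  unfolding wp_def using runs_frame by blast

text \<open>\<open>N\<close> is the number of iterations, fixed beforehand, and \<open>j\<close>
  counts those already made. The \<open>frame\<close> relative to the memory before the loop lets
  \<open>I\<close> speak only of arrays that the loop writes. The sum charges one step for each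
  successful guard, and the last 1 pays for the failing one.\<close>

lemma wp_for:
  fixes N :: nat
  assumes "I 0 \<sigma>"
    and guard: "\<And>j \<tau>. I j \<tau> \<Longrightarrow> frame c \<sigma> \<tau> \<Longrightarrow> j \<le> N \<Longrightarrow> bval b \<tau> \<longleftrightarrow> j < N"
    and body: "\<And>j \<tau>. I j \<tau> \<Longrightarrow> frame c \<sigma> \<tau> \<Longrightarrow> j < N \<Longrightarrow> wp c \<tau> (\<lambda>t \<rho>. t \<le> T j \<and> I (Suc j) \<rho>)"
    and post: "\<And>t \<tau>. t \<le> (\<Sum>j<N. T j + 1) + 1 \<Longrightarrow> I N \<tau> \<Longrightarrow> frame c \<sigma> \<tau> \<Longrightarrow> Q t \<tau>"
  shows "wp (While b c) \<sigma> Q"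
proof -
  have "\<exists>t \<rho>. runs (While b c) \<tau> t \<rho> \<and> t \<le> (\<Sum>i=j..<N. T i + 1) + 1 \<and> I N \<rho> \<and> frame c \<sigma> \<rho>"
    if "j \<le> N" "I j \<tau>" "frame c \<sigma> \<tau>" for j \<tau>
    using that
  proof (induction j arbitrary: \<tau> rule: inc_induct)
    case base
    then have "\<not> bval b \<tau>" using guard by blast
    with base show ?case using runs.WhileFalse by fastforce
  next
    case (step j)
    then have b: "bval b \<tau>" using guard by simp
    obtain t \<tau>' where t: "runs c \<tau> t \<tau>'" "t \<le> T j" "I (Suc j) \<tau>'"
      using body[of j \<tau>] step by (auto simp: wp_def)
    have "frame c \<sigma> \<tau>'"
      using step.prems(2) runs_frame[OF t(1)] by (auto simp: frame_def)
    with step.IH t(3) obtain u \<rho> where u: "runs (While b c) \<tau>' u \<rho>"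
      "u \<le> (\<Sum>i=Suc j..<N. T i + 1) + 1" "I N \<rho>" "frame c \<sigma> \<rho>" by blast
    have "runs (While b c) \<tau> (t + u + 1) \<rho>" using runs.WhileTrue b t(1) u(1) by blast
    moreover have "t + u + 1 \<le> (\<Sum>i=j..<N. T i + 1) + 1"
      using t(2) u(2) step.hyps sum.atLeast_Suc_lessThan[of j N "\<lambda>i. T i + 1"] by simp
    ultimately show ?case using u(3,4) by blast
  qed
  from this[of 0 \<sigma>] assms(1) obtain t \<rho> where "runs (While b c) \<sigma> t \<rho>"
    "t \<le> (\<Sum>i<N. T i + 1) + 1" "I N \<rho>" "frame c \<sigma> \<rho>"
    by (auto simp: frame_def atLeast0LessThan)
  then show ?thesis using post by (auto simp: wp_def)
qed

section \<open>Trees and rooted orders\<close>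

lemma distinct_path:
  assumes "(a, b) \<in> {(x, y). {x, y} \<in> F}\<^sup>*"
  obtains xs where "xs \<noteq> []" "hd xs = a" "last xs = b" "distinct xs"
    "successively (\<lambda>x y. {x, y} \<in> F) xs"
proof -
  from assms have "\<exists>xs. xs \<noteq> [] \<and> hd xs = a \<and> last xs = b \<and> distinct xs \<and>
      successively (\<lambda>x y. {x, y} \<in> F) xs"
  proof (induction rule: converse_rtrancl_induct)
    case base
    show ?case by (intro exI[of _ "[b]"]) simp
  next
    case (step a y)
    then obtain xs where xs: "xs \<noteq> []" "hd xs = y" "last xs = b" "distinct xs"
      "successively (\<lambda>x y. {x, y} \<in> F) xs" by blast
    show ?case
    proof (cases "a \<in> set xs")
      case True
      \<comment> \<open>A revisit of \<open>a\<close> is removed by cutting off the loop, that is,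
        everything before \<open>a\<close>.\<close>
      then obtain us vs where "xs = us @ a # vs" by (meson split_list)
      with xs show ?thesis
        by (intro exI[of _ "a # vs"]) (auto simp: successively_append_iff)
    next
      case False
      with xs step.hyps(1) show ?thesis
        by (intro exI[of _ "a # xs"]) (cases xs; auto)
    qed
  qed
  with that show ?thesis by blast
qed

text \<open>Otherwise a simple \<open>F\<close>-path from \<open>a\<close> to \<open>b\<close> has
  an inner node, because \<open>{a, b}\<close> is not in \<open>F\<close>, and the edge
  \<open>{a, b}\<close> closes it to a cycle.\<close>

lemma acyclic_edge_in_spanning_subgraph:
  assumes "\<nexists>xs. is_cycle E xs" "F \<subseteq> E" "{a, b} \<in> E" "a \<noteq> b" "(a, b) \<in> {(x, y). {x, y} \<in> F}\<^sup>*"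
  shows "{a, b} \<in> F"
proof (rule ccontr)
  assume nF: "{a, b} \<notin> F"
  obtain xs where xs: "xs \<noteq> []" "hd xs = a" "last xs = b" "distinct xs"
    "successively (\<lambda>x y. {x, y} \<in> F) xs"
    using distinct_path[OF assms(5)] .
  have "length xs \<ge> 3"
  proof (rule ccontr)
    assume "\<not> length xs \<ge> 3"
    then have "length xs = 0 \<or> length xs = 1 \<or> length xs = 2" by arith
    with xs assms(4) nF show False by (auto simp: length_Suc_conv numeral_2_eq_2)
  qed
  moreover have "successively (\<lambda>x y. {x, y} \<in> E) xs"
    using xs(5) assms(2) by (auto intro: successively_mono)
  ultimately have "is_cycle E xs"
    using xs assms(3) by (simp add: is_cycle_def insert_commute)
  with assms(1) show False by blast
qed

lemma connected_in_crossing: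
  assumes "connected_in E V" "X \<subseteq> V" "X \<noteq> {}" "X \<noteq> V"
  obtains x y where "x \<in> X" "y \<in> V - X" "{x, y} \<in> E"
proof -
  obtain a b where ab: "a \<in> X" "b \<in> V" "b \<notin> X" using assms by blast
  have "(a, b) \<in> {(a, b). a \<in> V \<and> b \<in> V \<and> {a, b} \<in> E}\<^sup>*"
    using assms ab by (auto simp: connected_in_def)
  then have "b \<in> X \<or> (\<exists>x\<in>X. \<exists>y\<in>V - X. {x, y} \<in> E)"
    by (induction rule: rtrancl_induct) (use ab in auto)
  with ab that show ?thesis by blast
qed

text \<open>A rooted tree encoded by a numbering with root 0; \<open>pp\<close> acts on numbers, not
  on nodes. Only the parent edges are asked to lie in \<open>E\<close>; in a tree they turn out to
  be all the edges.\<close>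

definition rooted_order :: "nat \<Rightarrow> nat set set \<Rightarrow> (nat \<Rightarrow> nat) \<Rightarrow> (nat \<Rightarrow> nat) \<Rightarrow> bool" where
  "rooted_order n E ord pp \<longleftrightarrow> bij_betw ord {..<n} {1..n} \<and>
     (\<forall>i. 0 < i \<and> i < n \<longrightarrow> pp i < i \<and> {ord i, ord (pp i)} \<in> E)"

lemma rooted_order_parent:
  assumes "rooted_order n E ord pp" "0 < i" "i < n"
  shows "pp i < i" "{ord i, ord (pp i)} \<in> E"
proof -
  have "\<forall>i. 0 < i \<and> i < n \<longrightarrow> pp i < i \<and> {ord i, ord (pp i)} \<in> E"
    using assms(1) unfolding rooted_order_def by (rule conjunct2)
  from spec[OF this, of i] assms(2,3) show "pp i < i" "{ord i, ord (pp i)} \<in> E" by iprover+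
qed

text \<open>The parent edges alone join every node to the root, so an edge outside them would close
  a cycle.\<close>

lemma rooted_order_edges:
  assumes tree: "is_tree {1..n} E" and ro: "rooted_order n E ord pp"
  shows "E = (\<lambda>i. {ord i, ord (pp i)}) ` {0<..<n}"
proof
  let ?F = "(\<lambda>i. {ord i, ord (pp i)}) ` {0<..<n}"
  let ?R = "{(x, y). {x, y} \<in> ?F}"
  show FE: "?F \<subseteq> E"
    by (rule image_subsetI) (rule rooted_order_parent(2)[OF ro], simp_all)
  have root: "(ord i, ord 0) \<in> ?R\<^sup>*" if "i < n" for i
    using that
  proof (induction i rule: less_induct)
    case (less i)
    show ?case
    proof (cases "i = 0")
      case False
      with less.prems have p: "pp i < i" using rooted_order_parent(1)[OF ro] by simp
      have "(ord (pp i), ord 0) \<in> ?R\<^sup>*" by (rule less.IH) (use p less.prems in simp_all)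
      moreover have "{ord i, ord (pp i)} \<in> ?F" by (rule imageI) (use less.prems False in simp)
      then have "(ord i, ord (pp i)) \<in> ?R" by simp
      ultimately      show ?thesis by (rule converse_rtrancl_into_rtrancl[rotated])
    qed simp
  qed
  have "sym ?R" by (rule symI) (simp add: insert_commute)
  then have symR: "sym (?R\<^sup>*)" by (rule sym_rtrancl)
  show "E \<subseteq> ?F"
  proof
    fix e assume e: "e \<in> E"
    then have "card e = 2" and eV: "e \<subseteq> {1..n}" using tree unfolding is_tree_def by blast+
    then obtain a b where ab: "e = {a, b}" "a \<noteq> b" by (auto simp: card_2_iff)
    have "ord ` {..<n} = {1..n}" using ro by (simp add: rooted_order_def bij_betw_def)
    then have "a \<in> ord ` {..<n}" "b \<in> ord ` {..<n}" using eV ab by simp_all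
    then obtain i j where ij: "a = ord i" "b = ord j" "i < n" "j < n" by blast
    have "(ord 0, b) \<in> ?R\<^sup>*" using root[OF ij(4)] ij(2) symD[OF symR] by blast
    with root[OF ij(3)] have "(a, b) \<in> ?R\<^sup>*" unfolding ij(1) by (rule rtrancl_trans)
    moreover have "\<nexists>xs. is_cycle E xs" using tree by (simp add: is_tree_def)
    moreover have "{a, b} \<in> E" using e ab(1) by simp
    ultimately show "e \<in> ?F"
      unfolding ab(1) using acyclic_edge_in_spanning_subgraph FE ab(2) by blast
  qed
qed

text \<open>Serves the running time: one scan of the edge list costs \<open>O(n)\<close>.\<close>

lemma rooted_order_card_edges:
  assumes "is_tree {1..n} E" "rooted_order n E ord pp"
  shows "card E < n"
proof -
  have "card E \<le> card {0<..<n}"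
    unfolding rooted_order_edges[OF assms] by (rule card_image_le) simp
  moreover have "n \<noteq> 0" using assms by (auto simp: is_tree_def connected_in_def)
  ultimately show ?thesis by simp
qed

section \<open>The dynamic program\<close>

text \<open>\<open>anc pp i u\<close> is the first ancestor of \<open>u\<close> below \<open>i\<close>, that is, the node which \<open>u\<close> has been
  merged into once \<open>n - 1, \<dots>, i\<close> have been merged into their parents. The test \<open>u \<le> pp u\<close> only serves
  termination.\<close>

function anc :: "(nat \<Rightarrow> nat) \<Rightarrow> nat \<Rightarrow> nat \<Rightarrow> nat" where
  "anc pp i u = (if u < i \<or> u \<le> pp u then u else anc pp i (pp u))"
  by auto
termination by (relation "measure (\<lambda>(_, _, u). u)") auto

declare anc.simps [simp del]

locale dp =
  fixes n W :: nat and pp :: "nat \<Rightarrow> nat" and S :: "nat \<Rightarrow> real"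
  assumes n_pos: "0 < n" and W_pos: "0 < W"
    and pp_less: "0 < i \<Longrightarrow> i < n \<Longrightarrow> pp i < i"
    and S_nonneg: "i < n \<Longrightarrow> 0 \<le> S i"
begin

abbreviation an :: "nat \<Rightarrow> nat \<Rightarrow> nat" where "an \<equiv> anc pp"

lemma an_below: "u < i \<Longrightarrow> an i u = u"
  by (simp add: anc.simps)

lemma an_above: "0 < i \<Longrightarrow> i \<le> u \<Longrightarrow> u < n \<Longrightarrow> an i u = an i (pp u)"
  using pp_less[of u] by (subst anc.simps) auto

lemma an_less: "0 < i \<Longrightarrow> u < n \<Longrightarrow> an i u < i"
proof (induction u rule: less_induct)
  case (less u)
  then show ?case
    using an_below[of u i] an_above[of i u] pp_less[of u] by (cases "u < i") auto
qed

text \<open>Merging \<open>i\<close> changes the representative of exactly those nodes that were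
  represented by \<open>i\<close>. The induction follows the parents of \<open>u\<close>, which have
  smaller numbers.\<close>

lemma an_step:
  assumes "0 < i" "i < n" "u < n"
  shows "an i u = (if an (Suc i) u = i then pp i else an (Suc i) u)"
  using assms
proof (induction u rule: less_induct)
  case (less u)
  consider "u < i" | "u = i" | "i < u" by linarith
  then show ?case
  proof cases
    case 1
    then show ?thesis by (simp add: an_below)
  next
    case 2
    then show ?thesis using less pp_less[of i] by (simp add: an_below an_above)
  next
    case 3
    then show ?thesis using less pp_less[of u] by (simp add: an_above)
  qed
qed

section \<open>Merged subtrees and their capped sizes\<close>

definition members :: "nat \<Rightarrow> nat \<Rightarrow> nat set" where
  "members i v = {u. u < n \<and> an i u = v}"

lemma finite_members [simp]: "finite (members i v)"
  by (simp add: members_def)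

lemma members_merge:
  assumes "0 < i" "i < n"
  shows "members i (pp i) = members (Suc i) (pp i) \<union> members (Suc i) i"
  using pp_less[OF assms] by (auto simp: members_def an_step[OF assms] split: if_splits)

lemma members_other:
  assumes "0 < i" "i < n" "v < i" "v \<noteq> pp i"
  shows "members i v = members (Suc i) v"
  using assms(3,4) by (auto simp: members_def an_step[OF assms(1,2)] split: if_splits)

lemma self_member: "v < i \<Longrightarrow> v < n \<Longrightarrow> v \<in> members i v"
  by (simp add: members_def an_below)

definition sz :: "nat \<Rightarrow> nat \<Rightarrow> nat" where "sz i v = card (members i v)"

text \<open>Sizes beyond \<open>W\<close> cannot occur in a feasible component, so the table of
  \<open>v\<close> is used in the columns \<open>1..cap i v\<close> only.\<close>

definition cap :: "nat \<Rightarrow> nat \<Rightarrow> nat" where "cap i v = min W (sz i v)"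

lemma members_disjoint: "v \<noteq> v' \<Longrightarrow> members i v \<inter> members i v' = {}"
  by (auto simp: members_def)

lemma sz_merge: "0 < i \<Longrightarrow> i < n \<Longrightarrow> sz i (pp i) = sz (Suc i) (pp i) + sz (Suc i) i"
  using pp_less[of i] by (simp add: sz_def members_merge card_Un_disjoint members_disjoint)

lemma sz_other: "0 < i \<Longrightarrow> i < n \<Longrightarrow> v < i \<Longrightarrow> v \<noteq> pp i \<Longrightarrow> sz i v = sz (Suc i) v"
  by (simp add: sz_def members_other)

lemma sz_pos: "v < i \<Longrightarrow> v < n \<Longrightarrow> 0 < sz i v"
  using self_member[of v i] by (auto simp: sz_def card_gt_0_iff)

lemma sz_n: "v < n \<Longrightarrow> sz n v = 1"
proof -
  assume "v < n"
  then have "members n v = {v}" by (auto simp: members_def an_below)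
  then show ?thesis by (simp add: sz_def)
qed

text \<open>Capping commutes with addition followed by another capping; hence it suffices that the
  machine stores capped sizes.\<close>

lemma cap_merge:
  "0 < i \<Longrightarrow> i < n \<Longrightarrow> cap i (pp i) = min W (cap (Suc i) (pp i) + cap (Suc i) i)"
  by (simp add: cap_def sz_merge min_def)

lemma cap_other: "0 < i \<Longrightarrow> i < n \<Longrightarrow> v < i \<Longrightarrow> v \<noteq> pp i \<Longrightarrow> cap i v = cap (Suc i) v"
  by (simp add: cap_def sz_other)

lemma cap_pos: "v < i \<Longrightarrow> v < n \<Longrightarrow> 0 < cap i v"
  using sz_pos W_pos by (simp add: cap_def)

lemma cap_le: "cap i v \<le> W"
  by (simp add: cap_def)

lemma cap_n: "v < n \<Longrightarrow> cap n v = 1"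
  using W_pos by (simp add: cap_def sz_n)

lemma sz_root: "sz 1 0 = n"
proof -
  have "members 1 0 = {..<n}" using an_less[of 1] by (auto simp: members_def)
  then show ?thesis by (simp add: sz_def)
qed

definition pen :: "nat \<Rightarrow> nat \<Rightarrow> real" where
  "pen m v = (if S m < S v then S v else 0)"

text \<open>In the following, \<open>V i v m k\<close> is the table entry of node \<open>v < i\<close> after the nodes \<open>n - 1, \<dots>, i\<close> have been
  merged, \<open>G i\<close> the cost of closing the component of \<open>i\<close>, attained at \<open>gm i\<close> and \<open>gk i\<close>, and
  \<open>ch i m k\<close> the choice made for the parent of \<open>i\<close>: 0 if the edge is cut, and otherwise the number of nodes
  that come from the side of \<open>i\<close>.\<close>

definition best_ok ::
  "(nat \<Rightarrow> nat \<Rightarrow> nat \<Rightarrow> nat \<Rightarrow> real) \<Rightarrow> (nat \<Rightarrow> real) \<Rightarrow> (nat \<Rightarrow> nat) \<Rightarrow> (nat \<Rightarrow> nat) \<Rightarrow> nat \<Rightarrow> bool" where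
  "best_ok V G gm gk i \<longleftrightarrow>
     (\<forall>m<n. \<forall>k\<in>{1..cap (Suc i) i}. G i \<le> S m + V (Suc i) i m k) \<and>
     gm i < n \<and> gk i \<in> {1..cap (Suc i) i} \<and> G i = S (gm i) + V (Suc i) i (gm i) (gk i)"

text \<open>The stages of \<open>V\<close> exist only in the proof; the machine overwrites a single
  table. The two inequalities serve the lower bound, and the last clause, a choice attaining each
  entry, serves the backtracking. Together they replace an explicit minimum.\<close>

definition merge_ok ::
  "(nat \<Rightarrow> nat \<Rightarrow> nat \<Rightarrow> nat \<Rightarrow> real) \<Rightarrow> (nat \<Rightarrow> real) \<Rightarrow> (nat \<Rightarrow> nat \<Rightarrow> nat \<Rightarrow> nat) \<Rightarrow> nat \<Rightarrow> bool" where
  "merge_ok V G ch i \<longleftrightarrow>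
     (\<forall>v<i. v \<noteq> pp i \<longrightarrow> (\<forall>m<n. \<forall>k\<in>{1..W}. V i v m k = V (Suc i) v m k)) \<and>
     (\<forall>m<n. \<forall>k\<in>{1..cap (Suc i) (pp i)}. V i (pp i) m k \<le> V (Suc i) (pp i) m k + G i) \<and>
     (\<forall>m<n. \<forall>k\<in>{1..cap (Suc i) (pp i)}. \<forall>j\<in>{1..cap (Suc i) i}. k + j \<le> W \<longrightarrow>
        V i (pp i) m (k + j) \<le> V (Suc i) (pp i) m k + V (Suc i) i m j) \<and>
     (\<forall>m<n. \<forall>k\<in>{1..cap i (pp i)}.
        ch i m k = 0 \<and> k \<le> cap (Suc i) (pp i) \<and> V i (pp i) m k = V (Suc i) (pp i) m k + G i \<or>
        ch i m k \<in> {1..cap (Suc i) i} \<and> ch i m k < k \<and> k - ch i m k \<le> cap (Suc i) (pp i) \<and>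
          V i (pp i) m k = V (Suc i) (pp i) m (k - ch i m k) + V (Suc i) i m (ch i m k))"

lemma merge_ok_other:
  assumes "merge_ok V G ch i" "v < i" "v \<noteq> pp i" "m < n" "k \<in> {1..W}"
  shows "V i v m k = V (Suc i) v m k"
  using assms by (simp add: merge_ok_def)

lemma merge_ok_cut:
  assumes "merge_ok V G ch i" "m < n" "k \<in> {1..cap (Suc i) (pp i)}"
  shows "V i (pp i) m k \<le> V (Suc i) (pp i) m k + G i"
  using assms by (simp add: merge_ok_def)

lemma merge_ok_join:
  assumes "merge_ok V G ch i" "m < n" "k \<in> {1..cap (Suc i) (pp i)}" "j \<in> {1..cap (Suc i) i}" "k + j \<le> W"
  shows "V i (pp i) m (k + j) \<le> V (Suc i) (pp i) m k + V (Suc i) i m j"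
  using assms by (simp add: merge_ok_def)

lemma merge_ok_choice:
  assumes "merge_ok V G ch i" "m < n" "k \<in> {1..cap i (pp i)}"
  shows "ch i m k = 0 \<and> k \<le> cap (Suc i) (pp i) \<and> V i (pp i) m k = V (Suc i) (pp i) m k + G i \<or>
    ch i m k \<in> {1..cap (Suc i) i} \<and> ch i m k < k \<and> k - ch i m k \<le> cap (Suc i) (pp i) \<and>
      V i (pp i) m k = V (Suc i) (pp i) m (k - ch i m k) + V (Suc i) i m (ch i m k)"
  using assms unfolding merge_ok_def by blast

definition table_ok ::
  "(nat \<Rightarrow> nat \<Rightarrow> nat \<Rightarrow> nat \<Rightarrow> real) \<Rightarrow> (nat \<Rightarrow> real) \<Rightarrow> (nat \<Rightarrow> nat) \<Rightarrow> (nat \<Rightarrow> nat) \<Rightarrow>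
     (nat \<Rightarrow> nat \<Rightarrow> nat \<Rightarrow> nat) \<Rightarrow> nat \<Rightarrow> bool" where
  "table_ok V G gm gk ch l \<longleftrightarrow> (\<forall>v<n. \<forall>m<n. V n v m 1 = pen m v) \<and>
     (\<forall>i\<in>{l..<n}. best_ok V G gm gk i \<and> merge_ok V G ch i)"

section \<open>Lower bound: the table against an arbitrary labelling\<close>

definition tops :: "(nat \<Rightarrow> 'b) \<Rightarrow> nat set" where
  "tops lab = {t. t < n \<and> (\<forall>u<t. lab u \<noteq> lab t)}"

definition block :: "(nat \<Rightarrow> 'b) \<Rightarrow> nat \<Rightarrow> nat set" where
  "block lab t = {u. u < n \<and> lab u = lab t}"

text \<open>Agreement of every non-top node with its parent is connectedness of the blocks: parents
  have smaller numbers, so climbing within a block stops only at its top. Labels may have any type,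
  since the components themselves will serve as labels.\<close>

definition labelling :: "(nat \<Rightarrow> 'b) \<Rightarrow> bool" where
  "labelling lab \<longleftrightarrow> (\<forall>u<n. u \<notin> tops lab \<longrightarrow> lab (pp u) = lab u) \<and> (\<forall>t<n. card (block lab t) \<le> W)"

definition lab_cost :: "(nat \<Rightarrow> 'b) \<Rightarrow> real" where
  "lab_cost lab = (\<Sum>t\<in>tops lab. Max (S ` block lab t))"

text \<open>Every node met before dropping below \<open>i\<close> has a larger number than
  \<open>t\<close> and the same label; hence it is not a top, and its parent agrees with it.\<close>

lemma lab_ancestor:
  assumes "labelling lab" "u < n" "t < i" "lab t = lab u"
  shows "lab (an i u) = lab u"
  using assms(2,4)
proof (induction u rule: less_induct)
  case (less u)
  show ?case
  proof (cases "u < i")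
    case False
    with assms(3) have "t < u" by simp
    with less.prems have "u \<notin> tops lab" by (auto simp: tops_def)
    then have "lab (pp u) = lab u" using assms(1) less.prems by (simp add: labelling_def)
    then show ?thesis
      using False less assms(3) pp_less[of u] by (simp add: an_above)
  qed (simp add: an_below)
qed

text \<open>\<open>K i v\<close> is the part of the block of \<open>v\<close> that has been merged into \<open>v\<close>, and \<open>D i v\<close> the set of tops of
  the blocks closed so far below \<open>v\<close>. Their costs bound the table entries from above at every stage.\<close>

lemma lower_bound:
  assumes tab: "table_ok V G gm gk ch 1" and root: "best_ok V G gm gk 0" and lab: "labelling lab"
  shows "G 0 \<le> lab_cost lab"
proof -
  define K where "K i v = members i v \<inter> block lab v" for i v
  define D where "D i v = {t \<in> tops lab. i \<le> t \<and> t \<in> members i v}" for i v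
  define c where "c t = Max (S ` block lab t)" for t
  have [simp]: "finite (K i v)" "finite (D i v)" for i v by (simp_all add: K_def D_def tops_def)
  have Kcap: "card (K i v) \<in> {1..cap i v}" if "v < i" "v < n" for i v
  proof -
    have "v \<in> K i v" using that self_member by (simp add: K_def block_def)
    then have "card (K i v) > 0" by (auto simp: card_gt_0_iff)
    moreover have "card (K i v) \<le> sz i v" unfolding sz_def K_def by (rule card_mono) auto
    moreover have "card (K i v) \<le> card (block lab v)"
      unfolding K_def by (rule card_mono) (auto simp: block_def)
    ultimately show ?thesis using lab that by (auto simp: cap_def labelling_def)
  qed
  \<comment> \<open>By the time a top is merged, its whole block has been merged into it, so closing
    it pays for the entire block.\<close>
  have Ktop: "K (Suc i) i = block lab i" if "i \<in> tops lab" for i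
  proof -
    have "an (Suc i) u = i" if "u \<in> block lab i" for u
    proof -
      have "lab (an (Suc i) u) = lab i"
        using lab_ancestor[OF lab, of u i "Suc i"] that by (simp add: block_def)
      moreover have "an (Suc i) u < Suc i" using an_less that by (simp add: block_def)
      ultimately show ?thesis using \<open>i \<in> tops lab\<close> by (auto simp: tops_def less_Suc_eq)
    qed
    then show ?thesis by (auto simp: K_def members_def block_def)
  qed
  have closed: "G i \<le> c i + sum c (D (Suc i) i)"
    if "i \<in> tops lab" "best_ok V G gm gk i" and
      le: "\<forall>m<n. V (Suc i) i m (card (K (Suc i) i)) \<le> sum (pen m) (K (Suc i) i) + sum c (D (Suc i) i)" for i
  proof -
    have i: "i < n" using that by (simp add: tops_def)
    have fin: "finite (S ` block lab i)" and ne: "S ` block lab i \<noteq> {}"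
      using i by (auto simp: block_def)
    \<comment> \<open>The right guess is a node \<open>m\<close> of the block with the largest
      \<open>S\<close>: nothing in the block is penalised, and \<open>S m\<close> is exactly the
      cost of the block.\<close>
    from Max_in[OF this] obtain m where m: "m \<in> block lab i" "c i = S m" by (auto simp: c_def)
    then have mn: "m < n" by (simp add: block_def)
    have "pen m u = 0" if "u \<in> block lab i" for u
      using Max_ge[OF fin, of "S u"] that m by (auto simp: pen_def c_def)
    then have "sum (pen m) (K (Suc i) i) = 0" by (simp add: Ktop[OF \<open>i \<in> tops lab\<close>])
    moreover have "G i \<le> S m + V (Suc i) i m (card (K (Suc i) i))"
      using that(2) Kcap[of i "Suc i"] i mn unfolding best_ok_def by blast
    ultimately show ?thesis using le mn m by fastforce
  qed
  \<comment> \<open>The bound is carried for all thresholds \<open>m\<close> at once: joining needs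
    the same \<open>m\<close> on both sides, whereas a component being closed picks its own
    maximiser.\<close>
  have inv: "\<forall>v<i. \<forall>m<n. V i v m (card (K i v)) \<le> sum (pen m) (K i v) + sum c (D i v)"
    if "1 \<le> i" "i \<le> n" for i
    using that(2) that(1)
  proof (induction i rule: inc_induct)
    case base
    show ?case
    proof (intro allI impI)
      fix v m assume vm: "v < n" "m < n"
      then have "K n v = {v}" "D n v = {}"
        by (auto simp: K_def D_def members_def an_below block_def tops_def)
      with vm tab show "V n v m (card (K n v)) \<le> sum (pen m) (K n v) + sum c (D n v)"
        by (simp add: table_ok_def)
    qed
  next
    case (step i)
    note IH = step.IH[OF le_SucI[OF step.prems]]
    from step.prems step.hyps have i: "0 < i" "i < n" by auto
    note p = pp_less[OF i]
    have ok: "best_ok V G gm gk i" "merge_ok V G ch i" using tab i by (auto simp: table_ok_def)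
    have le_iff: "i \<le> t \<longleftrightarrow> t = i \<or> Suc i \<le> t" for t by auto
    show ?case
    proof (intro allI impI)
      fix v m assume vm: "v < i" "m < n"
      show "V i v m (card (K i v)) \<le> sum (pen m) (K i v) + sum c (D i v)"
      proof (cases "v = pp i")
        case False
        have "K i v = K (Suc i) v" using False vm by (simp add: K_def members_other[OF i])
        moreover have "D i v = D (Suc i) v"
        proof -
          have "i \<notin> members (Suc i) v" using vm by (simp add: members_def an_below)
          then show ?thesis
            unfolding D_def members_other[OF i vm(1) False] by (auto simp: le_iff)
        qed
        moreover have "V i v m (card (K i v)) = V (Suc i) v m (card (K i v))"
        proof (rule merge_ok_other[OF ok(2) vm(1) False vm(2)])
          show "card (K i v) \<in> {1..W}" using Kcap[of v i] vm i cap_le[of i v] by auto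
        qed
        moreover have "V (Suc i) v m (card (K (Suc i) v)) \<le>
            sum (pen m) (K (Suc i) v) + sum c (D (Suc i) v)"
          using IH vm by simp
        ultimately show ?thesis by simp
      next
        case True
        have IHp: "V (Suc i) (pp i) m (card (K (Suc i) (pp i))) \<le>
            sum (pen m) (K (Suc i) (pp i)) + sum c (D (Suc i) (pp i))"
          using IH p vm by simp
        have disj: "members (Suc i) (pp i) \<inter> members (Suc i) i = {}"
          by (rule members_disjoint) (use p in simp)
        have capp: "card (K (Suc i) (pp i)) \<in> {1..cap (Suc i) (pp i)}"
          and capi: "card (K (Suc i) i) \<in> {1..cap (Suc i) i}"
          using Kcap p i by simp_all
        have i_mem: "i \<in> members (Suc i) i" using self_member i by simp
        show ?thesis
        proof (cases "i \<in> tops lab")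
          case top: True
          \<comment> \<open>A node merged into \<open>i\<close> with the label of
            \<open>pp i\<close> would carry that label up to \<open>i\<close>, but a top has no
            smaller node with its label.\<close>
          have KE: "K i (pp i) = K (Suc i) (pp i)"
          proof -
            have "members (Suc i) i \<inter> block lab (pp i) = {}"
            proof (safe)
              fix u assume u: "u \<in> members (Suc i) i" "u \<in> block lab (pp i)"
              then have "lab (an (Suc i) u) = lab u"
                using lab_ancestor[OF lab, of u "pp i" "Suc i"] p by (auto simp: block_def)
              with u top p show "u \<in> {}" by (auto simp: members_def block_def tops_def)
            qed
            then show ?thesis by (auto simp: K_def members_merge[OF i])
          qed
          have DU: "D i (pp i) = insert i (D (Suc i) (pp i) \<union> D (Suc i) i)"
            using top i_mem by (auto simp: D_def members_merge[OF i] le_iff)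
          have "i \<notin> D (Suc i) (pp i) \<union> D (Suc i) i" by (simp add: D_def)
          moreover have "D (Suc i) (pp i) \<inter> D (Suc i) i = {}" using disj by (auto simp: D_def)
          ultimately have "sum c (D i (pp i)) = c i + sum c (D (Suc i) (pp i)) + sum c (D (Suc i) i)"
            by (simp add: DU sum.union_disjoint)
          moreover have "V i (pp i) m (card (K (Suc i) (pp i))) \<le>
              V (Suc i) (pp i) m (card (K (Suc i) (pp i))) + G i"
            using merge_ok_cut[OF ok(2) vm(2) capp] .
          moreover have "G i \<le> c i + sum c (D (Suc i) i)"
            using closed[OF top ok(1)] IH by simp
          ultimately show ?thesis using IHp True KE by simp
        next
          case ntop: False
          then have labp: "block lab (pp i) = block lab i"
            using lab i by (simp add: labelling_def block_def)
          then have KU: "K i (pp i) = K (Suc i) (pp i) \<union> K (Suc i) i"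
            by (auto simp: K_def members_merge[OF i])
          have Kdisj: "K (Suc i) (pp i) \<inter> K (Suc i) i = {}" using disj by (auto simp: K_def)
          have cardU: "card (K i (pp i)) = card (K (Suc i) (pp i)) + card (K (Suc i) i)"
            using Kdisj by (simp add: KU card_Un_disjoint)
          have "D i (pp i) = D (Suc i) (pp i) \<union> D (Suc i) i"
            using ntop by (auto simp: D_def members_merge[OF i] le_iff)
          moreover have "D (Suc i) (pp i) \<inter> D (Suc i) i = {}" using disj by (auto simp: D_def)
          ultimately have "sum c (D i (pp i)) = sum c (D (Suc i) (pp i)) + sum c (D (Suc i) i)"
            by (simp add: sum.union_disjoint)
          moreover have "sum (pen m) (K i (pp i)) =
              sum (pen m) (K (Suc i) (pp i)) + sum (pen m) (K (Suc i) i)"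
            using Kdisj by (simp add: KU sum.union_disjoint)
          moreover have "card (K (Suc i) (pp i)) + card (K (Suc i) i) \<le> W"
            using Kcap[of "pp i" i] p i cap_le[of i "pp i"] by (simp add: cardU)
          then have "V i (pp i) m (card (K i (pp i))) \<le>
              V (Suc i) (pp i) m (card (K (Suc i) (pp i))) + V (Suc i) i m (card (K (Suc i) i))"
            unfolding cardU by (rule merge_ok_join[OF ok(2) vm(2) capp capi])
          moreover have "V (Suc i) i m (card (K (Suc i) i)) \<le> sum (pen m) (K (Suc i) i) + sum c (D (Suc i) i)"
            using IH vm by simp
          ultimately show ?thesis using IHp True by simp
        qed
      qed
    qed
  qed
  have top0: "0 \<in> tops lab" using n_pos by (simp add: tops_def)
  have "D 1 0 = tops lab - {0}"
    using an_less[of 1] by (auto simp: D_def members_def tops_def)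
  moreover have "G 0 \<le> c 0 + sum c (D (Suc 0) 0)"
    using closed[OF top0 root] inv[of 1] n_pos by simp
  moreover have "sum c (tops lab) = c 0 + sum c (tops lab - {0})"
    using top0 by (intro sum.remove) (auto simp: tops_def)
  ultimately show ?thesis by (simp add: lab_cost_def c_def)
qed

text \<open>Undoing the merge of \<open>i\<close> splits the entry of its parent into two entries, or into an entry and a closed
  component. The total cost in the last line therefore stays equal to \<open>G 0\<close>, and the sizes \<open>kk\<close> of the
  pieces of one component keep their sum.\<close>

definition backtrack_ok ::
  "(nat \<Rightarrow> nat \<Rightarrow> nat \<Rightarrow> nat \<Rightarrow> real) \<Rightarrow> (nat \<Rightarrow> real) \<Rightarrow> nat \<Rightarrow> (nat \<Rightarrow> nat) \<Rightarrow> (nat \<Rightarrow> nat) \<Rightarrow> (nat \<Rightarrow> nat) \<Rightarrow> bool"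
where
  "backtrack_ok V G i lab mm kk \<longleftrightarrow>
     (\<forall>v<i. lab v \<le> v \<and> lab (lab v) = lab v \<and> mm v < n \<and> mm (lab v) = mm v \<and>
        kk v \<in> {1..cap i v} \<and> (lab v = v \<or> lab v = lab (pp v) \<and> 0 < v)) \<and>
     (\<forall>t<i. (\<Sum>v | v < i \<and> lab v = t. kk v) \<le> W) \<and>
     G 0 = (\<Sum>v<i. V i v (mm v) (kk v)) + (\<Sum>t | t < i \<and> lab t = t. S (mm t))"

lemma backtrack_init:
  assumes "best_ok V G gm gk 0" "lab 0 = 0" "mm 0 = gm 0" "kk 0 = gk 0"
  shows "backtrack_ok V G 1 lab mm kk"
proof -
  have [simp]: "{v. v = 0 \<and> lab v = 0} = {0}" "{t. t = 0 \<and> lab t = t} = {0}" using assms(2) by auto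
  show ?thesis
    using assms cap_le[of 1 0] unfolding backtrack_ok_def best_ok_def by auto
qed

text \<open>Unfolding \<open>G i\<close> into its attaining pair opens a block with top
  \<open>i\<close>, threshold \<open>gm i\<close> and \<open>gk i\<close> nodes to distribute;
  \<open>S (gm i)\<close> joins the second sum of the invariant.\<close>

lemma backtrack_cut:
  assumes i: "0 < i" "i < n" and tab: "table_ok V G gm gk ch 1"
    and bt: "backtrack_ok V G i lab mm kk" and ch: "ch i (mm (pp i)) (kk (pp i)) = 0"
  shows "backtrack_ok V G (Suc i) (lab(i := i)) (mm(i := gm i)) (kk(i := gk i))"
proof -
  note p = pp_less[OF i]
  have ok: "best_ok V G gm gk i" "merge_ok V G ch i" using tab i by (auto simp: table_ok_def)
  have v: "lab v \<le> v" "lab (lab v) = lab v" "mm v < n" "mm (lab v) = mm v" "kk v \<in> {1..cap i v}"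
    "lab v = v \<or> lab v = lab (pp v) \<and> 0 < v" if "v < i" for v
    using bt that by (auto simp: backtrack_ok_def)
  have c: "kk (pp i) \<le> cap (Suc i) (pp i)"
    "V i (pp i) (mm (pp i)) (kk (pp i)) = V (Suc i) (pp i) (mm (pp i)) (kk (pp i)) + G i"
    using merge_ok_choice[OF ok(2) v(3)[OF p] v(5)[OF p]] ch by auto
  have other: "V i v (mm v) (kk v) = V (Suc i) v (mm v) (kk v)" if "v < i" "v \<noteq> pp i" for v
    using merge_ok_other[OF ok(2) that v(3)] v(5)[of v] that cap_le[of i v] by auto
  have capk: "kk v \<in> {1..cap (Suc i) v}" if "v < i" for v
    using v(5)[OF that] c(1) v(5)[OF p] cap_other[OF i that] by (cases "v = pp i") auto
  have lab_i: "lab v \<noteq> i" if "v < i" for v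
    using v(1)[OF that] that by simp
  have A: "{v. v < Suc i \<and> (lab(i := i)) v = t} = (if t = i then {i} else {v. v < i \<and> lab v = t})" for t
    using lab_i by (auto simp: less_Suc_eq)
  have B: "{t. t < Suc i \<and> (lab(i := i)) t = t} = insert i {t. t < i \<and> lab t = t}"
    by (auto simp: less_Suc_eq)
  have g: "G i = S (gm i) + V (Suc i) i (gm i) (gk i)" "gm i < n" "gk i \<in> {1..cap (Suc i) i}"
    using ok(1) by (auto simp: best_ok_def)
  have "(\<Sum>v<i. V i v (mm v) (kk v)) = (\<Sum>v<i. V (Suc i) v (mm v) (kk v)) + G i"
  proof -
    have "(\<Sum>v<i. V i v (mm v) (kk v)) =
        V i (pp i) (mm (pp i)) (kk (pp i)) + (\<Sum>v\<in>{..<i} - {pp i}. V i v (mm v) (kk v))"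
      using p by (intro sum.remove) auto
    also have "(\<Sum>v\<in>{..<i} - {pp i}. V i v (mm v) (kk v)) = (\<Sum>v\<in>{..<i} - {pp i}. V (Suc i) v (mm v) (kk v))"
      using other by (intro sum.cong) auto
    also have "V i (pp i) (mm (pp i)) (kk (pp i)) + \<dots> = (\<Sum>v<i. V (Suc i) v (mm v) (kk v)) + G i"
      using p c(2) by (subst sum.remove[of "{..<i}" "pp i"]) auto
    finally show ?thesis .
  qed
  moreover have "G 0 = (\<Sum>v<i. V i v (mm v) (kk v)) + (\<Sum>t | t < i \<and> lab t = t. S (mm t))"
    using bt by (simp add: backtrack_ok_def)
  moreover have "(\<Sum>v<i. V (Suc i) v ((mm(i := gm i)) v) ((kk(i := gk i)) v)) =
      (\<Sum>v<i. V (Suc i) v (mm v) (kk v))"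
    by (rule sum.cong) auto
  moreover have "(\<Sum>t | t < i \<and> lab t = t. S ((mm(i := gm i)) t)) = (\<Sum>t | t < i \<and> lab t = t. S (mm t))"
    by (rule sum.cong) auto
  ultimately have "G 0 = (\<Sum>v<Suc i. V (Suc i) v ((mm(i := gm i)) v) ((kk(i := gk i)) v)) +
      (\<Sum>t | t < Suc i \<and> (lab(i := i)) t = t. S ((mm(i := gm i)) t))"
    unfolding B using g(1) by simp
  moreover have "(\<Sum>v | v < Suc i \<and> (lab(i := i)) v = t. (kk(i := gk i)) v) \<le> W" if "t < Suc i" for t
  proof (cases "t = i")
    case True
    then show ?thesis unfolding A using g(3) cap_le[of "Suc i" i] by simp
  next
    case False
    have "(\<Sum>v | v < i \<and> lab v = t. (kk(i := gk i)) v) = (\<Sum>v | v < i \<and> lab v = t. kk v)"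
      by (rule sum.cong) auto
    with False that bt show ?thesis unfolding A by (simp add: backtrack_ok_def)
  qed
  moreover have "(lab(i := i)) v \<le> v \<and> (lab(i := i)) ((lab(i := i)) v) = (lab(i := i)) v \<and>
      (mm(i := gm i)) v < n \<and> (mm(i := gm i)) ((lab(i := i)) v) = (mm(i := gm i)) v \<and>
      (kk(i := gk i)) v \<in> {1..cap (Suc i) v} \<and>
      ((lab(i := i)) v = v \<or> (lab(i := i)) v = (lab(i := i)) (pp v) \<and> 0 < v)" if "v < Suc i" for v
  proof (cases "v = i")
    case False
    with that have "v < i" by simp
    then show ?thesis using v[of v] capk[of v] pp_less[of v] i by auto
  qed (use g in auto)
  ultimately show ?thesis unfolding backtrack_ok_def by blast
qed

text \<open>Node \<open>i\<close> inherits the label and the threshold of its parent and takes over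
  \<open>j\<close> of the parent's nodes. Since the recorded choice is smaller than the entry's
  size, the parent keeps at least one.\<close>

lemma backtrack_join:
  assumes i: "0 < i" "i < n" and tab: "table_ok V G gm gk ch 1"
    and bt: "backtrack_ok V G i lab mm kk"
    and ch: "ch i (mm (pp i)) (kk (pp i)) = j" "j \<noteq> 0"
  shows "backtrack_ok V G (Suc i) (lab(i := lab (pp i))) (mm(i := mm (pp i)))
    (kk(i := j, pp i := kk (pp i) - j))"
proof -
  note p = pp_less[OF i]
  let ?p = "pp i" and ?kk = "kk(i := j, pp i := kk (pp i) - j)"
  have ok: "best_ok V G gm gk i" "merge_ok V G ch i" using tab i by (auto simp: table_ok_def)
  have v: "lab v \<le> v" "lab (lab v) = lab v" "mm v < n" "mm (lab v) = mm v" "kk v \<in> {1..cap i v}"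
    "lab v = v \<or> lab v = lab (pp v) \<and> 0 < v" if "v < i" for v
    using bt that by (auto simp: backtrack_ok_def)
  have c: "j \<in> {1..cap (Suc i) i}" "j < kk ?p" "kk ?p - j \<le> cap (Suc i) ?p"
    "V i ?p (mm ?p) (kk ?p) = V (Suc i) ?p (mm ?p) (kk ?p - j) + V (Suc i) i (mm ?p) j"
    using merge_ok_choice[OF ok(2) v(3)[OF p] v(5)[OF p]] ch by auto
  have other: "V i v (mm v) (kk v) = V (Suc i) v (mm v) (kk v)" if "v < i" "v \<noteq> ?p" for v
    using merge_ok_other[OF ok(2) that v(3)] v(5)[of v] that cap_le[of i v] by auto
  have capk: "?kk v \<in> {1..cap (Suc i) v}" if "v < Suc i" for v
    using v(5)[of v] c that cap_other[OF i, of v] by (auto simp: less_Suc_eq)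
  have labp: "lab ?p < i" using v(1)[OF p] p by simp
  have A: "{v. v < Suc i \<and> (lab(i := lab ?p)) v = t} =
      (if t = lab ?p then insert i {v. v < i \<and> lab v = t} else {v. v < i \<and> lab v = t})" for t
    using v(1) by (auto simp: less_Suc_eq)
  have B: "{t. t < Suc i \<and> (lab(i := lab ?p)) t = t} = {t. t < i \<and> lab t = t}"
    using labp by (auto simp: less_Suc_eq)
  have "(\<Sum>v<i. V i v (mm v) (kk v)) = (\<Sum>v<i. V (Suc i) v (mm v) (?kk v)) + V (Suc i) i (mm ?p) j"
  proof -
    have "(\<Sum>v<i. V i v (mm v) (kk v)) =
        V i ?p (mm ?p) (kk ?p) + (\<Sum>v\<in>{..<i} - {?p}. V i v (mm v) (kk v))"
      using p by (intro sum.remove) auto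
    also have "(\<Sum>v\<in>{..<i} - {?p}. V i v (mm v) (kk v)) = (\<Sum>v\<in>{..<i} - {?p}. V (Suc i) v (mm v) (?kk v))"
      using other by (intro sum.cong) auto
    also have "V i ?p (mm ?p) (kk ?p) + \<dots> = (\<Sum>v<i. V (Suc i) v (mm v) (?kk v)) + V (Suc i) i (mm ?p) j"
      using p c(4) by (subst sum.remove[of "{..<i}" ?p]) auto
    finally show ?thesis .
  qed
  moreover have "G 0 = (\<Sum>v<i. V i v (mm v) (kk v)) + (\<Sum>t | t < i \<and> lab t = t. S (mm t))"
    using bt by (simp add: backtrack_ok_def)
  moreover have "(\<Sum>v<i. V (Suc i) v ((mm(i := mm ?p)) v) (?kk v)) = (\<Sum>v<i. V (Suc i) v (mm v) (?kk v))"
    by (rule sum.cong) auto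
  moreover have "(\<Sum>t | t < i \<and> lab t = t. S ((mm(i := mm ?p)) t)) = (\<Sum>t | t < i \<and> lab t = t. S (mm t))"
    by (rule sum.cong) auto
  moreover have "?kk i = j" using p by simp
  ultimately have "G 0 = (\<Sum>v<Suc i. V (Suc i) v ((mm(i := mm ?p)) v) (?kk v)) +
      (\<Sum>t | t < Suc i \<and> (lab(i := lab ?p)) t = t. S ((mm(i := mm ?p)) t))"
    unfolding B by simp
  moreover have "(\<Sum>v | v < Suc i \<and> (lab(i := lab ?p)) v = t. ?kk v) \<le> W" if "t < Suc i" for t
  proof (cases "t = lab ?p")
    case True
    let ?A = "{v. v < i \<and> lab v = t}"
    have pA: "?p \<in> ?A" using True p by simp
    have "sum ?kk (insert i ?A) = ?kk i + (?kk ?p + sum ?kk (?A - {?p}))"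
      using pA sum.remove[of ?A ?p ?kk] by simp
    also have "sum ?kk (?A - {?p}) = sum kk (?A - {?p})" by (rule sum.cong) auto
    also have "?kk i + (?kk ?p + \<dots>) = kk ?p + \<dots>" using p c(2) by simp
    also have "\<dots> = sum kk ?A" using pA by (intro sum.remove[symmetric]) auto
    also have "\<dots> \<le> W" using bt labp True by (simp add: backtrack_ok_def)
    finally show ?thesis unfolding A if_P[OF True] .
  next
    case False
    have "(\<Sum>v | v < i \<and> lab v = t. ?kk v) = (\<Sum>v | v < i \<and> lab v = t. kk v)"
      using False by (intro sum.cong) auto
    also have "\<dots> \<le> W"
    proof (cases "t = i")
      case True
      then have "{v. v < i \<and> lab v = t} = {}" using v(1) by fastforce
      then show ?thesis by (simp only: sum.empty)
    qed (use bt that in \<open>simp add: backtrack_ok_def\<close>)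
    finally show ?thesis unfolding A using False by simp
  qed
  moreover have "(lab(i := lab ?p)) v \<le> v \<and>
      (lab(i := lab ?p)) ((lab(i := lab ?p)) v) = (lab(i := lab ?p)) v \<and>
      (mm(i := mm ?p)) v < n \<and> (mm(i := mm ?p)) ((lab(i := lab ?p)) v) = (mm(i := mm ?p)) v \<and>
      ?kk v \<in> {1..cap (Suc i) v} \<and>
      ((lab(i := lab ?p)) v = v \<or> (lab(i := lab ?p)) v = (lab(i := lab ?p)) (pp v) \<and> 0 < v)"
    if "v < Suc i" for v
  proof (cases "v = i")
    case False
    with that have "v < i" by simp
    then show ?thesis using v[of v] capk[of v] pp_less[of v] i by auto
  next
    case True
    then show ?thesis using v[OF p] capk[of i] i labp p by auto
  qed
  ultimately show ?thesis unfolding backtrack_ok_def by blast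
qed

text \<open>With every merge undone all capacities are 1, so \<open>kk\<close> is constantly 1 and
  its sum over a block counts nodes. The cost satisfies only an inequality, because a threshold plus
  penalties may exceed the maximum of a block; the lower bound closes this gap later.\<close>

lemma backtrack_final:
  assumes tab: "table_ok V G gm gk ch 1" and bt: "backtrack_ok V G n lab mm kk"
  shows "(\<Sum>t | t < n \<and> lab t = t. Max (S ` {u. u < n \<and> lab u = t})) \<le> G 0"
    and "t < n \<Longrightarrow> card {u. u < n \<and> lab u = t} \<le> W"
    and "v < n \<Longrightarrow> lab v \<le> v \<and> lab (lab v) = lab v \<and> (lab v = v \<or> lab v = lab (pp v) \<and> 0 < v)"
proof -
  have v: "lab v \<le> v" "lab (lab v) = lab v" "mm v < n" "mm (lab v) = mm v" "kk v = 1"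
    "lab v = v \<or> lab v = lab (pp v) \<and> 0 < v" if "v < n" for v
    using bt that by (auto simp: backtrack_ok_def cap_n)
  show "v < n \<Longrightarrow> lab v \<le> v \<and> lab (lab v) = lab v \<and> (lab v = v \<or> lab v = lab (pp v) \<and> 0 < v)" for v
    using v by blast
  show "card {u. u < n \<and> lab u = t} \<le> W" if "t < n" for t
  proof -
    have "(\<Sum>v | v < n \<and> lab v = t. kk v) = (\<Sum>v | v < n \<and> lab v = t. 1)"
      using v(5) by (intro sum.cong) auto
    moreover have "(\<Sum>v | v < n \<and> lab v = t. kk v) \<le> W"
      using bt that unfolding backtrack_ok_def by blast
    ultimately show ?thesis by simp
  qed
  let ?T = "{t. t < n \<and> lab t = t}"
  have "Max (S ` {u. u < n \<and> lab u = t}) \<le> S (mm t) + (\<Sum>u | u < n \<and> lab u = t. pen (mm u) u)"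
    if t: "t \<in> ?T" for t
  proof -
    let ?B = "{u. u < n \<and> lab u = t}"
    have "S u \<le> S (mm t) + (\<Sum>u\<in>?B. pen (mm u) u)" if u: "u \<in> ?B" for u
    proof -
      \<comment> \<open>All nodes of a block share the threshold of its top. Either
        \<open>S u\<close> is at most the threshold, or \<open>u\<close> pays the penalty
        \<open>S u\<close> itself; nonnegativity makes each of the two terms sufficient
        alone.\<close>
      have "mm u = mm t" "0 \<le> S (mm t)" using v(4)[of u] v(3)[of t] u t S_nonneg by auto
      then have "S u \<le> S (mm t) + pen (mm u) u" by (simp add: pen_def)
      moreover have "pen (mm u) u \<le> (\<Sum>u\<in>?B. pen (mm u) u)"
        using u by (intro member_le_sum) (auto simp: pen_def S_nonneg)
      ultimately show ?thesis by simp
    qed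
    moreover have "t \<in> ?B" using t by simp
    ultimately show ?thesis by (subst Max_le_iff) auto
  qed
  then have "(\<Sum>t\<in>?T. Max (S ` {u. u < n \<and> lab u = t})) \<le>
      (\<Sum>t\<in>?T. S (mm t) + (\<Sum>u | u < n \<and> lab u = t. pen (mm u) u))"
    by (rule sum_mono)
  also have "\<dots> = (\<Sum>t\<in>?T. S (mm t)) + (\<Sum>t\<in>?T. \<Sum>u\<in>{u. u < n \<and> lab u = t}. pen (mm u) u)"
    by (rule sum.distrib)
  also have "(\<Sum>t\<in>?T. \<Sum>u\<in>{u. u < n \<and> lab u = t}. pen (mm u) u) = (\<Sum>u<n. pen (mm u) u)"
  proof -
    have "lab ` {..<n} \<subseteq> ?T" using v(1,2) by fastforce
    from sum.group[OF _ _ this, of "\<lambda>u. pen (mm u) u"] show ?thesis by simp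
  qed
  also have "\<dots> = (\<Sum>u<n. V n u (mm u) (kk u))"
    using v(3,5) tab by (intro sum.cong) (auto simp: table_ok_def)
  finally show "(\<Sum>t\<in>?T. Max (S ` {u. u < n \<and> lab u = t})) \<le> G 0"
    using bt by (simp add: backtrack_ok_def)
qed

section \<open>Amortised cost of the merges\<close>

definition pot :: "nat \<Rightarrow> nat" where
  "pot a = (if a \<le> W then a * a else 2 * a * W - W * W)"

text \<open>Beyond \<open>W\<close> the potential follows the tangent of the square at
  \<open>W\<close>. For \<open>a\<close> and \<open>b\<close> both at least \<open>W\<close>
  equality holds, so the coefficient 1 of the product cannot be raised. The computation takes place
  in the integers, where differences do not truncate.\<close>

lemma pot_merge: "pot a + pot b + min W a * min W b \<le> pot (a + b)"
proof -
  have *: "int (pot c) = (if c \<le> W then int c * int c else 2 * int c * int W - int W * int W)" for c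
  proof (cases "c \<le> W")
    case False
    then have "W * W \<le> 2 * c * W" by (intro mult_mono) auto
    with False show ?thesis by (simp add: pot_def of_nat_diff)
  qed (simp add: pot_def)
  have "int (pot a) + int (pot b) + int (min W a) * int (min W b) \<le> int (pot (a + b))"
  proof (cases "a \<le> W")
    case a: True
    show ?thesis
    proof (cases "b \<le> W")
      case b: True
      show ?thesis
      proof (cases "a + b \<le> W")
        case True
        have "0 \<le> int a * int b" by simp
        with True a b show ?thesis unfolding * by (simp add: algebra_simps)
      next
        case False
        \<comment> \<open>With the defects \<open>x = W - a\<close> and \<open>y = W - b\<close> the
          slack is \<open>x * y + (W - x - y) * (x + y)\<close>, and \<open>a + b > W\<close> says
          that \<open>W - x - y\<close> is positive.\<close>
        then obtain x y where xy: "W = a + x" "W = b + y" using a b le_Suc_ex by metis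
        then have ab: "int a = int W - int x" "int b = int W - int y" by simp_all
        have "0 \<le> int x * int y" by simp
        moreover have "0 \<le> (int W - int x - int y) * (int x + int y)"
          using False xy by (intro mult_nonneg_nonneg) auto
        moreover have "2 * ((int W - int x) + (int W - int y)) * int W - int W * int W -
            ((int W - int x) * (int W - int x) + (int W - int y) * (int W - int y) +
              (int W - int x) * (int W - int y)) =
            int x * int y + (int W - int x - int y) * (int x + int y)"
          by (simp add: algebra_simps)
        ultimately have "(int W - int x) * (int W - int x) + (int W - int y) * (int W - int y) +
            (int W - int x) * (int W - int y) \<le>
            2 * ((int W - int x) + (int W - int y)) * int W - int W * int W"
          by linarith
        then show ?thesis using False a b unfolding * ab[symmetric] by simp
      qed
    next
      case b: False
      have "int a * int a \<le> int a * int W" using a by (intro mult_mono) auto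
      with a b show ?thesis unfolding * by (simp add: algebra_simps)
    qed
  next
    case a: False
    show ?thesis
    proof (cases "b \<le> W")
      case b: True
      have "int b * int b \<le> int b * int W" using b by (intro mult_mono) auto
      with a b show ?thesis unfolding * by (simp add: algebra_simps)
    next
      case b: False
      with a show ?thesis unfolding * by (simp add: algebra_simps)
    qed
  qed
  then show ?thesis by (metis of_nat_add of_nat_le_iff of_nat_mult)
qed

text \<open>The products of the merges \<open>n - 1, ..., l\<close> are bounded by the total
  potential of the nodes \<open>v < l\<close> that remain. After the last merge only the root
  remains, with all \<open>n\<close> nodes.\<close>

lemma sum_cap_products:
  "(\<Sum>i=1..<n. cap (Suc i) (pp i) * cap (Suc i) i) \<le> 2 * n * W"
proof -
  have "(\<Sum>i=l..<n. cap (Suc i) (pp i) * cap (Suc i) i) \<le> (\<Sum>v<l. pot (sz l v))" if "1 \<le> l" "l \<le> n" for l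
    using that(2,1)
  proof (induction l rule: inc_induct)
    case (step i)
    then have i: "0 < i" "i < n" by auto
    note p = pp_less[OF i]
    let ?s = "\<lambda>v. pot (sz (Suc i) v)"
    have "(\<Sum>l=i..<n. cap (Suc l) (pp l) * cap (Suc l) l) \<le>
        cap (Suc i) (pp i) * cap (Suc i) i + (\<Sum>v<Suc i. ?s v)"
      using step.IH i by (simp add: sum.atLeast_Suc_lessThan)
    also have "(\<Sum>v<Suc i. ?s v) = ?s (pp i) + sum ?s ({..<i} - {pp i}) + ?s i"
      using p sum.remove[of "{..<i}" "pp i" ?s] by simp
    also have "sum ?s ({..<i} - {pp i}) = (\<Sum>v\<in>{..<i} - {pp i}. pot (sz i v))"
      using sz_other[OF i] by (intro sum.cong) auto
    also have "cap (Suc i) (pp i) * cap (Suc i) i + (?s (pp i) + (\<Sum>v\<in>{..<i} - {pp i}. pot (sz i v)) + ?s i) \<le>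
        pot (sz i (pp i)) + (\<Sum>v\<in>{..<i} - {pp i}. pot (sz i v))"
      using pot_merge[of "sz (Suc i) (pp i)" "sz (Suc i) i"] by (simp add: sz_merge[OF i] cap_def)
    also have "\<dots> = (\<Sum>v<i. pot (sz i v))"
      using p by (intro sum.remove[symmetric]) auto
    finally show ?case .
  qed simp
  from this[of 1] have "(\<Sum>i=1..<n. cap (Suc i) (pp i) * cap (Suc i) i) \<le> pot n"
    using n_pos sz_root by simp
  also have "pot n \<le> 2 * n * W" by (auto simp: pot_def)
  finally show ?thesis .
qed

end

section \<open>Labellings and feasible partitions\<close>

lemma rooted_order_edgeE:
  assumes "is_tree {1..n} E" "rooted_order n E ord pp" "x < n" "z < n" "{ord x, ord z} \<in> E"
  obtains "0 < z" "x = pp z" | "0 < x" "z = pp x"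
proof -
  have inj: "inj_on ord {..<n}" using assms(2) by (simp add: rooted_order_def bij_betw_def)
  obtain i where i: "0 < i" "i < n" "{ord x, ord z} = {ord i, ord (pp i)}"
    using assms(5) unfolding rooted_order_edges[OF assms(1,2)] by auto
  have "pp i < n" using rooted_order_parent(1)[OF assms(2) i(1,2)] i by simp
  then have "x = i \<and> z = pp i \<or> x = pp i \<and> z = i"
    using i inj assms(3,4) by (auto simp: doubleton_eq_iff inj_on_def)
  with i that show ?thesis by blast
qed

lemma partition_image:
  assumes "\<And>i. i \<in> A \<Longrightarrow> cmp i \<in> C" "C \<subseteq> cmp ` A"
  shows "(\<lambda>i. {j \<in> A. cmp j = cmp i}) ` A = (\<lambda>t. {j \<in> A. cmp j = t}) ` C"
  using assms by (auto simp: image_iff subset_iff)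

context dp
begin

text \<open>Every node of the block labelled \<open>t\<close> climbs by parent edges inside the
  block to \<open>ord t\<close>, so any two nodes are joined through it. With unit weights the
  weight of a block is its cardinality.\<close>

lemma labels_feasible:
  fixes s w :: "nat \<Rightarrow> real"
  assumes ro: "rooted_order n E ord pp" and S: "\<And>i. i < n \<Longrightarrow> S i = s (ord i)"
    and cmp: "\<And>i. i < n \<Longrightarrow> cmp (ord i) = lab i"
    and lab: "\<And>v. v < n \<Longrightarrow> lab v \<le> v \<and> lab (lab v) = lab v \<and> (lab v = v \<or> lab v = lab (pp v) \<and> 0 < v)"
    and card: "\<And>t. t < n \<Longrightarrow> card {u. u < n \<and> lab u = t} \<le> W"
    and W: "real W \<le> w0" and w: "\<forall>i\<in>{1..n}. w i = 1"
    and Q: "Q = (\<lambda>i. {j \<in> {1..n}. cmp j = cmp i}) ` {1..n}"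
  shows "feasible n E w w0 Q"
    and "partition_cost s Q = (\<Sum>t | t < n \<and> lab t = t. Max (S ` {u. u < n \<and> lab u = t}))"
proof -
  have inj: "inj_on ord {..<n}" and img: "ord ` {..<n} = {1..n}"
    using ro by (simp_all add: rooted_order_def bij_betw_def)
  let ?T = "{t. t < n \<and> lab t = t}" and ?B = "\<lambda>t. {u. u < n \<and> lab u = t}"
  have blk: "{j \<in> {1..n}. cmp j = t} = ord ` ?B t" for t
    unfolding img[symmetric] using cmp by auto
  have QB: "Q = (\<lambda>t. ord ` ?B t) ` ?T"
  proof -
    have "Q = (\<lambda>t. {j \<in> {1..n}. cmp j = t}) ` ?T"
      unfolding Q
    proof (rule partition_image)
      fix i assume "i \<in> {1..n}"
      then obtain v where v: "i = ord v" "v < n" using img by blast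
      then show "cmp i \<in> ?T" using lab[of v] cmp[of v] by auto
    next
      show "?T \<subseteq> cmp ` {1..n}" unfolding img[symmetric] using cmp by force
    qed
    then show ?thesis by (simp only: blk)
  qed
  have cardB: "card (ord ` ?B t) = card (?B t)" for t
    by (rule card_image) (rule inj_on_subset[OF inj], auto)
  show "feasible n E w w0 Q"
    unfolding feasible_def
  proof (intro conjI ballI)
    show "partition_on {1..n} Q"
      unfolding Q by (intro partition_onI) (auto simp: disjnt_def)
  next
    fix K assume "K \<in> Q"
    then obtain t where t: "t < n" "lab t = t" "K = ord ` ?B t" using QB by auto
    let ?R = "{(a, b). a \<in> K \<and> b \<in> K \<and> {a, b} \<in> E}"
    have "sym ?R" by (rule symI) (simp add: insert_commute)
    then have symR: "sym (?R\<^sup>*)" by (rule sym_rtrancl)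
    have top: "(ord u, ord t) \<in> ?R\<^sup>*" if "u < n" "lab u = t" for u
      using that
    proof (induction u rule: less_induct)
      case (less u)
      show ?case
      proof (cases "u = t")
        case False
        then have u: "lab (pp u) = t" "0 < u" using lab[of u] less.prems by auto
        have p: "pp u < u" using pp_less u less.prems by simp
        then have "(ord (pp u), ord t) \<in> ?R\<^sup>*" using less.IH[of "pp u"] u less.prems by simp
        moreover have "(ord u, ord (pp u)) \<in> ?R"
          using p u less.prems t(3) rooted_order_parent(2)[OF ro, of u] by auto
        ultimately show ?thesis by (rule converse_rtrancl_into_rtrancl[rotated])
      qed simp
    qed
    have "(x, y) \<in> ?R\<^sup>*" if xy: "x \<in> K" "y \<in> K" for x y
    proof -
      obtain a b where ab: "x = ord a" "a < n" "lab a = t" "y = ord b" "b < n" "lab b = t"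
        using xy t(3) by auto
      have "(ord t, y) \<in> ?R\<^sup>*" using top[OF ab(5,6)] symD[OF symR] ab(4) by blast
      with top[OF ab(2,3)] show ?thesis unfolding ab(1) by (rule rtrancl_trans)
    qed
    moreover have "K \<noteq> {}" using t by auto
    ultimately show "connected_in E K" by (simp add: connected_in_def)
    have "K \<subseteq> {1..n}" using t(3) img by auto
    then have "(\<Sum>i\<in>K. w i) = real (card K)" using w by (simp add: subset_iff)
    also have "card K \<le> W" unfolding t(3) cardB using card t(1) .
    finally show "(\<Sum>i\<in>K. w i) \<le> w0" using W by simp
  qed
  \<comment> \<open>\<open>partition_cost\<close> sums over a set of components, so distinct labels
    must give distinct blocks.\<close>
  have "inj_on (\<lambda>t. ord ` ?B t) ?T"
  proof (rule inj_onI)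
    fix t t' assume tt: "t \<in> ?T" "t' \<in> ?T" "ord ` ?B t = ord ` ?B t'"
    have "ord t \<in> ord ` ?B t'" using tt by blast
    then obtain u where "u < n" "lab u = t'" "ord t = ord u" by blast
    moreover then have "t = u" using inj tt(1) by (simp add: inj_on_def)
    ultimately show "t = t'" using tt by simp
  qed
  then have "partition_cost s Q = (\<Sum>t\<in>?T. Max (s ` ord ` ?B t))"
    unfolding partition_cost_def QB by (simp add: sum.reindex)
  also have "\<dots> = (\<Sum>t\<in>?T. Max (S ` ?B t))"
  proof (rule sum.cong[OF refl])
    fix t
    have "s ` ord ` ?B t = S ` ?B t" unfolding image_image using S by (intro image_cong) auto
    then show "Max (s ` ord ` ?B t) = Max (S ` ?B t)" by simp
  qed
  finally show "partition_cost s Q = (\<Sum>t\<in>?T. Max (S ` ?B t))" .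
qed

text \<open>The components serve as their own labels. A component containing \<open>u\<close> and a
  node with a smaller number also contains the parent of \<open>u\<close>, because every path out of
  the subtree of \<open>u\<close> uses the edge to that parent.\<close>

lemma feasible_labelling:
  fixes s w :: "nat \<Rightarrow> real"
  assumes tree: "is_tree {1..n} E" and ro: "rooted_order n E ord pp"
    and S: "\<And>i. i < n \<Longrightarrow> S i = s (ord i)"
    and W: "W = n \<or> w0 < real W + 1" and w: "\<forall>i\<in>{1..n}. w i = 1"
    and P: "feasible n E w w0 P"
  obtains lab :: "nat \<Rightarrow> nat set" where "labelling lab" "lab_cost lab = partition_cost s P"
proof -
  have inj: "inj_on ord {..<n}" and img: "ord ` {..<n} = {1..n}"
    using ro by (simp_all add: rooted_order_def bij_betw_def)
  have part: "partition_on {1..n} P"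
    and comps: "\<And>K. K \<in> P \<Longrightarrow> connected_in E K \<and> (\<Sum>i\<in>K. w i) \<le> w0"
    using P by (auto simp: feasible_def)
  have "\<forall>u. \<exists>K. u < n \<longrightarrow> K \<in> P \<and> ord u \<in> K"
    using partition_onD1[OF part] img by blast
  then obtain lab where lab: "\<And>u. u < n \<Longrightarrow> lab u \<in> P" "\<And>u. u < n \<Longrightarrow> ord u \<in> lab u"
    by metis
  have uniq: "K = lab u" if "u < n" "K \<in> P" "ord u \<in> K" for u K
    using partition_onD2[OF part] lab[OF that(1)] that by (auto simp: disjoint_def)
  have memb: "K = ord ` {u. u < n \<and> lab u = K}" if K: "K \<in> P" for K
  proof
    show "ord ` {u. u < n \<and> lab u = K} \<subseteq> K" using lab by auto
    show "K \<subseteq> ord ` {u. u < n \<and> lab u = K}"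
    proof
      fix x assume x: "x \<in> K"
      then have "x \<in> {1..n}" using partition_onD1[OF part] K by auto
      then obtain u where "x = ord u" "u < n" using img by blast
      with uniq[of u K] x K show "x \<in> ord ` {u. u < n \<and> lab u = K}" by auto
    qed
  qed
  have parent: "lab (pp u) = lab u" if u: "u < n" "u \<notin> tops lab" for u
  proof (rule ccontr)
    assume ne: "lab (pp u) \<noteq> lab u"
    obtain t where t: "t < u" "lab t = lab u" using u by (auto simp: tops_def)
    let ?R = "{(a, b). a \<in> lab u \<and> b \<in> lab u \<and> {a, b} \<in> E}"
    have "(ord u, ord t) \<in> ?R\<^sup>*"
      using comps[OF lab(1)[OF u(1)]] lab(2)[of u] lab(2)[of t] t u by (simp add: connected_in_def)
    \<comment> \<open>\<open>an (Suc u) x = u\<close> says that \<open>x\<close> lies in the subtree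
      of \<open>u\<close>. A walk inside the component keeps this property, since the parent of
      \<open>u\<close> is assumed to lie elsewhere; but \<open>t < u\<close> is outside the
      subtree.\<close>
    then have "\<exists>x<n. ord t = ord x \<and> an (Suc u) x = u"
    proof (induction rule: rtrancl_induct)
      case base
      show ?case using u(1) by (auto simp: an_below)
    next
      case (step y z)
      then obtain x where x: "x < n" "y = ord x" "an (Suc u) x = u" by blast
      have "z \<in> {1..n}" using step.hyps(2) partition_onD1[OF part] lab(1)[OF u(1)] by auto
      then obtain z' where z: "z = ord z'" "z' < n" using img by blast
      have labz: "lab z' = lab u" using uniq[of z' "lab u"] step.hyps(2) z lab(1)[OF u(1)] by simp
      have ux: "u \<le> x" using x(3) an_below[of x "Suc u"] by (cases "x < Suc u") auto
      have e: "{ord x, ord z'} \<in> E" using step.hyps(2) x z by simp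
      from rooted_order_edgeE[OF tree ro x(1) z(2) e] show ?case
      proof cases
        case 1
        have "Suc u \<le> z'" using pp_less[OF 1(1) z(2)] 1(2) ux by simp
        then have "an (Suc u) z' = u" using an_above[of "Suc u" z'] z(2) 1(2) x(3) by simp
        with z show ?thesis by blast
      next
        case 2
        have "x \<noteq> u" using ne labz 2(2) by auto
        then have "an (Suc u) z' = u" using an_above[of "Suc u" x] ux x 2(2) by simp
        with z show ?thesis by blast
      qed
    qed
    then obtain x where x: "x < n" "ord t = ord x" "an (Suc u) x = u" by blast
    then have "x = t" using inj t u by (auto simp: inj_on_def)
    with x t show False by (simp add: an_below)
  qed
  \<comment> \<open>A node count below \<open>W + 1\<close> is at most \<open>W\<close>, so rounding
    \<open>w0\<close> down loses nothing, and neither does stopping at \<open>n\<close>.\<close>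
  have card: "card (block lab t) \<le> W" if t: "t < n" for t
  proof -
    have K: "lab t = ord ` block lab t" using memb[OF lab(1)[OF t]] by (simp add: block_def)
    have "card (lab t) = card (block lab t)"
      by (subst K, rule card_image) (rule inj_on_subset[OF inj], auto simp: block_def)
    moreover have "lab t \<subseteq> {1..n}" using partition_onD1[OF part] lab(1)[OF t] by auto
    then have "(\<Sum>i\<in>lab t. w i) = real (card (lab t))" using w by (simp add: subset_iff)
    moreover have "card (lab t) \<le> n" using card_mono[OF _ \<open>lab t \<subseteq> {1..n}\<close>] by simp
    ultimately show ?thesis using W comps[OF lab(1)[OF t]] by auto
  qed
  have tops: "lab ` tops lab = P"
  proof
    show "lab ` tops lab \<subseteq> P" using lab by (auto simp: tops_def)
    show "P \<subseteq> lab ` tops lab"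
    proof
      fix K assume K: "K \<in> P"
      then have "K \<noteq> {}" using partition_onD3[OF part] by auto
      with memb[OF K] have ex: "\<exists>u. u < n \<and> lab u = K" by auto
      define t where "t = (LEAST u. u < n \<and> lab u = K)"
      have t: "t < n" "lab t = K" using LeastI_ex[OF ex] by (simp_all add: t_def)
      moreover have "lab u \<noteq> K" if "u < t" for u
        using not_less_Least[of u "\<lambda>u. u < n \<and> lab u = K"] that t(1) by (auto simp: t_def)
      ultimately show "K \<in> lab ` tops lab" by (auto simp: tops_def)
    qed
  qed
  have "inj_on lab (tops lab)"
  proof (rule inj_onI)
    fix t u assume "t \<in> tops lab" "u \<in> tops lab" "lab t = lab u"
    then show "t = u" by (cases t u rule: linorder_cases) (auto simp: tops_def)
  qed
  then have "partition_cost s P = (\<Sum>t\<in>tops lab. Max (s ` lab t))"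
    unfolding partition_cost_def tops[symmetric] by (simp add: sum.reindex)
  also have "\<dots> = lab_cost lab"
    unfolding lab_cost_def
  proof (rule sum.cong[OF refl])
    fix t assume "t \<in> tops lab"
    then have "lab t = ord ` block lab t" using memb lab(1) by (simp add: tops_def block_def)
    then have "s ` lab t = (\<lambda>u. s (ord u)) ` block lab t" by (metis image_image)
    also have "\<dots> = S ` block lab t" using S by (intro image_cong) (auto simp: block_def)
    finally show "Max (s ` lab t) = Max (S ` block lab t)" by simp
  qed
  finally show ?thesis using that[of lab] parent card by (simp add: labelling_def)
qed

end

section \<open>Implementation and running time\<close>

abbreviation nvar :: "aname \<Rightarrow> nexp" where "nvar a \<equiv> NCell a (NConst 0)"
abbreviation rvar :: "aname \<Rightarrow> rexp" where "rvar a \<equiv> RCell a (NConst 0)"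
abbreviation nset :: "aname \<Rightarrow> nexp \<Rightarrow> com" where "nset a \<equiv> NAssign a (NConst 0)"
abbreviation rset :: "aname \<Rightarrow> rexp \<Rightarrow> com" where "rset a \<equiv> RAssign a (NConst 0)"
abbreviation incr :: "aname \<Rightarrow> com" where "incr a \<equiv> nset a (NAdd (nvar a) (NConst 1))"
notation Seq (infixr ";;" 60)

text \<open>Reals cannot be rounded on the machine, so the integer part of \<open>w0\<close> is
  found by counting in a natural and a real cell in parallel. Stopping at \<open>n\<close> bounds
  the loop for huge \<open>w0\<close>.\<close>

definition capacity_com :: com where
  "capacity_com =
     nset ''W'' (NConst 1) ;; rset ''x'' (RConst 1) ;;
     While (And (NLess (nvar ''W'') (nvar ''n'')) (Not (RLess (rvar ''w0'') (RAdd (rvar ''x'') (RConst 1)))))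
       (incr ''W'' ;; rset ''x'' (RAdd (rvar ''x'') (RConst 1)))"

lemma wp_capacity:
  assumes n: "nmem \<sigma> ''n'' 0 = n" "0 < n" and w0: "rmem \<sigma> ''w0'' 0 = w0" "1 \<le> w0"
  shows "wp capacity_com \<sigma> (\<lambda>t \<tau>. t \<le> 3 * n \<and> (\<exists>W. nmem \<tau> ''W'' 0 = W \<and> 0 < W \<and> W \<le> n \<and>
    real W \<le> w0 \<and> (W = n \<or> w0 < real W + 1)))"
proof -
  define F where "F = nat \<lfloor>w0\<rfloor>"
  have le_F: "k \<le> F \<longleftrightarrow> real k \<le> w0" for k
    unfolding F_def using w0 by (simp add: le_nat_iff le_floor_iff)
  have F: "1 \<le> F" using le_F[of 1] w0 by simp
  \<comment> \<open>\<open>W\<close> starts at 1, hence the subtraction.\<close>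
  define N where "N = min n F - 1"
  show ?thesis
    unfolding capacity_com_def
  proof (simp, rule wp_for[where N = N and T = "\<lambda>_. 2" and
        I = "\<lambda>j \<tau>. nmem \<tau> ''W'' 0 = Suc j \<and> rmem \<tau> ''x'' 0 = real (Suc j)"], goal_cases)
    case (2 j \<tau>)
    have "nmem \<tau> ''n'' 0 = n" "rmem \<tau> ''w0'' 0 = w0"
      using frame_nmem[OF 2(2), of "''n''"] frame_rmem[OF 2(2), of "''w0''"] n w0 by simp_all
    moreover have "j < N \<longleftrightarrow> Suc j < n \<and> Suc (Suc j) \<le> F" by (auto simp: N_def)
    ultimately show ?case using 2(1) by (auto simp: le_F)
  next
    case (4 t \<tau>)
    then have W: "nmem \<tau> ''W'' 0 = min n F" using F n by (simp add: N_def)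
    have "min n F = n \<or> w0 < real (min n F) + 1"
      using le_F[of "Suc F"] by (auto simp: min_def)
    moreover have "real (min n F) \<le> w0" using le_F[of "min n F"] by simp
    moreover have "Suc (Suc t) \<le> 3 * n" using 4(1) n by (simp add: N_def min_def split: if_splits)
    ultimately show ?case using W F n by simp
  qed auto
qed

text \<open>The order grows from node 1 by edges with exactly one marked end point, and the edge
  list is rescanned from its start for each new node. Fewer than \<open>n\<close> scans of fewer
  than \<open>n\<close> edges fit into the bound because \<open>W\<close> is at least 1. The scan
  has no bounds check: while nodes are unmarked, connectedness guarantees a crossing edge.\<close>

definition order_com :: com where
  "order_com =
     NAssign ''ord'' (NConst 0) (NConst 1) ;; NAssign ''mk'' (NConst 1) (NConst 1) ;;
     NAssign ''pos'' (NConst 1) (NConst 0) ;; nset ''q'' (NConst 1) ;;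
     While (NLess (nvar ''q'') (nvar ''n''))
       (nset ''k'' (NConst 0) ;;
        While (NEq (NCell ''mk'' (NCell ''u'' (nvar ''k''))) (NCell ''mk'' (NCell ''v'' (nvar ''k''))))
          (incr ''k'') ;;
        If (NEq (NCell ''mk'' (NCell ''u'' (nvar ''k''))) (NConst 0))
          (nset ''a'' (NCell ''u'' (nvar ''k'')) ;; nset ''b'' (NCell ''v'' (nvar ''k'')))
          (nset ''a'' (NCell ''v'' (nvar ''k'')) ;; nset ''b'' (NCell ''u'' (nvar ''k''))) ;;
        NAssign ''ord'' (nvar ''q'') (nvar ''a'') ;;
        NAssign ''pp'' (nvar ''q'') (NCell ''pos'' (nvar ''b'')) ;;
        NAssign ''pos'' (nvar ''a'') (nvar ''q'') ;;
        NAssign ''mk'' (nvar ''a'') (NConst 1) ;;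
        incr ''q'')"

definition growing ::
  "nat \<Rightarrow> nat set set \<Rightarrow> nat \<Rightarrow> (nat \<Rightarrow> nat) \<Rightarrow> (nat \<Rightarrow> nat) \<Rightarrow> (nat \<Rightarrow> nat) \<Rightarrow> (nat \<Rightarrow> nat) \<Rightarrow> bool" where
  "growing n E j ord pp pos mk \<longleftrightarrow> inj_on ord {..j} \<and> ord ` {..j} \<subseteq> {1..n} \<and>
     (\<forall>x\<in>{1..n}. mk x = (if x \<in> ord ` {..j} then 1 else 0)) \<and> (\<forall>i\<le>j. pos (ord i) = i) \<and>
     (\<forall>i. 0 < i \<and> i \<le> j \<longrightarrow> pp i < i \<and> {ord i, ord (pp i)} \<in> E)"

lemma growing_step:
  assumes g: "growing n E j ord pp pos mk" and a: "a \<in> {1..n}" "mk a = 0"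
    and b: "b \<in> {1..n}" "mk b \<noteq> 0" and e: "{a, b} \<in> E"
  shows "growing n E (Suc j) (ord(Suc j := a)) (pp(Suc j := pos b)) (pos(a := Suc j)) (mk(a := 1))"
proof -
  have na: "a \<notin> ord ` {..j}" using g a by (auto simp: growing_def split: if_splits)
  have "b \<in> ord ` {..j}" using g b by (auto simp: growing_def split: if_splits)
  then obtain i where i: "i \<le> j" "b = ord i" by auto
  then have pb: "pos b = i" using g by (simp add: growing_def)
  have img: "(ord(Suc j := a)) ` {..Suc j} = insert a (ord ` {..j})"
    by (auto simp: atMost_Suc)
  have "inj_on (ord(Suc j := a)) {..Suc j}"
    using g na by (auto simp: growing_def inj_on_def atMost_Suc image_iff le_Suc_eq)
  moreover have "\<forall>i\<le>Suc j. (pos(a := Suc j)) ((ord(Suc j := a)) i) = i"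
    using g na by (auto simp: growing_def image_iff le_Suc_eq)
  moreover have "\<forall>i. 0 < i \<and> i \<le> Suc j \<longrightarrow> (pp(Suc j := pos b)) i < i \<and>
      {(ord(Suc j := a)) i, (ord(Suc j := a)) ((pp(Suc j := pos b)) i)} \<in> E"
  proof (intro allI impI)
    fix l assume l: "0 < l \<and> l \<le> Suc j"
    show "(pp(Suc j := pos b)) l < l \<and>
      {(ord(Suc j := a)) l, (ord(Suc j := a)) ((pp(Suc j := pos b)) l)} \<in> E"
    proof (cases "l = Suc j")
      case True
      then show ?thesis using pb i e by simp
    next
      case False
      with l have "pp l < l \<and> {ord l, ord (pp l)} \<in> E" using g by (simp add: growing_def)
      with False l show ?thesis by simp
    qed
  qed
  moreover have "\<forall>x\<in>{1..n}. (mk(a := 1)) x = (if x \<in> insert a (ord ` {..j}) then 1 else 0)"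
    using g by (simp add: growing_def)
  moreover have "insert a (ord ` {..j}) \<subseteq> {1..n}" using g a(1) by (simp add: growing_def)
  ultimately show ?thesis unfolding growing_def img by blast
qed

lemma wp_order:
  fixes u v :: "nat \<Rightarrow> nat"
  assumes n: "nmem \<sigma> ''n'' 0 = n" "0 < n" and mk: "\<And>x. nmem \<sigma> ''mk'' x = 0"
    and uv: "\<And>k. k < M \<Longrightarrow> nmem \<sigma> ''u'' k = u k \<and> nmem \<sigma> ''v'' k = v k \<and> u k \<in> {1..n} \<and> v k \<in> {1..n}"
    and E: "E = (\<lambda>k. {u k, v k}) ` {..<M}" and conn: "connected_in E {1..n}"
  shows "wp order_com \<sigma> (\<lambda>t \<tau>. t \<le> n * (2 * M + 13) \<and> rooted_order n E (nmem \<tau> ''ord'') (nmem \<tau> ''pp''))"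
  unfolding order_com_def
proof (simp, rule wp_for[where N = "n - 1" and T = "\<lambda>_. 2 * M + 10" and
      I = "\<lambda>j \<tau>. nmem \<tau> ''q'' 0 = Suc j \<and>
        growing n E j (nmem \<tau> ''ord'') (nmem \<tau> ''pp'') (nmem \<tau> ''pos'') (nmem \<tau> ''mk'')"], goal_cases)
  case 1
  show ?case using n mk by (auto simp: growing_def)
next
  case (2 j \<tau>)
  have "nmem \<tau> ''n'' 0 = n" using frame_nmem[OF 2(2), of "''n''"] n by simp
  with 2 show ?case by auto
next
  case (3 j \<tau>)
  let ?ord = "nmem \<tau> ''ord''" and ?mk = "nmem \<tau> ''mk''"
  have g: "growing n E j ?ord (nmem \<tau> ''pp'') (nmem \<tau> ''pos'') ?mk" and q: "nmem \<tau> ''q'' 0 = Suc j"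
    using 3 by simp_all
  have nu: "nmem \<tau> ''u'' = nmem \<sigma> ''u''" and nv: "nmem \<tau> ''v'' = nmem \<sigma> ''v''"
    using frame_nmem[OF 3(2), of "''u''"] frame_nmem[OF 3(2), of "''v''"] by simp_all
  have mkX: "x \<in> {1..n} \<Longrightarrow> ?mk x = (if x \<in> ?ord ` {..j} then 1 else 0)" for x
    using g by (simp add: growing_def)
  let ?cross = "\<lambda>k. k < M \<and> ?mk (u k) \<noteq> ?mk (v k)"
  have "\<exists>k. ?cross k"
  proof -
    have "card (?ord ` {..j}) \<le> Suc j" using card_image_le[of "{..j}" ?ord] by simp
    then have neq: "?ord ` {..j} \<noteq> {1..n}" using 3(3) by auto
    have sub: "?ord ` {..j} \<subseteq> {1..n}" using g by (simp add: growing_def)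
    have "?ord ` {..j} \<noteq> {}" by auto
    from connected_in_crossing[OF conn sub this neq] obtain x y
      where xy: "x \<in> ?ord ` {..j}" "y \<in> {1..n} - ?ord ` {..j}" "{x, y} \<in> E" .
    then have mxy: "?mk x \<noteq> ?mk y" using mkX[of x] mkX[of y] sub by auto
    obtain k where "k < M" "{x, y} = {u k, v k}" using xy(3) E by auto
    with mxy show ?thesis by (auto simp: doubleton_eq_iff)
  qed
  \<comment> \<open>The first crossing edge; its index is the length of the scan, whence the term
    \<open>2 * M\<close> in the time bound.\<close>
  then obtain N where N: "?cross N" "\<And>k. k < N \<Longrightarrow> \<not> ?cross k"
    using exists_least_iff[of ?cross] by auto
  have uvN: "u N \<in> {1..n}" "v N \<in> {1..n}" "nmem \<sigma> ''u'' N = u N" "nmem \<sigma> ''v'' N = v N"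
    using uv N(1) by auto
  have eN: "{u N, v N} \<in> E" using E N(1) by auto
  show ?case
  proof (simp, rule wp_for[where N = N and T = "\<lambda>_. 1" and I = "\<lambda>j \<tau>. nmem \<tau> ''k'' 0 = j"], goal_cases)
    case (2 k \<rho>)
    have *: "nmem \<rho> ''mk'' = ?mk" "nmem \<rho> ''u'' = nmem \<sigma> ''u''" "nmem \<rho> ''v'' = nmem \<sigma> ''v''"
      using frame_nmem[OF 2(2), of "''mk''"] frame_nmem[OF 2(2), of "''u''"]
        frame_nmem[OF 2(2), of "''v''"] nu nv by simp_all
    have "k < M" using 2(3) N(1) by simp
    then show ?case using N(1) N(2)[of k] 2(1,3) uv[of k] by (cases "k = N") (auto simp: *)
  next
    case (4 t \<rho>)
    have *: "nmem \<rho> ''mk'' = ?mk" "nmem \<rho> ''u'' = nmem \<sigma> ''u''" "nmem \<rho> ''v'' = nmem \<sigma> ''v''"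
      "nmem \<rho> ''ord'' = ?ord" "nmem \<rho> ''pp'' = nmem \<tau> ''pp''" "nmem \<rho> ''pos'' = nmem \<tau> ''pos''"
      "nmem \<rho> ''q'' 0 = Suc j"
      using frame_nmem[OF 4(3)] nu nv q by simp_all
    have t: "t \<le> 2 * M + 1" using 4(1) N(1) by simp
    show ?case
    proof (cases "?mk (u N) = 0")
      case True
      then have "?mk (v N) \<noteq> 0" using N(1) by simp
      from growing_step[OF g uvN(1) True uvN(2) this eN] show ?thesis
        using True t by (simp add: * 4(2) uvN)
    next
      case False
      then have "?mk (v N) = 0"
        using N(1) mkX[OF uvN(1)] mkX[OF uvN(2)] by (simp split: if_splits)
      from growing_step[OF g uvN(2) this uvN(1) False] eN show ?thesis
        using False t by (simp add: * 4(2) uvN insert_commute)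
    qed
  qed auto
next
  case (4 t \<tau>)
  then have g: "growing n E (n - 1) (nmem \<tau> ''ord'') (nmem \<tau> ''pp'') (nmem \<tau> ''pos'') (nmem \<tau> ''mk'')"
    by simp
  have at: "{..n - 1} = {..<n}" using n by auto
  have inj: "inj_on (nmem \<tau> ''ord'') {..<n}" and sub: "nmem \<tau> ''ord'' ` {..<n} \<subseteq> {1..n}"
    using g unfolding growing_def at by auto
  have "card (nmem \<tau> ''ord'' ` {..<n}) = n" using inj by (simp add: card_image)
  then have "nmem \<tau> ''ord'' ` {..<n} = {1..n}" using sub by (intro card_subset_eq) auto
  with inj g n have "rooted_order n E (nmem \<tau> ''ord'') (nmem \<tau> ''pp'')"
    by (auto simp: rooted_order_def bij_betw_def growing_def)
  moreover have "Suc (Suc (Suc (Suc t))) \<le> n * (2 * M + 13)"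
    using 4(1) n by (cases n) (auto simp: algebra_simps)
  ultimately show ?case by simp
qed

definition multiples_com :: "aname \<Rightarrow> nexp \<Rightarrow> com" where
  "multiples_com a e =
     nset ''j'' (NConst 0) ;;
     While (NLess (nvar ''j'') (nvar ''n''))
       (NAssign a (NAdd (nvar ''j'') (NConst 1)) (NAdd (NCell a (nvar ''j'')) e) ;; incr ''j'')"

text \<open>The range includes \<open>k = n\<close> because the entry of \<open>RM\<close> at
  \<open>n\<close> is the stride \<open>n * Suc W\<close> of \<open>RV\<close>. The assumption on
  \<open>e\<close> keeps the stride constant while \<open>a\<close> and \<open>j\<close>
  change.\<close>

lemma wp_multiples:
  assumes n: "nmem \<sigma> ''n'' 0 = n" and a: "nmem \<sigma> a 0 = 0" "a \<noteq> ''j''" "a \<noteq> ''n''"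
    and e: "\<And>\<tau>. (\<forall>b. b \<noteq> a \<and> b \<noteq> ''j'' \<longrightarrow> nmem \<tau> b = nmem \<sigma> b) \<Longrightarrow> nval e \<tau> = L"
  shows "wp (multiples_com a e) \<sigma> (\<lambda>t \<tau>. t \<le> 3 * n + 2 \<and> (\<forall>k\<le>n. nmem \<tau> a k = k * L))"
  unfolding multiples_com_def
proof (simp, rule wp_for[where N = n and T = "\<lambda>_. 2" and
      I = "\<lambda>j \<tau>. nmem \<tau> ''j'' 0 = j \<and> (\<forall>k\<le>j. nmem \<tau> a k = k * L)"], goal_cases)
  case (2 j \<tau>)
  have "nmem \<tau> ''n'' 0 = n" using frame_nmem[OF 2(2), of "''n''"] n a by simp
  with 2 show ?case by simp
next
  case (3 j \<tau>)
  have "nval e \<tau> = L" using frame_nmem[OF 3(2)] by (intro e) simp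
  with 3 a show ?case by (auto simp: le_Suc_eq)
qed (use a in auto)

definition cell_ix :: "nexp \<Rightarrow> nexp \<Rightarrow> nexp \<Rightarrow> nexp" where
  "cell_ix v m k = NAdd (NAdd (NCell ''RV'' v) (NCell ''RM'' m)) k"

abbreviation thr :: "nexp \<Rightarrow> rexp" where "thr m \<equiv> RCell ''s'' (NCell ''ord'' m)"

abbreviation tab :: "nexp \<Rightarrow> nexp \<Rightarrow> nexp \<Rightarrow> rexp" where "tab v m k \<equiv> RCell ''f'' (cell_ix v m k)"

text \<open>There is no multiplication on the machine, so the row offsets of the tables \<open>f\<close> and \<open>ch\<close> are precomputed
  in \<open>RV\<close> and \<open>RM\<close>. Further arrays: \<open>sz\<close> holds the number of nodes merged into a node, capped at \<open>W\<close>;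
  \<open>g\<close>, \<open>gm\<close>, \<open>gk\<close> hold the cost of closing a component and where it is attained; during backtracking,
  \<open>mm\<close> and \<open>kk\<close> hold the threshold and the number of nodes still to be distributed.\<close>

definition init_com :: com where
  "init_com =
     nset ''i'' (NConst 0) ;;
     While (NLess (nvar ''i'') (nvar ''n''))
       (NAssign ''sz'' (nvar ''i'') (NConst 1) ;;
        nset ''m'' (NConst 0) ;;
        While (NLess (nvar ''m'') (nvar ''n''))
          (If (RLess (thr (nvar ''m'')) (thr (nvar ''i'')))
             (RAssign ''f'' (cell_ix (nvar ''i'') (nvar ''m'') (NConst 1)) (thr (nvar ''i'')))
             (RAssign ''f'' (cell_ix (nvar ''i'') (nvar ''m'') (NConst 1)) (RConst 0)) ;;
           incr ''m'') ;;
        incr ''i'')"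

text \<open>The running minimum starts from the candidate \<open>m = 0\<close>,
  \<open>k = 1\<close>, which always exists, in place of an infinite value.\<close>

definition best_com :: com where
  "best_com =
     NAssign ''gm'' (nvar ''i'') (NConst 0) ;;
     NAssign ''gk'' (nvar ''i'') (NConst 1) ;;
     RAssign ''g'' (nvar ''i'') (RAdd (thr (NConst 0)) (tab (nvar ''i'') (NConst 0) (NConst 1))) ;;
     nset ''m'' (NConst 0) ;;
     While (NLess (nvar ''m'') (nvar ''n''))
       (nset ''k'' (NConst 1) ;;
        While (NLess (nvar ''k'') (NAdd (NCell ''sz'' (nvar ''i'')) (NConst 1)))
          (If (RLess (RAdd (thr (nvar ''m'')) (tab (nvar ''i'') (nvar ''m'') (nvar ''k''))) (RCell ''g'' (nvar ''i'')))
             (RAssign ''g'' (nvar ''i'') (RAdd (thr (nvar ''m'')) (tab (nvar ''i'') (nvar ''m'') (nvar ''k''))) ;;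
              NAssign ''gm'' (nvar ''i'') (nvar ''m'') ;;
              NAssign ''gk'' (nvar ''i'') (nvar ''k''))
             Skip ;;
           incr ''k'') ;;
        incr ''m'')"

text \<open>Let \<open>a\<close> and \<open>b\<close> be the sizes of the sides of \<open>p\<close>
  and \<open>i\<close>. Only splits with \<open>1 <= j <= b\<close> and
  \<open>1 <= k - j <= a\<close> are tried; this window has at most \<open>min a b\<close> elements,
  which the amortised bound relies on. The first candidate is the cut if \<open>k <= a\<close>, and
  otherwise, the cut being impossible, the split \<open>j = k - a\<close>.\<close>

definition pull_com :: com where
  "pull_com =
     If (NLess (NCell ''sz'' (nvar ''p'')) (nvar ''k''))
       (nset ''j'' (NSub (nvar ''k'') (NCell ''sz'' (nvar ''p''))) ;;
        rset ''x'' (RAdd (tab (nvar ''p'') (nvar ''m'') (NSub (nvar ''k'') (nvar ''j'')))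
          (tab (nvar ''i'') (nvar ''m'') (nvar ''j''))) ;;
        nset ''c'' (nvar ''j''))
       (nset ''j'' (NConst 1) ;;
        rset ''x'' (RAdd (tab (nvar ''p'') (nvar ''m'') (nvar ''k'')) (RCell ''g'' (nvar ''i''))) ;;
        nset ''c'' (NConst 0)) ;;
     While (And (NLess (nvar ''j'') (NAdd (NCell ''sz'' (nvar ''i'')) (NConst 1))) (NLess (nvar ''j'') (nvar ''k'')))
       (If (RLess (RAdd (tab (nvar ''p'') (nvar ''m'') (NSub (nvar ''k'') (nvar ''j'')))
              (tab (nvar ''i'') (nvar ''m'') (nvar ''j''))) (rvar ''x''))
          (rset ''x'' (RAdd (tab (nvar ''p'') (nvar ''m'') (NSub (nvar ''k'') (nvar ''j'')))
             (tab (nvar ''i'') (nvar ''m'') (nvar ''j''))) ;;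
           nset ''c'' (nvar ''j''))
          Skip ;;
        incr ''j'')"

text \<open>Since \<open>k\<close> decreases and the new entry \<open>k\<close> depends only on old entries up to \<open>k\<close>, the row of the parent
  can be updated in place.\<close>

definition row_com :: com where
  "row_com =
     nset ''k'' (nvar ''q'') ;;
     While (NLess (NConst 0) (nvar ''k''))
       (pull_com ;;
        RAssign ''f'' (cell_ix (nvar ''p'') (nvar ''m'') (nvar ''k'')) (rvar ''x'') ;;
        NAssign ''ch'' (cell_ix (nvar ''i'') (nvar ''m'') (nvar ''k'')) (nvar ''c'') ;;
        nset ''k'' (NSub (nvar ''k'') (NConst 1)))"

definition merge_com :: com where
  "merge_com =
     nset ''p'' (NCell ''pp'' (nvar ''i'')) ;;
     nset ''q'' (NAdd (NCell ''sz'' (nvar ''p'')) (NCell ''sz'' (nvar ''i''))) ;;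
     If (NLess (nvar ''W'') (nvar ''q'')) (nset ''q'' (nvar ''W'')) Skip ;;
     nset ''m'' (NConst 0) ;;
     While (NLess (nvar ''m'') (nvar ''n'')) (row_com ;; incr ''m'') ;;
     NAssign ''sz'' (nvar ''p'') (nvar ''q'')"

text \<open>The loop ends with \<open>i = 0\<close>, so the final \<open>best_com\<close> closes the
  component of the root.\<close>

definition dp_com :: com where
  "dp_com =
     nset ''i'' (NSub (nvar ''n'') (NConst 1)) ;;
     While (NLess (NConst 0) (nvar ''i''))
       (best_com ;; merge_com ;; nset ''i'' (NSub (nvar ''i'') (NConst 1))) ;;
     best_com"

definition backtrack_com :: com where
  "backtrack_com =
     NAssign ''comp'' (NCell ''ord'' (NConst 0)) (NConst 0) ;;
     NAssign ''mm'' (NConst 0) (NCell ''gm'' (NConst 0)) ;;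
     NAssign ''kk'' (NConst 0) (NCell ''gk'' (NConst 0)) ;;
     nset ''i'' (NConst 1) ;;
     While (NLess (nvar ''i'') (nvar ''n''))
       (nset ''p'' (NCell ''pp'' (nvar ''i'')) ;;
        nset ''c'' (NCell ''ch'' (cell_ix (nvar ''i'') (NCell ''mm'' (nvar ''p'')) (NCell ''kk'' (nvar ''p'')))) ;;
        If (NEq (nvar ''c'') (NConst 0))
          (NAssign ''comp'' (NCell ''ord'' (nvar ''i'')) (nvar ''i'') ;;
           NAssign ''mm'' (nvar ''i'') (NCell ''gm'' (nvar ''i'')) ;;
           NAssign ''kk'' (nvar ''i'') (NCell ''gk'' (nvar ''i'')))
          (NAssign ''comp'' (NCell ''ord'' (nvar ''i'')) (NCell ''comp'' (NCell ''ord'' (nvar ''p''))) ;;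
           NAssign ''mm'' (nvar ''i'') (NCell ''mm'' (nvar ''p'')) ;;
           NAssign ''kk'' (nvar ''i'') (nvar ''c'') ;;
           NAssign ''kk'' (nvar ''p'') (NSub (NCell ''kk'' (nvar ''p'')) (nvar ''c''))) ;;
        incr ''i'')"

section \<open>Table layout, initial entries and closing a component\<close>

context dp
begin

definition ix :: "nat \<Rightarrow> nat \<Rightarrow> nat \<Rightarrow> nat" where
  "ix v m k = v * (n * Suc W) + m * Suc W + k"

text \<open>Uniqueness of digits in a mixed radix system, with \<open>v\<close> as the unbounded
  leading digit.\<close>

lemma ix_eq_iff [simp]:
  assumes "m < n" "m' < n" "k \<le> W" "k' \<le> W"
  shows "ix v m k = ix v' m' k' \<longleftrightarrow> v = v' \<and> m = m' \<and> k = k'"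
proof
  assume eq: "ix v m k = ix v' m' k'"
  have ix: "ix v m k = (v * n + m) * Suc W + k" for v m k
    by (simp add: ix_def algebra_simps)
  have dm: "(a * b + r) div b = a" "(a * b + r) mod b = r" if "r < b" for a b r :: nat
    using that by auto
  have "ix v m k mod Suc W = k" "ix v' m' k' mod Suc W = k'"
    unfolding ix using assms by (simp_all only: dm le_imp_less_Suc)
  moreover have "ix v m k div Suc W = v * n + m" "ix v' m' k' div Suc W = v' * n + m'"
    unfolding ix using assms by (simp_all only: dm le_imp_less_Suc)
  ultimately have k: "k = k'" and vm: "v * n + m = v' * n + m'" using eq by simp_all
  have "(v * n + m) mod n = m" "(v' * n + m') mod n = m'" "(v * n + m) div n = v" "(v' * n + m') div n = v'"
    using assms by simp_all
  with k vm show "v = v' \<and> m = m' \<and> k = k'" by metis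
qed simp

text \<open>The data that all later programs only read, gathered so that one frame argument
  preserves it.\<close>

definition base :: "memory \<Rightarrow> bool" where
  "base \<sigma> \<longleftrightarrow> nmem \<sigma> ''n'' 0 = n \<and> nmem \<sigma> ''W'' 0 = W \<and> (\<forall>m<n. nmem \<sigma> ''RM'' m = m * Suc W) \<and>
     (\<forall>v<n. nmem \<sigma> ''RV'' v = v * (n * Suc W)) \<and> nmem \<sigma> ''pp'' = pp \<and>
     (\<forall>i<n. rmem \<sigma> ''s'' (nmem \<sigma> ''ord'' i) = S i)"

lemma base_cong:
  assumes "base \<sigma>" "\<And>a. a \<in> {''n'', ''W'', ''RM'', ''RV'', ''pp'', ''ord''} \<Longrightarrow> nmem \<tau> a = nmem \<sigma> a"
    "rmem \<tau> ''s'' = rmem \<sigma> ''s''"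
  shows "base \<tau>"
proof -
  have "nmem \<tau> ''n'' = nmem \<sigma> ''n''" "nmem \<tau> ''W'' = nmem \<sigma> ''W''" "nmem \<tau> ''RM'' = nmem \<sigma> ''RM''"
    "nmem \<tau> ''RV'' = nmem \<sigma> ''RV''" "nmem \<tau> ''pp'' = nmem \<sigma> ''pp''" "nmem \<tau> ''ord'' = nmem \<sigma> ''ord''"
    using assms(2) by simp_all
  note eqs = this
  from assms(1) show ?thesis unfolding base_def eqs assms(3) .
qed

lemma base_nwrite [simp]:
  assumes "a \<notin> {''n'', ''W'', ''RM'', ''RV'', ''pp'', ''ord''}"
  shows "base (nwrite a i x \<sigma>) \<longleftrightarrow> base \<sigma>"
  using assms by (intro iffI; elim base_cong; auto)

lemma base_rwrite [simp]: "a \<noteq> ''s'' \<Longrightarrow> base (rwrite a i x \<sigma>) \<longleftrightarrow> base \<sigma>"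
  by (intro iffI; elim base_cong; auto)

lemma base_frame:
  assumes "base \<sigma>" "frame c \<sigma> \<tau>" "{''n'', ''W'', ''RM'', ''RV'', ''pp'', ''ord''} \<inter> nmods c = {}" "''s'' \<notin> rmods c"
  shows "base \<tau>"
  using assms(1)
proof (rule base_cong)
  fix a assume "a \<in> {''n'', ''W'', ''RM'', ''RV'', ''pp'', ''ord''}"
  then have "a \<notin> nmods c" using assms(3) by blast
  then show "nmem \<tau> a = nmem \<sigma> a" by (rule frame_nmem[OF assms(2)])
qed (rule frame_rmem[OF assms(2,4)])

lemma base_simps [simp]:
  assumes "base \<sigma>"
  shows "nmem \<sigma> ''n'' 0 = n" "nmem \<sigma> ''W'' 0 = W" "nmem \<sigma> ''pp'' = pp"
    "i < n \<Longrightarrow> rmem \<sigma> ''s'' (nmem \<sigma> ''ord'' i) = S i"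
  using assms unfolding base_def by blast+

lemma base_rows:
  assumes "base \<sigma>"
  shows "i < n \<Longrightarrow> nmem \<sigma> ''RM'' i = i * Suc W" "i < n \<Longrightarrow> nmem \<sigma> ''RV'' i = i * (n * Suc W)"
  using assms unfolding base_def by blast+

lemma nval_cell_ix [simp]:
  "base \<sigma> \<Longrightarrow> nval v \<sigma> < n \<Longrightarrow> nval m \<sigma> < n \<Longrightarrow> nval (cell_ix v m k) \<sigma> = ix (nval v \<sigma>) (nval m \<sigma>) (nval k \<sigma>)"
  by (simp only: cell_ix_def base_rows ix_def nval.simps)

text \<open>Only column 1 receives values: every capacity is still 1 here, and merges write the
  other columns before they are read.\<close>

lemma wp_init:
  assumes base: "base \<sigma>"
  shows "wp init_com \<sigma> (\<lambda>t \<tau>. t \<le> 12 * (n * n) \<and> base \<tau> \<and> (\<forall>v<n. nmem \<tau> ''sz'' v = 1) \<and>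
    (\<forall>v<n. \<forall>m<n. rmem \<tau> ''f'' (ix v m 1) = pen m v))"
proof -
  let ?inv = "\<lambda>j \<tau>. nmem \<tau> ''i'' 0 = j \<and> base \<tau> \<and> (\<forall>v<j. nmem \<tau> ''sz'' v = 1) \<and>
    (\<forall>v<j. \<forall>m<n. rmem \<tau> ''f'' (ix v m 1) = pen m v)"
  show ?thesis
    unfolding init_com_def
  proof (simp, rule wp_for[where N = n and T = "\<lambda>_. 4 * n + 4" and I = ?inv], goal_cases)
    case 1
    then show ?case using base by simp
  next
    case (2 j \<tau>)
    then show ?case by simp
  next
    case (3 j \<tau>)
    show ?case
    proof (simp, rule wp_for[where N = n and T = "\<lambda>_. 3" and
          I = "\<lambda>l \<tau>. nmem \<tau> ''i'' 0 = j \<and> nmem \<tau> ''m'' 0 = l \<and> base \<tau> \<and> (\<forall>v<Suc j. nmem \<tau> ''sz'' v = 1) \<and>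
            (\<forall>v<j. \<forall>m<n. rmem \<tau> ''f'' (ix v m 1) = pen m v) \<and>
            (\<forall>m<l. rmem \<tau> ''f'' (ix j m 1) = pen m j)"], goal_cases)
      case 1
      then show ?case using 3 by (simp add: less_Suc_eq)
    next
      case (2 l \<tau>)
      then show ?case by simp
    next
      case (3 l \<rho>)
      with \<open>j < n\<close> W_pos show ?case by (auto simp: pen_def less_Suc_eq)
    next
      case (4 t \<tau>)
      then show ?case by (auto simp: less_Suc_eq)
    qed
  next
    case (4 t \<tau>)
    have "Suc t \<le> 12 * (n * n)"
      using 4(1) n_pos by (cases n) (auto simp: algebra_simps)
    with 4 show ?case by simp
  qed
qed

lemma wp_best:
  fixes \<sigma> :: memory and i c :: nat
  defines "F \<equiv> \<lambda>m k. rmem \<sigma> ''f'' (ix i m k)"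
  assumes base: "base \<sigma>" and i: "nmem \<sigma> ''i'' 0 = i" "i < n" and c: "nmem \<sigma> ''sz'' i = c" "1 \<le> c" "c \<le> W"
  shows "wp best_com \<sigma> (\<lambda>t \<tau>. t \<le> 17 * (n * c) \<and> base \<tau> \<and> (\<exists>a b x.
    nmem \<tau> ''gm'' = (nmem \<sigma> ''gm'')(i := a) \<and> nmem \<tau> ''gk'' = (nmem \<sigma> ''gk'')(i := b) \<and>
    rmem \<tau> ''g'' = (rmem \<sigma> ''g'')(i := x) \<and>
    (\<forall>m<n. \<forall>k\<in>{1..c}. x \<le> S m + F m k) \<and> a < n \<and> b \<in> {1..c} \<and> x = S a + F a b))"
proof -
  \<comment> \<open>\<open>Z\<close> collects the pairs examined so far; the running minimum always
    comes with a pair attaining it, even while \<open>Z\<close> is empty.\<close>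
  define inv where "inv Z \<tau> \<longleftrightarrow> base \<tau> \<and> (\<exists>a b x.
    nmem \<tau> ''gm'' = (nmem \<sigma> ''gm'')(i := a) \<and> nmem \<tau> ''gk'' = (nmem \<sigma> ''gk'')(i := b) \<and>
    rmem \<tau> ''g'' = (rmem \<sigma> ''g'')(i := x) \<and>
    (\<forall>(m, k)\<in>Z. x \<le> S m + F m k) \<and> a < n \<and> b \<in> {1..c} \<and> x = S a + F a b)" for Z \<tau>
  have invI: "inv Z \<tau>" if "base \<tau>" "nmem \<tau> ''gm'' = (nmem \<sigma> ''gm'')(i := a)"
    "nmem \<tau> ''gk'' = (nmem \<sigma> ''gk'')(i := b)" "rmem \<tau> ''g'' = (rmem \<sigma> ''g'')(i := S a + F a b)"
    "\<And>m k. (m, k) \<in> Z \<Longrightarrow> S a + F a b \<le> S m + F m k" "a < n" "b \<in> {1..c}" for Z \<tau> a b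
    using that unfolding inv_def by blast
  have inv_nset: "inv Z (nwrite d l y \<tau>) \<longleftrightarrow> inv Z \<tau>" if "d = ''m'' \<or> d = ''k''" for Z d l y \<tau>
    using that by (auto simp: inv_def)
  show ?thesis
    unfolding best_com_def
  proof (simp add: base i n_pos, rule wp_for[where N = n and T = "\<lambda>_. 6 * c + 3" and
        I = "\<lambda>j \<tau>. nmem \<tau> ''m'' 0 = j \<and> inv ({..<j} \<times> {1..c}) \<tau>"], goal_cases)
    case 1
    show ?case using base c n_pos i by (auto simp: F_def intro!: invI[of _ 0 1])
  next
    case (2 j \<tau>)
    then show ?case by (simp add: inv_def)
  next
    case (3 j \<tau>)
    show ?case
    proof (simp, rule wp_for[where N = c and T = "\<lambda>_. 5" and
          I = "\<lambda>l \<tau>. nmem \<tau> ''m'' 0 = j \<and> nmem \<tau> ''k'' 0 = Suc l \<and>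
            inv ({..<j} \<times> {1..c} \<union> {j} \<times> {1..l}) \<tau>"], goal_cases)
      case 1
      show ?case using 3(1) by (simp add: inv_nset)
    next
      case (2 l \<rho>)
      have "nmem \<rho> ''sz'' = nmem \<sigma> ''sz''" "nmem \<rho> ''i'' = nmem \<sigma> ''i''"
        using frame_nmem[OF 2(2)] frame_nmem[OF 3(2)] by simp_all
      with 2(1) c i show ?case by auto
    next
      case (3 l \<rho>)
      have fr: "nmem \<rho> ''sz'' = nmem \<sigma> ''sz''" "nmem \<rho> ''i'' = nmem \<sigma> ''i''" "rmem \<rho> ''f'' = rmem \<sigma> ''f''"
        using frame_nmem[OF 3(2)] frame_nmem[OF \<open>frame _ _ \<tau>\<close>]
         frame_rmem[OF 3(2)] frame_rmem[OF \<open>frame _ _ \<tau>\<close>] by simp_all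
      from 3(1) obtain a b where *: "nmem \<rho> ''gm'' = (nmem \<sigma> ''gm'')(i := a)"
        "nmem \<rho> ''gk'' = (nmem \<sigma> ''gk'')(i := b)" "rmem \<rho> ''g'' = (rmem \<sigma> ''g'')(i := S a + F a b)"
        "\<And>m k. (m, k) \<in> {..<j} \<times> {1..c} \<union> {j} \<times> {1..l} \<Longrightarrow> S a + F a b \<le> S m + F m k"
        "a < n" "b \<in> {1..c}" unfolding inv_def by blast
      have jl: "nmem \<rho> ''m'' 0 = j" "nmem \<rho> ''k'' 0 = Suc l" "base \<rho>" "j < n" "Suc l \<in> {1..c}"
        using 3 \<open>j < n\<close> by (auto simp: inv_def)
      have new: "(m, k) \<in> {..<j} \<times> {1..c} \<union> {j} \<times> {1..l} \<or> m = j \<and> k = Suc l"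
        if "(m, k) \<in> {..<j} \<times> {1..c} \<union> {j} \<times> {1..Suc l}" for m k
        using that by (auto simp: le_Suc_eq)
      have F: "nmem \<rho> ''i'' 0 = i" "rmem \<rho> ''f'' (ix i j (Suc l)) = F j (Suc l)"
        using fr i by (simp_all add: F_def)
      show ?case
      proof (cases "S j + F j (Suc l) < S a + F a b")
        case True
        have le: "S j + F j (Suc l) \<le> S m + F m k"
          if "(m, k) \<in> {..<j} \<times> {1..c} \<union> {j} \<times> {1..Suc l}" for m k
          using new[OF that] *(4)[of m k] True by auto
        have "inv ({..<j} \<times> {1..c} \<union> {j} \<times> {1..Suc l}) (nwrite ''gk'' i (Suc l) (nwrite ''gm'' i j
            (rwrite ''g'' i (S j + F j (Suc l)) \<rho>)))"
          by (rule invI[OF _ _ _ _ le jl(4,5)]) (simp_all add: * jl)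
        then show ?thesis by (simp add: True F i(2) * jl inv_nset)
      next
        case False
        have le: "S a + F a b \<le> S m + F m k"
          if "(m, k) \<in> {..<j} \<times> {1..c} \<union> {j} \<times> {1..Suc l}" for m k
          using new[OF that] *(4)[of m k] False by auto
        have "inv ({..<j} \<times> {1..c} \<union> {j} \<times> {1..Suc l}) \<rho>"
          by (rule invI[OF _ _ _ _ le *(5,6)]) (simp_all add: * jl)
        then show ?thesis by (simp add: False F i(2) * jl inv_nset)
      qed
    next
      case (4 t \<rho>)
      have "{..<j} \<times> {1..c} \<union> {j} \<times> {1..c} = {..<Suc j} \<times> {1..c}" by auto
      then show ?case using 4(1,2) by (simp add: inv_nset)
    qed
  next
    case (4 t \<tau>)
    have "Suc (Suc (Suc (Suc t))) \<le> 17 * (n * c)"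
      using 4(1) n_pos c(2) by (cases n; cases c) (auto simp: algebra_simps)
    moreover have "base \<tau>" using 4(2) by (simp add: inv_def)
    ultimately show ?case using 4(2) unfolding inv_def by fastforce
  qed
qed

end

text \<open>The state of the search for one new entry: \<open>x\<close> is at most the cut, if that
  is possible, and at most every split \<open>j < l\<close>, and the choice \<open>c\<close> attains
  it. At \<open>l = k\<close> all splits have been tried.\<close>

definition pulled ::
  "(nat \<Rightarrow> real) \<Rightarrow> (nat \<Rightarrow> real) \<Rightarrow> real \<Rightarrow> nat \<Rightarrow> nat \<Rightarrow> nat \<Rightarrow> nat \<Rightarrow> real \<Rightarrow> nat \<Rightarrow> bool" where
  "pulled F H G a b k l x c \<longleftrightarrow> (k \<le> a \<longrightarrow> x \<le> F k + G) \<and>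
     (\<forall>j\<in>{1..b}. j < l \<and> j < k \<and> k - j \<le> a \<longrightarrow> x \<le> F (k - j) + H j) \<and>
     (c = 0 \<and> k \<le> a \<and> x = F k + G \<or> c \<in> {1..b} \<and> c < k \<and> k - c \<le> a \<and> x = F (k - c) + H c)"

lemma pulled_step_less:
  assumes "pulled F H G a b k l x c" "F (k - l) + H l < x" "l \<in> {1..b}" "l < k" "k - l \<le> a"
  shows "pulled F H G a b k (Suc l) (F (k - l) + H l) l"
  using assms unfolding pulled_def less_Suc_eq by fastforce

lemma pulled_step_geq:
  assumes "pulled F H G a b k l x c" "\<not> F (k - l) + H l < x"
  shows "pulled F H G a b k (Suc l) x c"
  using assms unfolding pulled_def less_Suc_eq by fastforce

text \<open>Old entries of the parent matter only up to size \<open>k\<close>. This makes updating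
  in place sound: while \<open>k\<close> runs downwards, exactly these entries are still
  intact.\<close>

lemma pulled_cong:
  assumes "pulled F' H' G a b k l x c" "1 \<le> k" "\<And>k'. k' \<in> {1..a} \<Longrightarrow> k' \<le> k \<Longrightarrow> F k' = F' k'"
    "\<And>j. j \<in> {1..b} \<Longrightarrow> H j = H' j"
  shows "pulled F H G a b k l x c"
  using assms(1,2) unfolding pulled_def by (auto simp: assms(3,4))

section \<open>Correctness and cost of one merge\<close>

context dp
begin

lemma merge_okI:
  assumes i: "0 < i" "i < n"
    and other: "\<And>v m k. v < i \<Longrightarrow> v \<noteq> pp i \<Longrightarrow> m < n \<Longrightarrow> k \<in> {1..W} \<Longrightarrow> V i v m k = V (Suc i) v m k"
    and pull: "\<And>m k. m < n \<Longrightarrow> k \<in> {1..cap i (pp i)} \<Longrightarrow>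
      pulled (V (Suc i) (pp i) m) (V (Suc i) i m) (G i) (cap (Suc i) (pp i)) (cap (Suc i) i) k k
        (V i (pp i) m k) (ch i m k)"
  shows "merge_ok V G ch i"
  unfolding merge_ok_def
proof (intro conjI allI impI ballI)
  fix m k assume m: "m < n" and k: "k \<in> {1..cap (Suc i) (pp i)}"
  then have "k \<in> {1..cap i (pp i)}" using cap_merge[OF i] cap_le[of "Suc i" "pp i"] by simp
  from pull[OF m this] k show "V i (pp i) m k \<le> V (Suc i) (pp i) m k + G i"
    unfolding pulled_def by simp
next
  fix m k j assume m: "m < n" and kj: "k \<in> {1..cap (Suc i) (pp i)}" "j \<in> {1..cap (Suc i) i}" "k + j \<le> W"
  then have "k + j \<in> {1..cap i (pp i)}" using cap_merge[OF i] by simp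
  from pull[OF m this] have "\<forall>j'\<in>{1..cap (Suc i) i}. j' < k + j \<and> k + j - j' \<le> cap (Suc i) (pp i) \<longrightarrow>
      V i (pp i) m (k + j) \<le> V (Suc i) (pp i) m (k + j - j') + V (Suc i) i m j'"
    unfolding pulled_def by simp
  from bspec[OF this kj(2)] kj show "V i (pp i) m (k + j) \<le> V (Suc i) (pp i) m k + V (Suc i) i m j"
    by simp
next
  fix m k assume "m < n" "k \<in> {1..cap i (pp i)}"
  from pull[OF this] show
    "ch i m k = 0 \<and> k \<le> cap (Suc i) (pp i) \<and> V i (pp i) m k = V (Suc i) (pp i) m k + G i \<or>
      ch i m k \<in> {1..cap (Suc i) i} \<and> ch i m k < k \<and> k - ch i m k \<le> cap (Suc i) (pp i) \<and>
      V i (pp i) m k = V (Suc i) (pp i) m (k - ch i m k) + V (Suc i) i m (ch i m k)"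
    unfolding pulled_def by blast
qed (rule other)

text \<open>Stage \<open>i\<close> is added without touching the later stages, since the machine
  arrays keep the results of all nodes side by side. Agreement of \<open>ch\<close> is asked only
  for \<open>m < n\<close> and \<open>k <= W\<close>, where distinct index triples occupy distinct
  cells.\<close>

lemma table_ok_extend:
  assumes tab: "table_ok V G gm gk ch (Suc i)" and i: "i < n" and V': "V' = V(i := X)"
    and arr: "\<And>l. Suc i \<le> l \<Longrightarrow> l < n \<Longrightarrow> G' l = G l \<and> gm' l = gm l \<and> gk' l = gk l"
      "\<And>l m k. Suc i \<le> l \<Longrightarrow> l < n \<Longrightarrow> m < n \<Longrightarrow> k \<le> W \<Longrightarrow> ch' l m k = ch l m k"
    and new: "best_ok V' G' gm' gk' i" "merge_ok V' G' ch' i"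
  shows "table_ok V' G' gm' gk' ch' i"
proof -
  have "best_ok V' G' gm' gk' l \<and> merge_ok V' G' ch' l" if l: "Suc i \<le> l" "l < n" for l
  proof
    have ok: "best_ok V G gm gk l" "merge_ok V G ch l" using tab l by (auto simp: table_ok_def)
    have V: "V' l = V l" "V' (Suc l) = V (Suc l)" using l by (simp_all add: V')
    have arr_l: "G' l = G l" "gm' l = gm l" "gk' l = gk l" using arr(1)[OF l] by simp_all
    show "best_ok V' G' gm' gk' l" using ok(1) unfolding best_ok_def V arr_l .
    have "ch' l m k = ch l m k" if "m < n" "k \<in> {1..cap l (pp l)}" for m k
      using arr(2)[OF l that(1)] that(2) cap_le[of l "pp l"] by simp
    then show "merge_ok V' G' ch' l" using ok(2) unfolding merge_ok_def V arr_l by simp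
  qed
  moreover have "V' n = V n" using i by (simp add: V')
  moreover have "{i..<n} = insert i {Suc i..<n}" using i by auto
  ultimately show ?thesis using tab new by (simp add: table_ok_def)
qed

lemma wp_pull:
  fixes \<sigma> :: memory and i p m k a b :: nat
  defines "F \<equiv> \<lambda>k. rmem \<sigma> ''f'' (ix p m k)" and "H \<equiv> \<lambda>k. rmem \<sigma> ''f'' (ix i m k)" and "G \<equiv> rmem \<sigma> ''g'' i"
  assumes base: "base \<sigma>" and st: "nmem \<sigma> ''i'' 0 = i" "nmem \<sigma> ''p'' 0 = p" "nmem \<sigma> ''m'' 0 = m" "nmem \<sigma> ''k'' 0 = k"
    and sz: "nmem \<sigma> ''sz'' p = a" "nmem \<sigma> ''sz'' i = b"
    and bd: "i < n" "p < n" "m < n" "1 \<le> k" "k \<le> a + b" "1 \<le> a" "1 \<le> b"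
  shows "wp pull_com \<sigma> (\<lambda>t \<tau>. t \<le> 5 + 5 * min a b \<and>
    pulled F H G a b k k (rmem \<tau> ''x'' 0) (nmem \<tau> ''c'' 0))"
proof -
  define j0 where "j0 = (if a < k then k - a else 1)"
  define N where "N = min (Suc b) k - j0"
  \<comment> \<open>If \<open>k > a\<close>, the window from \<open>k - a\<close> to
    \<open>min b (k - 1)\<close> has at most \<open>a\<close> and at most \<open>b\<close> elements;
    if \<open>k <= a\<close>, it starts at 1 and ends before \<open>a\<close>.\<close>
  have N: "N \<le> min a b" using bd by (auto simp: N_def j0_def)
  have j0: "1 \<le> j0" "j0 \<le> min (Suc b) k" using bd by (auto simp: j0_def)
  let ?loop = "While (And (NLess (nvar ''j'') (NAdd (NCell ''sz'' (nvar ''i'')) (NConst 1))) (NLess (nvar ''j'') (nvar ''k'')))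
       (If (RLess (RAdd (tab (nvar ''p'') (nvar ''m'') (NSub (nvar ''k'') (nvar ''j'')))
              (tab (nvar ''i'') (nvar ''m'') (nvar ''j''))) (rvar ''x''))
          (rset ''x'' (RAdd (tab (nvar ''p'') (nvar ''m'') (NSub (nvar ''k'') (nvar ''j'')))
             (tab (nvar ''i'') (nvar ''m'') (nvar ''j''))) ;;
           nset ''c'' (nvar ''j''))
          Skip ;;
        incr ''j'')"
  have loop: "wp ?loop \<tau> (\<lambda>t \<rho>. t \<le> 1 + 5 * min a b \<and> pulled F H G a b k k (rmem \<rho> ''x'' 0) (nmem \<rho> ''c'' 0))"
    if \<tau>: "pulled F H G a b k j0 (rmem \<tau> ''x'' 0) (nmem \<tau> ''c'' 0)" "nmem \<tau> ''j'' 0 = j0" "base \<tau>"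
      "\<And>d. d \<in> {''i'', ''p'', ''m'', ''k'', ''sz''} \<Longrightarrow> nmem \<tau> d = nmem \<sigma> d" "rmem \<tau> ''f'' = rmem \<sigma> ''f''" for \<tau>
  proof (rule wp_for[where N = N and T = "\<lambda>_. 4" and I = "\<lambda>l \<tau>. nmem \<tau> ''j'' 0 = j0 + l \<and>
        pulled F H G a b k (j0 + l) (rmem \<tau> ''x'' 0) (nmem \<tau> ''c'' 0)"], goal_cases)
    case 1
    show ?case using \<tau> by simp
  next
    case (2 l \<rho>)
    have "nmem \<rho> ''i'' 0 = i" "nmem \<rho> ''k'' 0 = k" "nmem \<rho> ''sz'' i = b"
      using frame_nmem[OF 2(2)] \<tau>(4) st sz by simp_all
    moreover have "l < N \<longleftrightarrow> j0 + l < Suc b \<and> j0 + l < k" using j0 by (auto simp: N_def)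
    ultimately show ?case using 2(1) by simp
  next
    case (3 l \<rho>)
    have base: "base \<rho>" by (rule base_frame[OF \<tau>(3) 3(2)]) simp_all
    have fr: "nmem \<rho> ''i'' 0 = i" "nmem \<rho> ''p'' 0 = p" "nmem \<rho> ''m'' 0 = m" "nmem \<rho> ''k'' 0 = k" "rmem \<rho> ''f'' = rmem \<sigma> ''f''"
      using frame_nmem[OF 3(2)] frame_rmem[OF 3(2)] \<tau>(4,5) st by simp_all
    define l' where "l' = j0 + l"
    have l': "l' \<in> {1..b}" "l' < k" "k - l' \<le> a" using 3(3) j0 by (auto simp: l'_def N_def j0_def split: if_splits)
    have f: "rmem \<sigma> ''f'' (ix p m (k - l')) = F (k - l')" "rmem \<sigma> ''f'' (ix i m l') = H l'"
      by (simp_all add: F_def H_def)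
    have j: "nmem \<rho> ''j'' 0 = l'" and pu: "pulled F H G a b k l' (rmem \<rho> ''x'' 0) (nmem \<rho> ''c'' 0)"
      using 3(1) by (simp_all add: l'_def)
    have Suc: "j0 + Suc l = Suc l'" by (simp add: l'_def)
    show ?case
    proof (cases "F (k - l') + H l' < rmem \<rho> ''x'' 0")
      case True
      from pulled_step_less[OF pu this l'] show ?thesis
        unfolding Suc by (simp add: base fr j f bd True)
    next
      case False
      from pulled_step_geq[OF pu this] show ?thesis
        unfolding Suc by (simp add: base fr j f bd False)
    qed
  next
    case (4 t \<rho>)
    have "j0 + N = min (Suc b) k" using j0 by (simp add: N_def)
    with 4(2) have "pulled F H G a b k (min (Suc b) k) (rmem \<rho> ''x'' 0) (nmem \<rho> ''c'' 0)" by simp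
    \<comment> \<open>There are no splits beyond \<open>b\<close>, so reaching
      \<open>min (Suc b) k\<close> amounts to reaching \<open>k\<close>.\<close>
    then have "pulled F H G a b k k (rmem \<rho> ''x'' 0) (nmem \<rho> ''c'' 0)"
      unfolding pulled_def by auto
    moreover have "t \<le> 1 + 5 * min a b" using 4(1) N by (simp del: min.bounded_iff)
    ultimately show ?case by simp
  qed
  show ?thesis
  proof (cases "a < k")
    case True
    have kj: "k - (k - a) = a" using True by simp
    have init: "pulled F H G a b k j0 (F a + H (k - a)) (k - a)"
      using True bd by (auto simp: pulled_def j0_def)
    let ?\<tau> = "nwrite ''c'' 0 (k - a) (rwrite ''x'' 0 (F a + H (k - a)) (nwrite ''j'' 0 (k - a) \<sigma>))"
    have "wp ?loop ?\<tau> (\<lambda>t \<rho>. t \<le> 1 + 5 * min a b \<and> pulled F H G a b k k (rmem \<rho> ''x'' 0) (nmem \<rho> ''c'' 0))"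
      by (rule loop) (use init True base in \<open>auto simp: j0_def\<close>)
    moreover have "rmem \<sigma> ''f'' (ix p m a) = F a" "rmem \<sigma> ''f'' (ix i m (k - a)) = H (k - a)"
      by (simp_all add: F_def H_def)
    ultimately show ?thesis
      unfolding pull_com_def by (auto simp: st sz True base bd kj elim!: wp_mono)
  next
    case False
    have init: "pulled F H G a b k j0 (F k + G) 0"
      using False bd by (auto simp: pulled_def j0_def)
    let ?\<tau> = "nwrite ''c'' 0 0 (rwrite ''x'' 0 (F k + G) (nwrite ''j'' 0 1 \<sigma>))"
    have "wp ?loop ?\<tau> (\<lambda>t \<rho>. t \<le> 1 + 5 * min a b \<and> pulled F H G a b k k (rmem \<rho> ''x'' 0) (nmem \<rho> ''c'' 0))"
      by (rule loop) (use init False base in \<open>auto simp: j0_def\<close>)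
    moreover have "rmem \<sigma> ''f'' (ix p m k) = F k" "rmem \<sigma> ''g'' i = G"
      by (simp_all add: F_def G_def)
    ultimately show ?thesis
      unfolding pull_com_def by (auto simp: st sz False base bd elim!: wp_mono)
  qed
qed

lemma wp_row:
  fixes \<sigma> :: memory and i p m q a b :: nat
  defines "F \<equiv> \<lambda>k. rmem \<sigma> ''f'' (ix p m k)" and "H \<equiv> \<lambda>k. rmem \<sigma> ''f'' (ix i m k)" and "G \<equiv> rmem \<sigma> ''g'' i"
  assumes base: "base \<sigma>" and st: "nmem \<sigma> ''i'' 0 = i" "nmem \<sigma> ''p'' 0 = p" "nmem \<sigma> ''m'' 0 = m" "nmem \<sigma> ''q'' 0 = q"
    and sz: "nmem \<sigma> ''sz'' p = a" "nmem \<sigma> ''sz'' i = b"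
    and bd: "i < n" "p < n" "m < n" "i \<noteq> p" "q \<le> W" "q \<le> a + b" "1 \<le> a" "1 \<le> b" "a \<le> W" "b \<le> W"
  shows "wp row_com \<sigma> (\<lambda>t \<tau>. t \<le> 2 + q * (9 + 5 * min a b) \<and>
    (\<forall>k\<in>{1..q}. pulled F H G a b k k (rmem \<tau> ''f'' (ix p m k)) (nmem \<tau> ''ch'' (ix i m k))) \<and>
    (\<forall>v m' k'. m' < n \<and> k' \<le> W \<and> (v \<noteq> p \<or> m' \<noteq> m) \<longrightarrow> rmem \<tau> ''f'' (ix v m' k') = rmem \<sigma> ''f'' (ix v m' k')) \<and>
    (\<forall>v m' k'. m' < n \<and> k' \<le> W \<and> (v \<noteq> i \<or> m' \<noteq> m) \<longrightarrow> nmem \<tau> ''ch'' (ix v m' k') = nmem \<sigma> ''ch'' (ix v m' k')))"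
proof -
  show ?thesis
    unfolding row_com_def
  proof (simp, rule wp_for[where N = q and T = "\<lambda>_. 8 + 5 * min a b" and I = "\<lambda>l \<tau>. nmem \<tau> ''k'' 0 = q - l \<and>
      (\<forall>k\<in>{q - l<..q}. pulled F H G a b k k (rmem \<tau> ''f'' (ix p m k)) (nmem \<tau> ''ch'' (ix i m k))) \<and>
      (\<forall>v m' k'. m' < n \<and> k' \<le> W \<and> (v \<noteq> p \<or> m' \<noteq> m \<or> k' \<le> q - l) \<longrightarrow> rmem \<tau> ''f'' (ix v m' k') = rmem \<sigma> ''f'' (ix v m' k')) \<and>
      (\<forall>v m' k'. m' < n \<and> k' \<le> W \<and> (v \<noteq> i \<or> m' \<noteq> m) \<longrightarrow> nmem \<tau> ''ch'' (ix v m' k') = nmem \<sigma> ''ch'' (ix v m' k'))"], goal_cases)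
    case 1
    show ?case using st by simp
  next
    case (2 l \<tau>)
    then show ?case by auto
  next
    case (3 l \<tau>)
    have base\<tau>: "base \<tau>" by (rule base_frame[OF _ 3(2)]) (simp_all add: base pull_com_def)
    have fr: "nmem \<tau> ''i'' 0 = i" "nmem \<tau> ''p'' 0 = p" "nmem \<tau> ''m'' 0 = m" "nmem \<tau> ''sz'' = nmem \<sigma> ''sz''" "rmem \<tau> ''g'' = rmem \<sigma> ''g''"
      using frame_nmem[OF 3(2)] frame_rmem[OF 3(2)] st by (simp_all add: pull_com_def)
    define k where "k = q - l"
    have k: "1 \<le> k" "k \<le> q" "k \<le> W" "q - Suc l = k - 1" using 3(3) bd by (auto simp: k_def)
    have kk: "nmem \<tau> ''k'' 0 = k" using 3(1) by (simp add: k_def)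
    have prev: "\<And>k'. k' \<in> {k<..q} \<Longrightarrow> pulled F H G a b k' k' (rmem \<tau> ''f'' (ix p m k')) (nmem \<tau> ''ch'' (ix i m k'))"
      and f_old: "\<And>v m' k'. m' < n \<Longrightarrow> k' \<le> W \<Longrightarrow> v \<noteq> p \<or> m' \<noteq> m \<or> k' \<le> k \<Longrightarrow> rmem \<tau> ''f'' (ix v m' k') = rmem \<sigma> ''f'' (ix v m' k')"
      and ch_old: "\<And>v m' k'. m' < n \<Longrightarrow> k' \<le> W \<Longrightarrow> v \<noteq> i \<or> m' \<noteq> m \<Longrightarrow> nmem \<tau> ''ch'' (ix v m' k') = nmem \<sigma> ''ch'' (ix v m' k')"
      using 3(1) unfolding k_def by blast+
    have pull: "wp pull_com \<tau> (\<lambda>t \<rho>. t \<le> 5 + 5 * min a b \<and>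
        pulled (\<lambda>k. rmem \<tau> ''f'' (ix p m k)) (\<lambda>k. rmem \<tau> ''f'' (ix i m k)) (rmem \<tau> ''g'' i) a b k k
          (rmem \<rho> ''x'' 0) (nmem \<rho> ''c'' 0))"
      using bd k fr kk sz by (intro wp_pull base\<tau>) simp_all
    have G: "rmem \<tau> ''g'' i = G" by (simp add: fr G_def)
    show ?case
      unfolding wp_Seq
    proof (rule wp_frame[OF pull], goal_cases)
      case (1 t \<rho>)
      have base\<rho>: "base \<rho>" by (rule base_frame[OF base\<tau> 1(2)]) (simp_all add: pull_com_def)
      have fr\<rho>: "nmem \<rho> ''i'' 0 = i" "nmem \<rho> ''p'' 0 = p" "nmem \<rho> ''m'' 0 = m" "nmem \<rho> ''k'' 0 = k"
        "nmem \<rho> ''ch'' = nmem \<tau> ''ch''" "rmem \<rho> ''f'' = rmem \<tau> ''f''"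
        using frame_nmem[OF 1(2)] frame_rmem[OF 1(2)] fr kk by (simp_all add: pull_com_def)
      \<comment> \<open>The search ran on the current table. This agrees with the table before the
        row wherever \<open>pulled\<close> looks: the cells of \<open>p\<close> up to size
        \<open>k\<close> are not yet overwritten, and those of \<open>i\<close> are never written,
        as \<open>i\<close> differs from \<open>p\<close>.\<close>
      have new: "pulled F H G a b k k (rmem \<rho> ''x'' 0) (nmem \<rho> ''c'' 0)"
      proof (rule pulled_cong)
        show "1 \<le> k" by (rule k(1))
        show "pulled (\<lambda>k. rmem \<tau> ''f'' (ix p m k)) (\<lambda>k. rmem \<tau> ''f'' (ix i m k)) G a b k k
          (rmem \<rho> ''x'' 0) (nmem \<rho> ''c'' 0)" using 1(1) G by simp
        show "F k' = rmem \<tau> ''f'' (ix p m k')" if "k' \<le> k" for k'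
          unfolding F_def by (rule f_old[symmetric]) (use that k bd in auto)
        show "H j = rmem \<tau> ''f'' (ix i m j)" if "j \<in> {1..b}" for j
          unfolding H_def by (rule f_old[symmetric]) (use that bd in auto)
      qed
      let ?f = "(rmem \<tau> ''f'')(ix p m k := rmem \<rho> ''x'' 0)"
      let ?ch = "(nmem \<tau> ''ch'')(ix i m k := nmem \<rho> ''c'' 0)"
      have p1: "pulled F H G a b k' k' (?f (ix p m k')) (?ch (ix i m k'))" if "k - 1 < k'" "k' \<le> q" for k'
      proof (cases "k' = k")
        case True
        then show ?thesis using new by simp
      next
        case False
        then have "ix p m k' \<noteq> ix p m k" "ix i m k' \<noteq> ix i m k" "k' \<in> {k<..q}"
          using that bd k by auto
        then show ?thesis using prev[of k'] by simp
      qed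
      have p2: "?f (ix v m' k') = rmem \<sigma> ''f'' (ix v m' k')"
        if "m' < n" "k' \<le> W" "v \<noteq> p \<or> m' \<noteq> m \<or> k' \<le> k - 1" for v m' k'
      proof -
        have "ix v m' k' \<noteq> ix p m k" "v \<noteq> p \<or> m' \<noteq> m \<or> k' \<le> k" using that bd k by auto
        then show ?thesis using f_old[of m' k' v] that(1,2) by simp
      qed
      have p3: "?ch (ix v m' k') = nmem \<sigma> ''ch'' (ix v m' k')"
        if "m' < n" "k' \<le> W" "v \<noteq> i \<or> m' \<noteq> m" for v m' k'
      proof -
        have "ix v m' k' \<noteq> ix i m k" using that bd k by auto
        then show ?thesis using ch_old[of m' k' v] that by auto
      qed
      have t: "t \<le> 5 + 5 * min a b" using 1(1) by simp
      show ?case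
        unfolding k(4)
        using p1 p2 p3 t by (simp add: base\<rho> fr\<rho> bd fun_upd_same fun_upd_other del: fun_upd_apply)
    qed
  next
    case (4 t \<tau>)
    have "Suc t \<le> 2 + q * (9 + 5 * min a b)" using 4(1) by simp
    moreover have "rmem \<tau> ''f'' (ix v m' k') = rmem \<sigma> ''f'' (ix v m' k')"
      if "m' < n" "k' \<le> W" "v \<noteq> p \<or> m' \<noteq> m" for v m' k'
      using 4(2) that by blast
    moreover have "{q - q<..q} = {1..q}" by auto
    ultimately show ?case using 4(2) by simp
  qed
qed

lemma wp_merge:
  fixes \<sigma> :: memory and i a b :: nat
  defines "F \<equiv> \<lambda>m k. rmem \<sigma> ''f'' (ix (pp i) m k)" and "H \<equiv> \<lambda>m k. rmem \<sigma> ''f'' (ix i m k)" and "G \<equiv> rmem \<sigma> ''g'' i"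
  assumes base: "base \<sigma>" and st: "nmem \<sigma> ''i'' 0 = i"
    and sz: "nmem \<sigma> ''sz'' (pp i) = a" "nmem \<sigma> ''sz'' i = b"
    and bd: "0 < i" "i < n" "1 \<le> a" "1 \<le> b" "a \<le> W" "b \<le> W"
  shows "wp merge_com \<sigma> (\<lambda>t \<tau>. t \<le> 40 * (n * (a * b)) \<and> base \<tau> \<and>
    nmem \<tau> ''sz'' = (nmem \<sigma> ''sz'')(pp i := min W (a + b)) \<and>
    (\<forall>m<n. \<forall>k\<in>{1..min W (a + b)}. pulled (F m) (H m) G a b k k (rmem \<tau> ''f'' (ix (pp i) m k)) (nmem \<tau> ''ch'' (ix i m k))) \<and>
    (\<forall>v m k. m < n \<and> k \<le> W \<and> v \<noteq> pp i \<longrightarrow> rmem \<tau> ''f'' (ix v m k) = rmem \<sigma> ''f'' (ix v m k)) \<and>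
    (\<forall>v m k. m < n \<and> k \<le> W \<and> v \<noteq> i \<longrightarrow> nmem \<tau> ''ch'' (ix v m k) = nmem \<sigma> ''ch'' (ix v m k)))"
proof -
  define p q where "p = pp i" and "q = min W (a + b)"
  have p: "p < i" using pp_less bd by (simp add: p_def)
  have q: "q \<le> W" "q \<le> a + b" by (simp_all add: q_def)
  let ?row = "2 + q * (9 + 5 * min a b)"
  let ?loop = "While (NLess (nvar ''m'') (nvar ''n'')) (row_com ;; incr ''m'')"
  have loop: "wp ?loop \<tau> (\<lambda>t \<rho>. t \<le> 1 + n * (?row + 2) \<and> base \<rho> \<and>
      (\<forall>m<n. \<forall>k\<in>{1..q}. pulled (F m) (H m) G a b k k (rmem \<rho> ''f'' (ix p m k)) (nmem \<rho> ''ch'' (ix i m k))) \<and>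
      (\<forall>v m k. m < n \<and> k \<le> W \<and> v \<noteq> p \<longrightarrow> rmem \<rho> ''f'' (ix v m k) = rmem \<sigma> ''f'' (ix v m k)) \<and>
      (\<forall>v m k. m < n \<and> k \<le> W \<and> v \<noteq> i \<longrightarrow> nmem \<rho> ''ch'' (ix v m k) = nmem \<sigma> ''ch'' (ix v m k)))"
    if \<tau>: "base \<tau>" "nmem \<tau> ''i'' 0 = i" "nmem \<tau> ''p'' 0 = p" "nmem \<tau> ''q'' 0 = q" "nmem \<tau> ''m'' 0 = 0"
      "nmem \<tau> ''sz'' = nmem \<sigma> ''sz''" "nmem \<tau> ''ch'' = nmem \<sigma> ''ch''" "rmem \<tau> = rmem \<sigma>" for \<tau>
  proof (rule wp_for[where N = n and T = "\<lambda>_. ?row + 1" and I = "\<lambda>l \<rho>. nmem \<rho> ''m'' 0 = l \<and>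
      (\<forall>m<l. \<forall>k\<in>{1..q}. pulled (F m) (H m) G a b k k (rmem \<rho> ''f'' (ix p m k)) (nmem \<rho> ''ch'' (ix i m k))) \<and>
      (\<forall>v m k. m < n \<and> k \<le> W \<and> (v \<noteq> p \<or> l \<le> m) \<longrightarrow> rmem \<rho> ''f'' (ix v m k) = rmem \<sigma> ''f'' (ix v m k)) \<and>
      (\<forall>v m k. m < n \<and> k \<le> W \<and> v \<noteq> i \<longrightarrow> nmem \<rho> ''ch'' (ix v m k) = nmem \<sigma> ''ch'' (ix v m k))"], goal_cases)
    case 1
    show ?case using \<tau> by simp
  next
    case (2 l \<rho>)
    have "base \<rho>" by (rule base_frame[OF \<tau>(1) 2(2)]) (simp_all add: row_com_def pull_com_def)
    then show ?case using 2(1) by simp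
  next
    case (3 l \<rho>)
    have base\<rho>: "base \<rho>" by (rule base_frame[OF \<tau>(1) 3(2)]) (simp_all add: row_com_def pull_com_def)
    have fr: "nmem \<rho> ''i'' 0 = i" "nmem \<rho> ''p'' 0 = p" "nmem \<rho> ''q'' 0 = q" "nmem \<rho> ''sz'' p = a" "nmem \<rho> ''sz'' i = b"
      "rmem \<rho> ''g'' i = G"
      using frame_nmem[OF 3(2)] frame_rmem[OF 3(2)] \<tau> sz by (simp_all add: row_com_def pull_com_def p_def G_def)
    have m: "nmem \<rho> ''m'' 0 = l" using 3(1) by simp
    have prev: "\<And>m k. m < l \<Longrightarrow> k \<in> {1..q} \<Longrightarrow> pulled (F m) (H m) G a b k k (rmem \<rho> ''f'' (ix p m k)) (nmem \<rho> ''ch'' (ix i m k))"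
      and f_old: "\<And>v m k. m < n \<Longrightarrow> k \<le> W \<Longrightarrow> v \<noteq> p \<or> l \<le> m \<Longrightarrow> rmem \<rho> ''f'' (ix v m k) = rmem \<sigma> ''f'' (ix v m k)"
      and ch_old: "\<And>v m k. m < n \<Longrightarrow> k \<le> W \<Longrightarrow> v \<noteq> i \<Longrightarrow> nmem \<rho> ''ch'' (ix v m k) = nmem \<sigma> ''ch'' (ix v m k)"
      using 3(1) by blast+
    have row: "wp row_com \<rho> (\<lambda>t \<tau>. t \<le> ?row \<and>
      (\<forall>k\<in>{1..q}. pulled (\<lambda>k. rmem \<rho> ''f'' (ix p l k)) (\<lambda>k. rmem \<rho> ''f'' (ix i l k)) (rmem \<rho> ''g'' i) a b k k
         (rmem \<tau> ''f'' (ix p l k)) (nmem \<tau> ''ch'' (ix i l k))) \<and>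
      (\<forall>v m' k'. m' < n \<and> k' \<le> W \<and> (v \<noteq> p \<or> m' \<noteq> l) \<longrightarrow> rmem \<tau> ''f'' (ix v m' k') = rmem \<rho> ''f'' (ix v m' k')) \<and>
      (\<forall>v m' k'. m' < n \<and> k' \<le> W \<and> (v \<noteq> i \<or> m' \<noteq> l) \<longrightarrow> nmem \<tau> ''ch'' (ix v m' k') = nmem \<rho> ''ch'' (ix v m' k')))"
      using fr m bd p q 3(3) by (intro wp_row base\<rho>) simp_all
    have FH: "F l k = rmem \<rho> ''f'' (ix p l k)" "H l k = rmem \<rho> ''f'' (ix i l k)" if "k \<le> W" for k
      using f_old[of l k] that 3(3) by (simp_all add: F_def H_def p_def)
    show ?case
      unfolding wp_Seq
    proof (rule wp_frame[OF row], goal_cases)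
      case (1 t \<omega>)
      have t: "t \<le> ?row"
        and new: "\<And>k. k \<in> {1..q} \<Longrightarrow> pulled (\<lambda>k. rmem \<rho> ''f'' (ix p l k)) (\<lambda>k. rmem \<rho> ''f'' (ix i l k)) G a b k k
         (rmem \<omega> ''f'' (ix p l k)) (nmem \<omega> ''ch'' (ix i l k))"
        and f': "\<And>v m' k'. m' < n \<Longrightarrow> k' \<le> W \<Longrightarrow> v \<noteq> p \<or> m' \<noteq> l \<Longrightarrow> rmem \<omega> ''f'' (ix v m' k') = rmem \<rho> ''f'' (ix v m' k')"
        and ch': "\<And>v m' k'. m' < n \<Longrightarrow> k' \<le> W \<Longrightarrow> v \<noteq> i \<or> m' \<noteq> l \<Longrightarrow> nmem \<omega> ''ch'' (ix v m' k') = nmem \<rho> ''ch'' (ix v m' k')"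
        using 1(1) fr(6) by blast+
      have p1: "pulled (F m) (H m) G a b k k (rmem \<omega> ''f'' (ix p m k)) (nmem \<omega> ''ch'' (ix i m k))"
        if "m < Suc l" "k \<in> {1..q}" for m k
      proof (cases "m = l")
        case True
        show ?thesis unfolding True
          by (rule pulled_cong[OF new[OF that(2)]]) (use that(2) bd FH in auto)
      next
        case False
        with that have "m < l" by simp
        then show ?thesis
          using prev[of m k] that(2) f'[of m k p] ch'[of m k i] 3(3) q by simp
      qed
      have p2: "rmem \<omega> ''f'' (ix v m k) = rmem \<sigma> ''f'' (ix v m k)"
        if "m < n" "k \<le> W" "v \<noteq> p \<or> Suc l \<le> m" for v m k
      proof -
        have "v \<noteq> p \<or> m \<noteq> l" "v \<noteq> p \<or> l \<le> m" using that(3) by auto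
        then show ?thesis using f'[OF that(1,2)] f_old[OF that(1,2)] by simp
      qed
      have p3: "nmem \<omega> ''ch'' (ix v m k) = nmem \<sigma> ''ch'' (ix v m k)" if "m < n" "k \<le> W" "v \<noteq> i" for v m k
        using ch'[of m k v] ch_old[of m k v] that by simp
      have "nmem \<omega> ''m'' 0 = l" using frame_nmem[OF 1(2)] m by (simp add: row_com_def pull_com_def)
      then show ?case using t p1 p2 p3 by simp
    qed
  next
    case (4 t \<rho>)
    have "base \<rho>" by (rule base_frame[OF \<tau>(1) 4(3)]) (simp_all add: row_com_def pull_com_def)
    then show ?case using 4(1,2) by simp
  qed
  have fin: "wp (?loop ;; NAssign ''sz'' (nvar ''p'') (nvar ''q'')) \<tau> (\<lambda>t \<rho>. t \<le> 2 + n * (?row + 2) \<and> base \<rho> \<and>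
      nmem \<rho> ''sz'' = (nmem \<sigma> ''sz'')(p := q) \<and>
      (\<forall>m<n. \<forall>k\<in>{1..q}. pulled (F m) (H m) G a b k k (rmem \<rho> ''f'' (ix p m k)) (nmem \<rho> ''ch'' (ix i m k))) \<and>
      (\<forall>v m k. m < n \<and> k \<le> W \<and> v \<noteq> p \<longrightarrow> rmem \<rho> ''f'' (ix v m k) = rmem \<sigma> ''f'' (ix v m k)) \<and>
      (\<forall>v m k. m < n \<and> k \<le> W \<and> v \<noteq> i \<longrightarrow> nmem \<rho> ''ch'' (ix v m k) = nmem \<sigma> ''ch'' (ix v m k)))"
    if \<tau>: "base \<tau>" "nmem \<tau> ''i'' 0 = i" "nmem \<tau> ''p'' 0 = p" "nmem \<tau> ''q'' 0 = q" "nmem \<tau> ''m'' 0 = 0"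
      "nmem \<tau> ''sz'' = nmem \<sigma> ''sz''" "nmem \<tau> ''ch'' = nmem \<sigma> ''ch''" "rmem \<tau> = rmem \<sigma>" for \<tau>
    unfolding wp_Seq
  proof (rule wp_frame[OF loop[OF \<tau>]], goal_cases)
    case (1 t \<rho>)
    have "nmem \<rho> ''p'' 0 = p" "nmem \<rho> ''q'' 0 = q" "nmem \<rho> ''sz'' = nmem \<sigma> ''sz''"
      using frame_nmem[OF 1(2)] \<tau> by (simp_all add: row_com_def pull_com_def)
    with 1(1) show ?case by simp
  qed
  \<comment> \<open>Since \<open>a\<close> and \<open>b\<close> are at least 1, both are at most
    \<open>a * b\<close>, whence \<open>28 = 9 + 9 + 5 + 5\<close>. The constant part of a row
    raises this to 32, and the 7 remaining steps to 39.\<close>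
  have time: "7 + n * (?row + 2) \<le> 40 * (n * (a * b))"
  proof -
    have "a * 1 \<le> a * b" "b * 1 \<le> b * a" "a * min a b \<le> a * b" "b * min a b \<le> b * a"
      using bd by (intro mult_le_mono; simp)+
    moreover have "(a + b) * (9 + 5 * min a b) = 9 * (a * 1) + 9 * (b * 1) + 5 * (a * min a b) + 5 * (b * min a b)"
      by (simp add: algebra_simps)
    ultimately have "(a + b) * (9 + 5 * min a b) \<le> 28 * (a * b)"
      unfolding mult.commute[of b a] by linarith
    moreover have "q * (9 + 5 * min a b) \<le> (a + b) * (9 + 5 * min a b)" using q by (intro mult_le_mono) auto
    moreover have ab: "1 * 1 \<le> a * b" using bd by (intro mult_le_mono) auto
    ultimately have "?row + 2 \<le> 32 * (a * b)" by linarith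
    then have "n * (?row + 2) \<le> n * (32 * (a * b))" by (rule mult_le_mono2)
    moreover have "1 * 1 \<le> n * (a * b)" using ab n_pos by (intro mult_le_mono) auto
    ultimately show ?thesis by linarith
  qed
  let ?\<tau>0 = "nwrite ''q'' 0 (a + b) (nwrite ''p'' 0 p \<sigma>)"
  let ?\<tau> = "nwrite ''m'' 0 0 (if W < a + b then nwrite ''q'' 0 W ?\<tau>0 else ?\<tau>0)"
  have "q = (if W < a + b then W else a + b)" by (simp add: q_def)
  then have "wp (?loop ;; NAssign ''sz'' (nvar ''p'') (nvar ''q'')) ?\<tau> (\<lambda>t \<rho>. t \<le> 2 + n * (?row + 2) \<and> base \<rho> \<and>
      nmem \<rho> ''sz'' = (nmem \<sigma> ''sz'')(p := q) \<and>
      (\<forall>m<n. \<forall>k\<in>{1..q}. pulled (F m) (H m) G a b k k (rmem \<rho> ''f'' (ix p m k)) (nmem \<rho> ''ch'' (ix i m k))) \<and>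
      (\<forall>v m k. m < n \<and> k \<le> W \<and> v \<noteq> p \<longrightarrow> rmem \<rho> ''f'' (ix v m k) = rmem \<sigma> ''f'' (ix v m k)) \<and>
      (\<forall>v m k. m < n \<and> k \<le> W \<and> v \<noteq> i \<longrightarrow> nmem \<rho> ''ch'' (ix v m k) = nmem \<sigma> ''ch'' (ix v m k)))"
    by (intro fin) (simp_all add: base st)
  then have "wp merge_com \<sigma> (\<lambda>t \<rho>. t \<le> 7 + n * (?row + 2) \<and> base \<rho> \<and>
      nmem \<rho> ''sz'' = (nmem \<sigma> ''sz'')(p := q) \<and>
      (\<forall>m<n. \<forall>k\<in>{1..q}. pulled (F m) (H m) G a b k k (rmem \<rho> ''f'' (ix p m k)) (nmem \<rho> ''ch'' (ix i m k))) \<and>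
      (\<forall>v m k. m < n \<and> k \<le> W \<and> v \<noteq> p \<longrightarrow> rmem \<rho> ''f'' (ix v m k) = rmem \<sigma> ''f'' (ix v m k)) \<and>
      (\<forall>v m k. m < n \<and> k \<le> W \<and> v \<noteq> i \<longrightarrow> nmem \<rho> ''ch'' (ix v m k) = nmem \<sigma> ''ch'' (ix v m k)))"
    using p sz[folded p_def] unfolding merge_com_def
    by (cases "W < a + b") (auto simp add: base st p_def[symmetric] elim!: wp_mono)
  then show ?thesis
    unfolding p_def[symmetric] q_def[symmetric] using time by (elim wp_mono) auto
qed

lemma wp_dp:
  assumes base: "base \<sigma>" and sz: "\<And>v. v < n \<Longrightarrow> nmem \<sigma> ''sz'' v = 1"
    and f: "\<And>v m. v < n \<Longrightarrow> m < n \<Longrightarrow> rmem \<sigma> ''f'' (ix v m 1) = pen m v"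
  shows "wp dp_com \<sigma> (\<lambda>t \<tau>. t \<le> 200 * (n * (n * W)) \<and> base \<tau> \<and>
    (\<exists>V. table_ok V (rmem \<tau> ''g'') (nmem \<tau> ''gm'') (nmem \<tau> ''gk'') (\<lambda>i m k. nmem \<tau> ''ch'' (ix i m k)) 1 \<and>
      best_ok V (rmem \<tau> ''g'') (nmem \<tau> ''gm'') (nmem \<tau> ''gk'') 0))"
proof -
  \<comment> \<open>Only the current stage \<open>l\<close> of \<open>V\<close> has to agree with
    the array \<open>f\<close>. Other stages survive in the proof alone, though the choices kept in
    \<open>ch\<close> still refer to them.\<close>
  define tables where "tables l V \<tau> \<longleftrightarrow>
      table_ok V (rmem \<tau> ''g'') (nmem \<tau> ''gm'') (nmem \<tau> ''gk'') (\<lambda>i m k. nmem \<tau> ''ch'' (ix i m k)) l \<and>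
      (\<forall>v<l. nmem \<tau> ''sz'' v = cap l v) \<and> (\<forall>v<l. \<forall>m<n. \<forall>k\<in>{1..W}. V l v m k = rmem \<tau> ''f'' (ix v m k))" for l V and \<tau> :: memory
  \<comment> \<open>\<open>58 = 17 + 40 + 1\<close>: closing \<open>i\<close>, merging it, and
    decrementing the counter. The cost of closing lacks the factor of the parent's side, which is at
    least 1.\<close>
  define work where "work i = 58 * n * (cap (Suc i) (pp i) * cap (Suc i) i)" for i
  have best: "wp best_com \<tau> (\<lambda>t \<rho>. t \<le> 17 * (n * cap (Suc i) i) \<and> base \<rho> \<and> nmem \<rho> ''i'' 0 = i \<and>
      tables (Suc i) V \<rho> \<and> best_ok V (rmem \<rho> ''g'') (nmem \<rho> ''gm'') (nmem \<rho> ''gk'') i)"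
    if \<tau>: "tables (Suc i) V \<tau>" "base \<tau>" "nmem \<tau> ''i'' 0 = i" "i < n" for \<tau> i V
  proof -
    have V: "V (Suc i) i m k = rmem \<tau> ''f'' (ix i m k)" if "m < n" "k \<in> {1..W}" for m k
      using \<tau>(1) that by (simp add: tables_def)
    have szi: "nmem \<tau> ''sz'' i = cap (Suc i) i" using \<tau>(1) by (simp add: tables_def)
    have c: "1 \<le> cap (Suc i) i" "cap (Suc i) i \<le> W" using cap_pos[of i "Suc i"] cap_le \<tau>(4) by auto
    show ?thesis
    proof (rule wp_frame[OF wp_best[OF \<tau>(2-4) szi c]], goal_cases)
      case (1 t \<rho>)
      then obtain a b x where *: "nmem \<rho> ''gm'' = (nmem \<tau> ''gm'')(i := a)"
        "nmem \<rho> ''gk'' = (nmem \<tau> ''gk'')(i := b)" "rmem \<rho> ''g'' = (rmem \<tau> ''g'')(i := x)"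
        "\<forall>m<n. \<forall>k\<in>{1..cap (Suc i) i}. x \<le> S m + rmem \<tau> ''f'' (ix i m k)" "a < n"
        "b \<in> {1..cap (Suc i) i}" "x = S a + rmem \<tau> ''f'' (ix i a b)" by blast
      have fr: "nmem \<rho> ''i'' = nmem \<tau> ''i''" "nmem \<rho> ''sz'' = nmem \<tau> ''sz''" "nmem \<rho> ''ch'' = nmem \<tau> ''ch''"
        "rmem \<rho> ''f'' = rmem \<tau> ''f''"
        using frame_nmem[OF 1(2)] frame_rmem[OF 1(2)] by (simp_all add: best_com_def)
      have "best_ok V (rmem \<rho> ''g'') (nmem \<rho> ''gm'') (nmem \<rho> ''gk'') i"
        using *(4-7) V c(2) by (auto simp: best_ok_def *(1-3))
      moreover have "table_ok V (rmem \<rho> ''g'') (nmem \<rho> ''gm'') (nmem \<rho> ''gk'') (\<lambda>i m k. nmem \<rho> ''ch'' (ix i m k)) (Suc i)"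
      proof -
        have "best_ok V (rmem \<rho> ''g'') (nmem \<rho> ''gm'') (nmem \<rho> ''gk'') l \<longleftrightarrow>
            best_ok V (rmem \<tau> ''g'') (nmem \<tau> ''gm'') (nmem \<tau> ''gk'') l"
          "merge_ok V (rmem \<rho> ''g'') (\<lambda>i m k. nmem \<rho> ''ch'' (ix i m k)) l \<longleftrightarrow>
            merge_ok V (rmem \<tau> ''g'') (\<lambda>i m k. nmem \<tau> ''ch'' (ix i m k)) l" if "l \<noteq> i" for l
          using that unfolding best_ok_def merge_ok_def *(1-3) fr by simp_all
        then show ?thesis using \<tau>(1) unfolding tables_def table_ok_def by simp
      qed
      ultimately show ?case using 1(1) \<tau> fr by (simp add: tables_def)
    qed
  qed
  have merge: "wp merge_com \<rho> (\<lambda>t \<omega>. t \<le> 40 * (n * (cap (Suc i) (pp i) * cap (Suc i) i)) \<and> base \<omega> \<and>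
      nmem \<omega> ''i'' 0 = i \<and> (\<exists>V. tables i V \<omega>))"
    if \<rho>: "tables (Suc i) V \<rho>" "best_ok V (rmem \<rho> ''g'') (nmem \<rho> ''gm'') (nmem \<rho> ''gk'') i" "base \<rho>"
      "nmem \<rho> ''i'' 0 = i" and i: "0 < i" "i < n" for \<rho> i V
  proof -
    note p = pp_less[OF i]
    let ?a = "cap (Suc i) (pp i)" and ?b = "cap (Suc i) i"
    have V: "V (Suc i) v m k = rmem \<rho> ''f'' (ix v m k)" if "v < Suc i" "m < n" "k \<in> {1..W}" for v m k
      using \<rho>(1) that by (simp add: tables_def)
    have szs: "nmem \<rho> ''sz'' v = cap (Suc i) v" if "v < Suc i" for v using \<rho>(1) that by (simp add: tables_def)
    have bd: "1 \<le> ?a" "1 \<le> ?b" "?a \<le> W" "?b \<le> W"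
      using cap_pos[of "pp i" "Suc i"] cap_pos[of i "Suc i"] cap_le p i by (auto simp: Suc_le_eq)
    have szp: "nmem \<rho> ''sz'' (pp i) = ?a" "nmem \<rho> ''sz'' i = ?b" using szs p by simp_all
    show ?thesis
    proof (rule wp_frame[OF wp_merge[OF \<rho>(3,4) szp i bd]], goal_cases)
      case (1 t \<omega>)
      have fr: "nmem \<omega> ''i'' 0 = i" "nmem \<omega> ''gm'' = nmem \<rho> ''gm''" "nmem \<omega> ''gk'' = nmem \<rho> ''gk''"
        "rmem \<omega> ''g'' = rmem \<rho> ''g''"
        using frame_nmem[OF 1(2)] frame_rmem[OF 1(2)] \<rho>(4) by (simp_all add: merge_com_def row_com_def pull_com_def)
      have new: "\<And>m k. m < n \<Longrightarrow> k \<in> {1..cap i (pp i)} \<Longrightarrow>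
          pulled (\<lambda>k. rmem \<rho> ''f'' (ix (pp i) m k)) (\<lambda>k. rmem \<rho> ''f'' (ix i m k)) (rmem \<rho> ''g'' i) ?a ?b k k
            (rmem \<omega> ''f'' (ix (pp i) m k)) (nmem \<omega> ''ch'' (ix i m k))"
        and f': "\<And>v m k. m < n \<Longrightarrow> k \<le> W \<Longrightarrow> v \<noteq> pp i \<Longrightarrow> rmem \<omega> ''f'' (ix v m k) = rmem \<rho> ''f'' (ix v m k)"
        and ch': "\<And>v m k. m < n \<Longrightarrow> k \<le> W \<Longrightarrow> v \<noteq> i \<Longrightarrow> nmem \<omega> ''ch'' (ix v m k) = nmem \<rho> ''ch'' (ix v m k)"
        and sz': "nmem \<omega> ''sz'' = (nmem \<rho> ''sz'')(pp i := cap i (pp i))"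
        and t: "t \<le> 40 * (n * (?a * ?b))" and base\<omega>: "base \<omega>"
        using 1(1) unfolding cap_merge[OF i] by blast+
      \<comment> \<open>The new stage is whatever the array \<open>f\<close> holds after the
        merge.\<close>
      define V' where "V' = V(i := \<lambda>v m k. rmem \<omega> ''f'' (ix v m k))"
      have V': "V' i v m k = rmem \<omega> ''f'' (ix v m k)" "V' (Suc i) = V (Suc i)" for v m k
        by (simp_all add: V'_def)
      have "best_ok V' (rmem \<omega> ''g'') (nmem \<omega> ''gm'') (nmem \<omega> ''gk'') i"
        using \<rho>(2) unfolding best_ok_def V' fr .
      moreover have "merge_ok V' (rmem \<omega> ''g'') (\<lambda>i m k. nmem \<omega> ''ch'' (ix i m k)) i"
      proof (rule merge_okI[OF i], goal_cases)
        case (1 v m k)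
        then show ?case using V[of v m k] f'[of m k v] by (simp add: V')
      next
        case (2 m k)
        show ?case unfolding V' fr
          by (rule pulled_cong[OF new[OF 2]]) (use 2 V bd p in auto)
      qed
      moreover have "table_ok V (rmem \<rho> ''g'') (nmem \<rho> ''gm'') (nmem \<rho> ''gk'') (\<lambda>i m k. nmem \<rho> ''ch'' (ix i m k)) (Suc i)"
        using \<rho>(1) by (simp add: tables_def)
      ultimately have "table_ok V' (rmem \<omega> ''g'') (nmem \<omega> ''gm'') (nmem \<omega> ''gk'') (\<lambda>i m k. nmem \<omega> ''ch'' (ix i m k)) i"
        using i(2) fr ch' by (intro table_ok_extend[OF _ _ V'_def]) auto
      moreover have "nmem \<omega> ''sz'' v = cap i v" if "v < i" for v
        using szs[of v] cap_other[OF i that] that by (auto simp: sz')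
      ultimately have "tables i V' \<omega>" by (simp add: tables_def V')
      then show ?case using t base\<omega> fr by blast
    qed
  qed
  have body: "wp (best_com ;; merge_com ;; nset ''i'' (NSub (nvar ''i'') (NConst 1))) \<tau>
      (\<lambda>t \<rho>. t \<le> work i \<and> nmem \<rho> ''i'' 0 = i - 1 \<and> base \<rho> \<and> (\<exists>V. tables i V \<rho>))"
    if "tables (Suc i) V \<tau>" "base \<tau>" "nmem \<tau> ''i'' 0 = i" "0 < i" "i < n" for \<tau> i V
  proof -
    let ?a = "cap (Suc i) (pp i)" and ?b = "cap (Suc i) i"
    have "pp i < i" using pp_less that by simp
    then have "1 \<le> ?a" "1 \<le> ?b"
      using cap_pos[of "pp i" "Suc i"] cap_pos[of i "Suc i"] that by simp_all
    then have "n * (1 * ?b) \<le> n * (?a * ?b)" "1 * (1 * 1) \<le> n * (?a * ?b)"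
      using n_pos by (intro mult_le_mono; simp)+
    moreover have "work i = 58 * (n * (?a * ?b))" by (simp add: work_def)
    ultimately have time: "17 * (n * ?b) + (40 * (n * (?a * ?b)) + 1) \<le> work i"
      by linarith
    show ?thesis
      unfolding wp_Seq
    proof (rule wp_mono[OF best[OF that(1-3,5)]], goal_cases)
      case (1 t \<rho>)
      then have \<rho>: "tables (Suc i) V \<rho>" "best_ok V (rmem \<rho> ''g'') (nmem \<rho> ''gm'') (nmem \<rho> ''gk'') i"
        "base \<rho>" "nmem \<rho> ''i'' 0 = i" and t: "t \<le> 17 * (n * ?b)" by blast+
      show ?case
      proof (rule wp_mono[OF merge[OF \<rho> that(4,5)]], goal_cases)
        case (1 u \<omega>)
        then show ?case using t time by (auto simp: tables_def)
      qed
    qed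
  qed
  show ?thesis
    unfolding dp_com_def
  proof (simp add: base, rule wp_for[where N = "n - 1" and T = "\<lambda>j. work (n - 1 - j)" and
        I = "\<lambda>j \<tau>. nmem \<tau> ''i'' 0 = n - 1 - j \<and> base \<tau> \<and> (\<exists>V. tables (n - j) V \<tau>)"], goal_cases)
    case 1
    have "tables n (\<lambda>_ v m k. rmem \<sigma> ''f'' (ix v m k)) (nwrite ''i'' 0 (n - Suc 0) \<sigma>)"
      using sz f by (auto simp: tables_def table_ok_def cap_n)
    then show ?case using base by auto
  next
    case (2 j \<tau>)
    then show ?case by auto
  next
    case (3 j \<tau>)
    then obtain V where V: "tables (n - j) V \<tau>" by blast
    have eq: "n - j = Suc (n - 1 - j)" "n - Suc j = n - 1 - j" "0 < n - 1 - j" "n - 1 - j < n" using 3(3) by auto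
    have "base \<tau>" "nmem \<tau> ''i'' 0 = n - 1 - j" using 3(1) by simp_all
    from body[OF V[unfolded eq(1)] this eq(3,4)] show ?case
      unfolding eq(2) One_nat_def by (rule wp_mono) auto
  next
    case (4 t \<tau>)
    then obtain V where V: "tables (Suc 0) V \<tau>" and \<tau>: "base \<tau>" "nmem \<tau> ''i'' 0 = 0"
      using n_pos by auto
    \<comment> \<open>The loop runs from \<open>n - 1\<close> down to 1, so the sum is reversed
      before the amortised bound applies.\<close>
    have "(\<Sum>j<n - 1. work (n - 1 - j)) = (\<Sum>j<n - 1. work (Suc (n - 1 - Suc j)))"
      by (intro sum.cong) (auto simp: Suc_diff_Suc)
    also have "\<dots> = (\<Sum>j<n - 1. work (Suc j))" by (rule sum.nat_diff_reindex)
    also have "\<dots> = (\<Sum>i=1..<n. work i)"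
      using sum.shift_bounds_Suc_ivl[of work 0 "n - 1"] n_pos by (simp add: lessThan_atLeast0)
    also have "\<dots> = 58 * n * (\<Sum>i=1..<n. cap (Suc i) (pp i) * cap (Suc i) i)"
      by (simp add: work_def sum_distrib_left)
    also have "\<dots> \<le> 58 * n * (2 * n * W)" by (intro mult_le_mono2 sum_cap_products)
    finally have sum: "(\<Sum>j<n - 1. work (n - 1 - j)) \<le> 116 * (n * (n * W))" by simp
    have "(\<Sum>j<l. f j + 1) = (\<Sum>j<l. f j) + l" for f and l :: nat by (induction l) auto
    from 4(1)[unfolded this] sum have "t \<le> 116 * (n * (n * W)) + (n - 1) + 1" by linarith
    moreover have "n * (1 * 1) \<le> n * (n * W)" "1 * (n * cap 1 0) \<le> n * (n * W)"
      using n_pos W_pos cap_le[of 1 0] by (intro mult_le_mono; simp)+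
    ultimately have time: "Suc (t + 17 * (n * cap 1 0)) \<le> 200 * (n * (n * W))"
      using n_pos by linarith
    show ?case
    proof (rule wp_mono[OF best[OF V \<tau> n_pos]], goal_cases)
      case (1 u \<rho>)
      then show ?case using time by (auto simp: tables_def)
    qed
  qed
qed

end

section \<open>Backtracking on the machine\<close>

context dp
begin

lemma wp_backtrack:
  fixes \<sigma> :: memory
  defines "ord \<equiv> nmem \<sigma> ''ord''" and "ch \<equiv> \<lambda>i m k. nmem \<sigma> ''ch'' (ix i m k)"
  assumes base: "base \<sigma>" and inj: "inj_on ord {..<n}"
    and tab: "table_ok V (rmem \<sigma> ''g'') (nmem \<sigma> ''gm'') (nmem \<sigma> ''gk'') ch 1"
    and best: "best_ok V (rmem \<sigma> ''g'') (nmem \<sigma> ''gm'') (nmem \<sigma> ''gk'') 0"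
  shows "wp backtrack_com \<sigma> (\<lambda>t \<tau>. t \<le> 9 * n \<and> (\<exists>lab mm kk. backtrack_ok V (rmem \<sigma> ''g'') n lab mm kk \<and>
    (\<forall>v<n. nmem \<tau> ''comp'' (ord v) = lab v)))"
  unfolding backtrack_com_def
proof (simp, rule wp_for[where N = "n - 1" and T = "\<lambda>_. 8" and
    I = "\<lambda>j \<tau>. nmem \<tau> ''i'' 0 = Suc j \<and> base \<tau> \<and> (\<exists>lab. (\<forall>v\<le>j. nmem \<tau> ''comp'' (ord v) = lab v) \<and>
      backtrack_ok V (rmem \<sigma> ''g'') (Suc j) lab (nmem \<tau> ''mm'') (nmem \<tau> ''kk''))"], goal_cases)
  case 1
  have "backtrack_ok V (rmem \<sigma> ''g'') (Suc 0) (\<lambda>_. 0) ((nmem \<sigma> ''mm'')(0 := nmem \<sigma> ''gm'' 0))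
      ((nmem \<sigma> ''kk'')(0 := nmem \<sigma> ''gk'' 0))"
    using backtrack_init[OF best] by simp
  then show ?case using base by (auto simp: ord_def)
next
  case (2 j \<tau>)
  then show ?case by auto
next
  case (3 j \<tau>)
  define i where "i = Suc j"
  have i: "0 < i" "i < n" using 3(3) by (auto simp: i_def)
  note p = pp_less[OF i]
  from 3(1) obtain lab where lab: "\<And>v. v < i \<Longrightarrow> nmem \<tau> ''comp'' (ord v) = lab v"
    and bt: "backtrack_ok V (rmem \<sigma> ''g'') i lab (nmem \<tau> ''mm'') (nmem \<tau> ''kk'')"
    and base\<tau>: "base \<tau>" and ii: "nmem \<tau> ''i'' 0 = i"
    by (auto simp: i_def less_Suc_eq_le)
  have fr: "nmem \<tau> ''ord'' = ord" "nmem \<tau> ''gm'' = nmem \<sigma> ''gm''" "nmem \<tau> ''gk'' = nmem \<sigma> ''gk''" "nmem \<tau> ''ch'' = nmem \<sigma> ''ch''"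
    using frame_nmem[OF 3(2)] by (simp_all add: ord_def)
  have mp: "nmem \<tau> ''mm'' (pp i) < n" using bt p by (simp add: backtrack_ok_def)
  \<comment> \<open>\<open>comp\<close> is indexed by nodes but \<open>lab\<close> by numbers;
    injectivity of \<open>ord\<close> keeps the earlier labels intact when the cell
    \<open>ord i\<close> is written.\<close>
  have ne: "ord v \<noteq> ord i" if "v < i" for v
    using inj_onD[OF inj, of v i] that i by auto
  let ?c = "ch i (nmem \<tau> ''mm'' (pp i)) (nmem \<tau> ''kk'' (pp i))"
  have c: "nmem \<sigma> ''ch'' (ix i (nmem \<tau> ''mm'' (pp i)) (nmem \<tau> ''kk'' (pp i))) = ?c"
    by (simp add: ch_def)
  have lt: "v < Suc i \<longleftrightarrow> v = i \<or> v < i" for v by auto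
  show ?case
  proof (cases "?c = 0")
    case True
    have "backtrack_ok V (rmem \<sigma> ''g'') (Suc i) (lab(i := i)) ((nmem \<tau> ''mm'')(i := nmem \<sigma> ''gm'' i))
        ((nmem \<tau> ''kk'')(i := nmem \<sigma> ''gk'' i))"
      by (rule backtrack_cut[OF i tab bt True])
    then have "\<exists>lab'. (\<forall>v\<le>i. ((nmem \<tau> ''comp'')(ord i := i)) (ord v) = lab' v) \<and>
        backtrack_ok V (rmem \<sigma> ''g'') (Suc i) lab' ((nmem \<tau> ''mm'')(i := nmem \<sigma> ''gm'' i))
        ((nmem \<tau> ''kk'')(i := nmem \<sigma> ''gk'' i))"
      by (intro exI[of _ "lab(i := i)"]) (auto simp: less_Suc_eq_le[symmetric] lt lab ne)
    then show ?thesis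
      by (simp add: base\<tau> ii fr i mp c True i_def[symmetric] fun_upd_same fun_upd_other del: fun_upd_apply)
  next
    case False
    have "backtrack_ok V (rmem \<sigma> ''g'') (Suc i) (lab(i := lab (pp i))) ((nmem \<tau> ''mm'')(i := nmem \<tau> ''mm'' (pp i)))
        ((nmem \<tau> ''kk'')(i := ?c, pp i := nmem \<tau> ''kk'' (pp i) - ?c))"
      by (rule backtrack_join[OF i tab bt refl False])
    then have "\<exists>lab'. (\<forall>v\<le>i. ((nmem \<tau> ''comp'')(ord i := nmem \<tau> ''comp'' (ord (pp i)))) (ord v) = lab' v) \<and>
        backtrack_ok V (rmem \<sigma> ''g'') (Suc i) lab' ((nmem \<tau> ''mm'')(i := nmem \<tau> ''mm'' (pp i)))
        ((nmem \<tau> ''kk'')(i := ?c, pp i := nmem \<tau> ''kk'' (pp i) - ?c))"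
      by (intro exI[of _ "lab(i := lab (pp i))"]) (auto simp: less_Suc_eq_le[symmetric] lt lab ne p)
    moreover have "pp i \<noteq> i" using p by simp
    ultimately show ?thesis using False
      by (simp add: base\<tau> ii fr i mp c i_def[symmetric] fun_upd_same fun_upd_other del: fun_upd_apply)
  qed
next
  case (4 t \<tau>)
  have "{v. v < n} = {v. v \<le> n - 1}" using n_pos by auto
  then have lt: "v \<le> n - 1 \<longleftrightarrow> v < n" for v by auto
  have "Suc (Suc (Suc (Suc t))) \<le> 9 * n" using 4(1) n_pos by (cases n) auto
  moreover have "Suc (n - 1) = n" using n_pos by simp
  ultimately show ?case using 4(2) unfolding lt by auto
qed

end

section \<open>The complete program and its optimality\<close>

definition tree_partition_com :: com where
  "tree_partition_com =
     If (RLess (rvar ''w0'') (RConst 1)) Skip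
       (nset ''feasible'' (NConst 1) ;; capacity_com ;; order_com ;;
        multiples_com ''RM'' (NAdd (nvar ''W'') (NConst 1)) ;;
        multiples_com ''RV'' (NCell ''RM'' (nvar ''n'')) ;;
        init_com ;; dp_com ;; backtrack_com)"

text \<open>A tree has a node, and any component weighs at least 1. The program may then halt at
  once, because the flag \<open>feasible\<close> is 0 in the input memory.\<close>

lemma infeasible:
  assumes "instance_ok n E w s" "\<forall>i\<in>{1..n}. w i = 1" "w0 < 1"
  shows "\<not> feasible n E w w0 P"
proof
  assume P: "feasible n E w w0 P"
  then have part: "partition_on {1..n} P" by (simp add: feasible_def)
  have "{1..n} \<noteq> {}" using assms(1) by (auto simp: instance_ok_def is_tree_def connected_in_def)
  then obtain K where K: "K \<in> P" using partition_onD1[OF part] by blast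
  then have sub: "K \<subseteq> {1..n}" and ne: "K \<noteq> {}"
    using partition_onD1[OF part] partition_onD3[OF part] by auto
  have "(\<Sum>i\<in>K. w i) = real (card K)" using sub assms(2) by (simp add: subset_iff)
  moreover have "card K \<noteq> 0" using ne finite_subset[OF sub] by simp
  moreover have "(\<Sum>i\<in>K. w i) \<le> w0" using P K by (simp add: feasible_def)
  ultimately show False using assms(3) by linarith
qed

text \<open>\<open>G 0\<close> separates the two sides: the output costs at most \<open>G 0\<close>
  by backtracking, and every feasible partition costs at least \<open>G 0\<close> by the lower
  bound.\<close>

lemma (in dp) optimal_output:
  fixes s w :: "nat \<Rightarrow> real"
  assumes tree: "is_tree {1..n} E" and ro: "rooted_order n E ord pp" and S: "\<And>i. i < n \<Longrightarrow> S i = s (ord i)"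
    and W: "real W \<le> w0" "W = n \<or> w0 < real W + 1" and w: "\<forall>i\<in>{1..n}. w i = 1"
    and tab: "table_ok V G gm gk ch 1" and best: "best_ok V G gm gk 0" and bt: "backtrack_ok V G n lab mm kk"
    and lab: "\<And>v. v < n \<Longrightarrow> nmem \<tau> ''comp'' (ord v) = lab v"
  shows "optimal_partition n E w s w0 (output_partition n \<tau>)"
proof -
  note fin = backtrack_final[OF tab bt]
  note out = labels_feasible[OF ro S lab fin(3,2) W(1) w output_partition_def]
  have "partition_cost s (output_partition n \<tau>) \<le> partition_cost s P" if P: "feasible n E w w0 P" for P
  proof -
    obtain lab' :: "nat \<Rightarrow> nat set" where "labelling lab'" "lab_cost lab' = partition_cost s P"
      using feasible_labelling[OF tree ro S W(2) w P] .
    then have "G 0 \<le> partition_cost s P" using lower_bound[OF tab best] by metis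
    moreover have "partition_cost s (output_partition n \<tau>) \<le> G 0" using fin(1) out(2) by simp
    ultimately show ?thesis by simp
  qed
  with out(1) show ?thesis
    unfolding optimal_partition_def is_arg_min_def by (auto simp: not_less)
qed

lemma wp_tree_partition:
  assumes inst: "instance_ok n E w s" and es: "lists_edges es E" and w: "\<forall>i\<in>{1..n}. w i = 1" and w0: "1 \<le> w0"
  shows "wp tree_partition_com (input_memory n es w s w0)
    (\<lambda>t \<tau>. real t \<le> 300 * (w0 * real n ^ 2) \<and> nmem \<tau> ''feasible'' 0 = 1 \<and>
      optimal_partition n E w s w0 (output_partition n \<tau>))"
proof -
  have tree: "is_tree {1..n} E" and s: "\<And>i. i \<in> {1..n} \<Longrightarrow> 0 \<le> s i" using inst by (auto simp: instance_ok_def)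
  have n: "0 < n" using tree by (auto simp: is_tree_def connected_in_def)
  have conn: "connected_in E {1..n}" using tree by (simp add: is_tree_def)
  define u v where "u k = fst (es ! k)" and "v k = snd (es ! k)" for k
  let ?M = "length es"
  have E: "E = (\<lambda>k. {u k, v k}) ` {..<?M}"
  proof -
    have "E = (\<lambda>(x, y). {x, y}) ` set es" using es by (simp add: lists_edges_def)
    also have "set es = (\<lambda>k. es ! k) ` {..<?M}" by (auto simp: set_conv_nth)
    finally show ?thesis by (simp add: image_image u_def v_def case_prod_beta)
  qed
  have cardE: "card E = ?M"
    using es distinct_card[of "map (\<lambda>(x, y). {x, y}) es"] by (simp add: lists_edges_def)
  have sub: "{u k, v k} \<subseteq> {1..n}" if "k < ?M" for k
    using tree E that by (auto simp: is_tree_def)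
  define \<sigma> where "\<sigma> = nwrite ''feasible'' 0 1 (input_memory n es w s w0)"
  have mem: "nmem \<sigma> ''n'' 0 = n" "rmem \<sigma> ''w0'' 0 = w0" "nmem \<sigma> ''feasible'' 0 = 1"
    "\<And>x. nmem \<sigma> ''mk'' x = 0" "nmem \<sigma> ''RM'' 0 = 0" "nmem \<sigma> ''RV'' 0 = 0"
    "\<And>k. k < ?M \<Longrightarrow> nmem \<sigma> ''u'' k = u k" "\<And>k. k < ?M \<Longrightarrow> nmem \<sigma> ''v'' k = v k"
    "\<And>i. i \<in> {1..n} \<Longrightarrow> rmem \<sigma> ''s'' i = s i"
    by (simp_all add: \<sigma>_def input_memory_def u_def v_def)
  have "wp (capacity_com ;; order_com ;; multiples_com ''RM'' (NAdd (nvar ''W'') (NConst 1)) ;;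
      multiples_com ''RV'' (NCell ''RM'' (nvar ''n'')) ;; init_com ;; dp_com ;; backtrack_com) \<sigma>
    (\<lambda>t \<tau>. real t + 2 \<le> 300 * (w0 * real n ^ 2) \<and> nmem \<tau> ''feasible'' 0 = 1 \<and>
      optimal_partition n E w s w0 (output_partition n \<tau>))"
    unfolding wp_Seq
  proof (rule wp_frame[OF wp_capacity[OF mem(1) n mem(2) w0]], goal_cases)
    case (1 t1 \<sigma>1)
    then obtain W where W: "nmem \<sigma>1 ''W'' 0 = W" "0 < W" "W \<le> n" "real W \<le> w0" "W = n \<or> w0 < real W + 1"
      and t1: "t1 \<le> 3 * n" by blast
    have mem1: "nmem \<sigma>1 a = nmem \<sigma> a" if "a \<in> {''n'', ''feasible'', ''mk'', ''RM'', ''RV'', ''u'', ''v''}" for a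
      by (rule frame_nmem[OF 1(2)]) (use that in \<open>auto simp: capacity_com_def\<close>)
    have s1: "rmem \<sigma>1 ''s'' = rmem \<sigma> ''s''" using frame_rmem[OF 1(2)] by (simp add: capacity_com_def)
    show ?case
    proof (rule wp_frame[OF wp_order[where n = n and u = u and v = v and M = ?M and E = E]], goal_cases)
      case (7 t2 \<sigma>2)
      then have t2: "t2 \<le> n * (2 * ?M + 13)" by blast
      define ord pp where "ord = nmem \<sigma>2 ''ord''" and "pp = nmem \<sigma>2 ''pp''"
      have ro: "rooted_order n E ord pp" using 7(1) by (simp add: ord_def pp_def)
      have bij: "bij_betw ord {..<n} {1..n}" using ro by (simp add: rooted_order_def)
      have ordn: "ord i \<in> {1..n}" if "i < n" for i using bij that by (auto simp: bij_betw_def)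
      have M: "?M < n" using rooted_order_card_edges[OF tree ro] cardE by simp
      define S where "S i = s (ord i)" for i
      \<comment> \<open>\<open>W\<close> and \<open>pp\<close> are known only after the first two
        programs have run, so the locale is interpreted in the middle of the execution.\<close>
      interpret dp n W pp S
        by unfold_locales (use n W(2) rooted_order_parent(1)[OF ro] s ordn in \<open>auto simp: S_def\<close>)
      have mem2: "nmem \<sigma>2 a = nmem \<sigma>1 a" if "a \<in> {''n'', ''feasible'', ''W'', ''RM'', ''RV''}" for a
        by (rule frame_nmem[OF 7(2)]) (use that in \<open>auto simp: order_com_def\<close>)
      have s2: "rmem \<sigma>2 ''s'' = rmem \<sigma> ''s''" using frame_rmem[OF 7(2)] s1 by (simp add: order_com_def)
      show ?case
      proof (rule wp_frame[OF wp_multiples[where n = n and L = "Suc W"]], goal_cases)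
        case (6 t3 \<sigma>3)
        have fr3: "nmem \<sigma>3 a = nmem \<sigma>2 a" if "a \<notin> {''RM'', ''j''}" for a
          by (rule frame_nmem[OF 6(2)]) (use that in \<open>auto simp: multiples_com_def\<close>)
        have s3: "rmem \<sigma>3 ''s'' = rmem \<sigma> ''s''" using frame_rmem[OF 6(2)] s2 by (simp add: multiples_com_def)
        have RM: "nmem \<sigma>3 ''RM'' k = k * Suc W" if "k \<le> n" for k using 6(1) that by blast
        show ?case
        proof (rule wp_frame[OF wp_multiples[where n = n and L = "n * Suc W"]], goal_cases)
          case (6 t4 \<sigma>4)
          have fr4: "nmem \<sigma>4 a = nmem \<sigma>3 a" if "a \<notin> {''RV'', ''j''}" for a
            by (rule frame_nmem[OF 6(2)]) (use that in \<open>auto simp: multiples_com_def\<close>)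
          have s4: "rmem \<sigma>4 ''s'' = rmem \<sigma> ''s''" using frame_rmem[OF 6(2)] s3 by (simp add: multiples_com_def)
          have RV: "nmem \<sigma>4 ''RV'' k = k * (n * Suc W)" if "k \<le> n" for k using 6(1) that by blast
          have "base \<sigma>4"
            unfolding base_def using RM RV mem(9) ordn
            by (simp add: fr4 fr3 mem2 mem1 mem(1) W(1) s4 pp_def[symmetric] ord_def[symmetric] S_def)
          then show ?case
          proof (rule wp_frame[OF wp_init], goal_cases)
            case (1 t5 \<sigma>5)
            then have b5: "base \<sigma>5" and i5: "\<And>v. v < n \<Longrightarrow> nmem \<sigma>5 ''sz'' v = 1"
              "\<And>v m. v < n \<Longrightarrow> m < n \<Longrightarrow> rmem \<sigma>5 ''f'' (ix v m 1) = pen m v" and t5: "t5 \<le> 12 * (n * n)" by blast+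
            have fr5: "nmem \<sigma>5 a = nmem \<sigma>4 a" if "a \<in> {''ord'', ''feasible''}" for a
              by (rule frame_nmem[OF 1(2)]) (use that in \<open>auto simp: init_com_def\<close>)
            show ?case
            proof (rule wp_frame[OF wp_dp[OF b5]], goal_cases)
              case (3 t6 \<sigma>6)
              then obtain V where V: "table_ok V (rmem \<sigma>6 ''g'') (nmem \<sigma>6 ''gm'') (nmem \<sigma>6 ''gk'')
                  (\<lambda>i m k. nmem \<sigma>6 ''ch'' (ix i m k)) 1"
                "best_ok V (rmem \<sigma>6 ''g'') (nmem \<sigma>6 ''gm'') (nmem \<sigma>6 ''gk'') 0"
                and b6: "base \<sigma>6" and t6: "t6 \<le> 200 * (n * (n * W))" by blast
              have fr6: "nmem \<sigma>6 a = nmem \<sigma>5 a" if "a \<in> {''ord'', ''feasible''}" for a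
                by (rule frame_nmem[OF 3(2)])
                  (use that in \<open>auto simp: dp_com_def best_com_def merge_com_def row_com_def pull_com_def\<close>)
              have ord6: "nmem \<sigma>6 ''ord'' = ord" and feas6: "nmem \<sigma>6 ''feasible'' 0 = 1"
                using mem(3) by (simp_all add: fr6 fr5 fr4 fr3 mem2 mem1 ord_def)
              have inj6: "inj_on (nmem \<sigma>6 ''ord'') {..<n}" using bij by (simp add: ord6 bij_betw_def)
              show ?case
              proof (rule wp_frame[OF wp_backtrack[OF b6 inj6 V]], goal_cases)
                case (1 t7 \<tau>)
                then obtain lab mm kk where bt: "backtrack_ok V (rmem \<sigma>6 ''g'') n lab mm kk"
                  and lab: "\<And>v. v < n \<Longrightarrow> nmem \<tau> ''comp'' (ord v) = lab v" and t7: "t7 \<le> 9 * n"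
                  unfolding ord6 by blast
                have "optimal_partition n E w s w0 (output_partition n \<tau>)"
                  by (rule optimal_output[OF tree ro S_def W(4,5) w V bt lab])
                moreover have "nmem \<tau> ''feasible'' 0 = 1"
                  using frame_nmem[OF 1(2), of "''feasible''"] feas6 by (simp add: backtrack_com_def)
                moreover have "real (t1 + (t2 + (t3 + (t4 + (t5 + (t6 + t7)))))) + 2 \<le> 300 * (w0 * real n ^ 2)"
                proof -
                  have "t3 \<le> 3 * n + 2" "t4 \<le> 3 * n + 2"
                    using \<open>t3 \<le> _ \<and> _\<close> \<open>t4 \<le> _ \<and> _\<close> by auto
                  moreover have "n * (2 * ?M + 13) \<le> n * (15 * n)" using M by (intro mult_le_mono2) simp
                  moreover have "n * (1 * 1) \<le> n * (n * W)" "1 * (1 * 1) \<le> n * (n * W)" "n * (n * 1) \<le> n * (n * W)"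
                    using n W(2) by (intro mult_le_mono; simp)+
                  \<comment> \<open>The constants of the seven programs and of the two steps before
                    them add up to at most 251.\<close>
                  ultimately have "t1 + (t2 + (t3 + (t4 + (t5 + (t6 + t7))))) + 2 \<le> 300 * (n * (n * W))"
                    using t1 t2 t5 t6 t7 by linarith
                  then have "real (t1 + (t2 + (t3 + (t4 + (t5 + (t6 + t7))))) + 2) \<le> real (300 * (n * (n * W)))"
                    by (rule of_nat_mono)
                  also have "\<dots> = 300 * (real W * real n ^ 2)" by (simp add: power2_eq_square)
                  also have "\<dots> \<le> 300 * (w0 * real n ^ 2)"
                    using W(4) by (intro mult_left_mono mult_right_mono) auto
                  finally show ?thesis by simp
                qed
                ultimately show ?case by blast
              qed
            qed (use i5 in auto)
          qed
        qed (use mem mem1 mem2 fr3 RM[of n] in \<open>auto simp: mem1 mem2 fr3\<close>)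
      qed (use mem mem1 mem2 W in \<open>auto simp: mem1 mem2\<close>)
    qed (use mem mem1 n conn E sub in \<open>auto simp: mem1\<close>)
  qed
  then show ?thesis
    unfolding tree_partition_com_def using w0
    by (auto simp: \<sigma>_def input_memory_def elim!: wp_mono)
qed

theorem theorem5:
  shows "\<exists>(prog :: com) (C :: real). \<forall>(n :: nat) (E :: nat set set) (es :: (nat \<times> nat) list)
      (w :: nat \<Rightarrow> real) (s :: nat \<Rightarrow> real) (w0 :: real).
    instance_ok n E w s \<and> lists_edges es E \<and> (\<forall>i\<in>{1..n}. w i = 1) \<longrightarrow>
    solves_within prog (C * (max 1 w0 * real n ^ 2)) n E es w s w0"
proof (intro exI[of _ tree_partition_com] exI[of _ 300] allI impI, elim conjE)
  fix n :: nat and E es and w s :: "nat \<Rightarrow> real" and w0 :: real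
  assume inst: "instance_ok n E w s" and es: "lists_edges es E" and w: "\<forall>i\<in>{1..n}. w i = 1"
  show "solves_within tree_partition_com (300 * (max 1 w0 * real n ^ 2)) n E es w s w0"
  proof (cases "1 \<le> w0")
    case True
    from wp_tree_partition[OF inst es w True] True show ?thesis
      unfolding wp_def solves_within_def correct_output_def optimal_partition_def is_arg_min_def
      by (auto simp: max_def)
  next
    \<comment> \<open>Even here the test of \<open>w0\<close> costs one step, which a multiple of
      \<open>w0 * real n ^ 2\<close> need not cover; hence \<open>max 1 w0\<close> in the
      bound.\<close>
    case False
    let ?\<sigma> = "input_memory n es w s w0"
    have "wp tree_partition_com ?\<sigma> (\<lambda>t \<tau>. t = 1 \<and> \<tau> = ?\<sigma>)"
      using False by (simp add: tree_partition_com_def input_memory_def)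
    then have "runs tree_partition_com ?\<sigma> 1 ?\<sigma>" by (simp add: wp_def)
    moreover have "correct_output n E w s w0 ?\<sigma>"
      using infeasible[OF inst w] False by (simp add: correct_output_def input_memory_def)
    moreover have "0 < n" using inst by (auto simp: instance_ok_def is_tree_def connected_in_def)
    then have "1 \<le> real n ^ 2" by simp
    then have "1 \<le> 300 * (max 1 w0 * real n ^ 2)" using False by (simp add: max_def)
    ultimately show ?thesis unfolding solves_within_def by (intro exI conjI) auto
  qed
qed

end
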